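(* Fix a small $\delta>0$ and positive integers $n$ and $r$. As $\mu\to\infty$ with $\lambda=\kappa/\mu\in[0,1-\delta]$ (i.e. for all sufficiently large $\mu$ and all such $\lambda$), one has $$M_{\kappa,\mu}(\mu z)=(4\mu)^{\mu}\{2(1-\lambda)\}^{\kappa}\left(\frac{2\mu z}{Z}\right)^{1/2}\exp\left\{\mu(\xi-1)+\sum_{s=1}^{n-1}\frac{\hat E_s(z)-\hat E_s(0)}{\mu^s}\right\}\{1+\eta_{n,1}(\mu,z)\}$$ and $$W_{\kappa,\mu}(\mu z)=\left(\frac{\mu}{2e}\right)^{\kappa}\frac{1}{(1-\lambda)^{\mu}}\left(\frac{z}{Z}\right)^{1/2}\exp\left\{-\mu\xi+\sum_{s=1}^{n-1}(-1)^s\frac{\hat E_s(z)}{\mu^s}\right\}\{1+\eta_{n,2}(\mu,z)\},$$ where for $z\in Z_1(\delta)$ $$|\eta_{n,1}(\mu,z)|\le\left|\exp\left\{\sum_{s=n}^{n+r-1}\frac{\hat E_s(z)-\hat E_s(0)}{\mu^s}\right\}-1\right|+\frac{\omega_{n+r,1}(\mu,z)}{\mu^{n+r}}\exp\left\{\frac{\varpi_{n+r,1}(\mu,z)}{\mu}+\sum_{s=n}^{n+r-1}\frac{\Re\{\hat E_s(z)\}-\hat E_s(0)}{\mu^s}+\frac{\omega_{n+r,1}(\mu,z)}{\mu^{n+r}}\right\},$$ and for $z\in Z_2(\delta)$ $$|\eta_{n,2}(\mu,z)|\le\left|\exp\left\{\sum_{s=n}^{n+r-1}(-1)^s\frac{\hat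 E_s(z)}{\mu^s}\right\}-1\right|+\frac{\omega_{n+r,2}(\mu,z)}{\mu^{n+r}}\exp\left\{\frac{\varpi_{n+r,2}(\mu,z)}{\mu}+\sum_{s=n}^{n+r-1}(-1)^s\frac{\Re\{\hat E_s(z)\}}{\mu^s}+\frac{\omega_{n+r,2}(\mu,z)}{\mu^{n+r}}\right\}.$$ Here, for $j=1,2$, $$\omega_{n,j}(\mu,z)=\int_{\mathscr L_j(z)}\left|\frac{Z(t)\hat F_n(t)\,dt}{t}\right|+\sum_{s=1}^{n-1}\frac{1}{2\mu^s}\int_{\mathscr L_j(z)}\left|\frac{Z(t)\hat G_{n,s}(t)\,dt}{t}\right|,\qquad \varpi_{n,j}(\mu,z)=\sum_{s=0}^{n-2}\frac{2}{\mu^s}\int_{\mathscr L_j(z)}\left|\frac{Z(t)\hat F_{s+1}(t)\,dt}{t}\right|,$$ where $\mathscr L_j(z)$ is a progressive path linking $z$ to the singularity $z^{(j)}$ ($z^{(1)}=0$, $z^{(2)}=+\infty$), and $$\hat G_{n,s}(z)=\sum_{k=s}^{n-1}\hat F_k(z)\hat F_{s+n-k-1}(z).$$ In the formula for $W_{\kappa,\mu}(\mu z)$ all multivalued functions take their principal values. In the formula for $M_{\kappa,\mu}(\mu z)$ they take their principal values except when $z\in S_1$, in which case $\xi$, $Z$, $(z/Z)^{1/2}$ and the $\hat E_s(z)$ denote the values obtained by analytic continuation from $S_{-1}$ into $S_1$ across the curve $\gamma_2$.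
   Context: $M_{\kappa,\mu}$ and $W_{\kappa,\mu}$ are the Whittaker functions, solutions of $y''=\left(\frac{\mu^2-1/4}{z^2}-\frac{\kappa}{z}+\frac14\right)y$, with $M_{\kappa,\mu}(z)\sim z^{\mu+1/2}$ as $z\to0$ and $W_{\kappa,\mu}(z)\sim z^\kappa e^{-z/2}$ as $z\to\infty$, $|\arg z|\le\frac32\pi-\delta$. Here $\mu>0$, $\kappa=\lambda\mu$ are real and $\mathbb C^+=\{z\ne0:0\le\arg z\le\pi\}$. $\delta$ denotes an arbitrary small positive constant. **Turning point and Liouville variable.** Put $f(z)=\frac{z^2-4\lambda z+4}{4z^2}$. For $0\le\lambda<1$ its zero in the upper half plane is $z^+=z^+(\lambda)=2\lambda+2i\sqrt{1-\lambda^2}$. Let $$Z=Z(z)=(z^2-4\lambda z+4)^{1/2},\qquad \xi=\xi(z)=\tfrac12Z-\lambda\ln(Z+z-2\lambda)-\ln\left(\frac{Z-\lambda z+2}{z}\right),$$ so that $d\xi/dz=f^{1/2}(z)=Z/(2z)$. **Curves and regions.** Three level curves $\Re\,\xi(z)=\Re\,\xi(z^+)$ in $\mathbb C^+$ emanate from $z^+$ and divide $\mathbb C^+$ into three regions: $S_{-1}$ (bounded, having $z^{(1)}=0$ on its boundary), $S_0$ (containing the end $z^{(2)}=+\infty$ of the positive real axis) and $S_1$ (containing the end $z^{(3)}=\infty e^{\pi i}$ of the negative real axis). The curve separating $S_0$ and $S_1$ is $\gamma_1$, the one separating $S_{-1}$ and $S_1$ is $\gamma_2$, and the one separating $S_{-1}$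 and $S_0$ is $\gamma_3$. $Z_j(\delta)$ ($j=1,2,3$) is the set of points of $\mathbb C^+$ whose distance to $\gamma_j$ is at least $\delta$. **Principal values.** With a branch cut along $\gamma_2$, the principal values of $Z$, $\xi$, $(z/Z)^{1/2}$ are the branches continuous in $\mathbb C^+\setminus\gamma_2$ for which $Z>0$, $\xi$ is real and $(z/Z)^{1/2}>0$ for $z\in(0,\infty)$ (so $(z/Z)^{1/2}\to1$ as $z\to\infty$ in $\mathbb C^+$). **Progressive paths.** A path $\mathscr L_j(z)$ from $z^{(j)}$ to $z\in Z_j(\delta)$ is progressive if (i) it is a finite chain of $R_2$ arcs (arcs with a parametrization having continuous second derivative and nonvanishing first derivative); (ii) $\Re\,\xi(t)$ is monotonic as $t$ passes along it from $z^{(j)}$ to $z$, with the branch of $\xi(t)$ taken continuous in $Z_j(\delta)$; (iii) $|t-z^+|\ge\delta$ for all $t$ on it. $Z_j(\delta)$ is such that all its points can be linked to $z^{(j)}$ by such a path. **Coefficients.** $$\hat F_1(z)=-\frac{z(z^3-16z+4\lambda^2z+16\lambda)}{2Z^6},\qquad \hat F_2(z)=-\frac zZ\frac{d\hat F_1(z)}{dz},$$ $$\hat F_{s+1}(z)=-\frac zZ\frac{d\hat F_s(z)}{dz}-\frac12\sum_{j=1}^{s-1}\hat F_j(z)\hat F_{s-j}(z)\quad(s\ge2),\qquad \hat E_s(z)=\frac12\int_\infty^z\frac{Z(t)\hat F_s(t)}{t}\,dt\quad(s\ge1),$$ whose principal values are those with $Z$ principal and the integration path in $\mathbb C^+\setminus\gamma_2$;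 $\hat E_s(0)$ is the limit of the principal value as $z\to0$. *)

theory Defs
  imports "HOL-Complex_Analysis.Complex_Analysis"
begin

text \<open>
  A function \<open>y\<close> on the Riemann surface of the logarithm is represented by the entire function
  \<open>Y\<close> for which \<open>Y w\<close> is the value of \<open>y\<close> at the point \<open>exp w\<close> with argument \<open>Im w\<close>. Thus
  \<open>y'' = (Y'' - Y') / (exp w)\<^sup>2\<close>, and the value of \<open>y\<close> at \<open>z\<close> with \<open>0 \<le> arg z \<le> \<pi>\<close> is \<open>Y (Ln z)\<close>.
\<close>

definition whittaker_solution :: "real \<Rightarrow> real \<Rightarrow> (complex \<Rightarrow> complex) \<Rightarrow> bool" where
  "whittaker_solution \<kappa> \<mu> Y \<longleftrightarrow> Y holomorphic_on UNIV \<and>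
     (\<forall>w. (deriv (deriv Y) w - deriv Y w) / (exp w)\<^sup>2 =
        ((of_real \<mu> ^ 2 - 1/4) / (exp w)\<^sup>2 - of_real \<kappa> / exp w + 1/4) * Y w)"

text \<open>\<open>M(z) \<sim> z powr (\<mu> + 1/2)\<close> as \<open>z \<rightarrow> 0\<close>; for \<open>\<mu> > 0\<close> this determines the solution.\<close>

definition is_whittaker_M :: "real \<Rightarrow> real \<Rightarrow> (complex \<Rightarrow> complex) \<Rightarrow> bool" where
  "is_whittaker_M \<kappa> \<mu> Y \<longleftrightarrow> whittaker_solution \<kappa> \<mu> Y \<and>
     ((\<lambda>w. Y w / exp ((of_real \<mu> + 1/2) * w)) \<longlongrightarrow> 1) (filtercomap Re at_bot)"

text \<open>\<open>W(z) \<sim> z powr \<kappa> * exp (-z/2)\<close> as \<open>z \<rightarrow> \<infinity>\<close> in \<open>\<bar>arg z\<bar> \<le> 3\<pi>/2 - \<epsilon>\<close>, for every \<open>\<epsilon> > 0\<close>;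
  this determines the solution.\<close>

definition is_whittaker_W :: "real \<Rightarrow> real \<Rightarrow> (complex \<Rightarrow> complex) \<Rightarrow> bool" where
  "is_whittaker_W \<kappa> \<mu> Y \<longleftrightarrow> whittaker_solution \<kappa> \<mu> Y \<and>
     (\<forall>\<epsilon>>0. ((\<lambda>w. Y w / exp (of_real \<kappa> * w - exp w / 2)) \<longlongrightarrow> 1)
        (inf (filtercomap Re at_top) (principal {w. \<bar>Im w\<bar> \<le> 3/2 * pi - \<epsilon>})))"

definition Cplus :: "complex set" where
  "Cplus = {z. z \<noteq> 0 \<and> 0 \<le> Arg z \<and> Arg z \<le> pi}"

definition Zsq :: "real \<Rightarrow> complex \<Rightarrow> complex" where
  "Zsq lam z = z\<^sup>2 - 4 * of_real lam * z + 4"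

definition zplus :: "real \<Rightarrow> complex" where
  "zplus lam = 2 * of_real lam + 2 * \<i> * of_real (sqrt (1 - lam\<^sup>2))"

text \<open>The real part of \<open>\<xi>(z)\<close> when \<open>Z(z)\<close> has the value \<open>v\<close>; it does not depend on the branches of
  the logarithms.\<close>

definition Re_xi :: "real \<Rightarrow> complex \<Rightarrow> complex \<Rightarrow> real" where
  "Re_xi lam v z = Re v / 2 - lam * ln (norm (v + z - 2 * of_real lam))
                     - ln (norm ((v - of_real lam * z + 2) / z))"

text \<open>
  The union of the level curves \<open>Re \<xi>(z) = Re \<xi>(z\<^sup>+)\<close>. Changing the sign of \<open>Z\<close> replaces
  \<open>Re \<xi>(z)\<close> by \<open>2 Re \<xi>(z\<^sup>+) - Re \<xi>(z)\<close>, so the choice of the square root \<open>v\<close> is immaterial.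
\<close>

definition level_set :: "real \<Rightarrow> complex set" where
  "level_set lam =
     {z \<in> Cplus. \<exists>v. v\<^sup>2 = Zsq lam z \<and> Re_xi lam v z = Re_xi lam 0 (zplus lam)}"

definition S_m1 :: "real \<Rightarrow> complex set" where
  "S_m1 lam = {z \<in> Cplus - level_set lam.
     bounded (connected_component_set (Cplus - level_set lam) z) \<and>
     0 \<in> frontier (connected_component_set (Cplus - level_set lam) z)}"

definition S_0 :: "real \<Rightarrow> complex set" where
  "S_0 lam = {z. \<exists>R>0. \<forall>x\<ge>R. connected_component (Cplus - level_set lam) z (of_real x)}"

definition S_1 :: "real \<Rightarrow> complex set" where
  "S_1 lam = {z. \<exists>R>0. \<forall>x\<ge>R. connected_component (Cplus - level_set lam) z (of_real (- x))}"

text \<open>The curves separating the regions; each contains its end point \<open>z\<^sup>+\<close>.\<close>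

definition gamma1 :: "real \<Rightarrow> complex set" where
  "gamma1 lam = Cplus \<inter> closure (S_0 lam) \<inter> closure (S_1 lam)"

definition gamma2 :: "real \<Rightarrow> complex set" where
  "gamma2 lam = Cplus \<inter> closure (S_m1 lam) \<inter> closure (S_1 lam)"

definition away_from :: "complex set \<Rightarrow> real \<Rightarrow> complex set" where
  "away_from C \<delta> = {z \<in> Cplus. infdist z C \<ge> \<delta>}"

definition Z1_region :: "real \<Rightarrow> real \<Rightarrow> complex set" where
  "Z1_region lam \<delta> = away_from (gamma1 lam) \<delta>"

definition Z2_region :: "real \<Rightarrow> real \<Rightarrow> complex set" where
  "Z2_region lam \<delta> = away_from (gamma2 lam) \<delta>"

text \<open>Complex derivative relative to a set: the sets used below contain parts of the real axis but no
  points of the lower half plane.\<close>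

definition deriv_within :: "complex set \<Rightarrow> (complex \<Rightarrow> complex) \<Rightarrow> complex \<Rightarrow> complex" where
  "deriv_within D g z = (THE d. (g has_field_derivative d) (at z within D))"

text \<open>The coefficients belonging to a branch \<open>Z\<close> on \<open>D\<close>; the value at \<open>s = 0\<close> is not used.
  For \<open>s = 1\<close> the sum in the recursion is empty.\<close>

fun Fhat :: "complex set \<Rightarrow> (complex \<Rightarrow> complex) \<Rightarrow> real \<Rightarrow> nat \<Rightarrow> complex \<Rightarrow> complex" where
  "Fhat D Z lam 0 = (\<lambda>z. 0)"
| "Fhat D Z lam (Suc 0) = (\<lambda>z.
     - (z * (z^3 - 16 * z + 4 * (of_real lam)\<^sup>2 * z + 16 * of_real lam)) / (2 * Z z ^ 6))"
| "Fhat D Z lam (Suc (Suc m)) = (\<lambda>z.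
     - (z / Z z) * deriv_within D (Fhat D Z lam (Suc m)) z
     - 1/2 * (\<Sum>j=1..m. Fhat D Z lam j z * Fhat D Z lam (Suc m - j) z))"

definition Ghat ::
  "complex set \<Rightarrow> (complex \<Rightarrow> complex) \<Rightarrow> real \<Rightarrow> nat \<Rightarrow> nat \<Rightarrow> complex \<Rightarrow> complex" where
  "Ghat D Z lam n s z = (\<Sum>k=s..n-1. Fhat D Z lam k z * Fhat D Z lam (s + n - k - 1) z)"

text \<open>\<open>I\<close> is the integral of \<open>g\<close> from \<open>+\<infinity>\<close> to \<open>z\<close> inside \<open>D\<close>: along the real axis from \<open>+\<infinity>\<close> to
  some \<open>R > 0\<close>, then along any path in \<open>D\<close> from \<open>R\<close> to \<open>z\<close>.\<close>

definition integral_from_infinity ::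
  "complex set \<Rightarrow> (complex \<Rightarrow> complex) \<Rightarrow> complex \<Rightarrow> complex \<Rightarrow> bool" where
  "integral_from_infinity D g z I \<longleftrightarrow>
     (\<forall>R>0. \<forall>p. valid_path p \<and> path_image p \<subseteq> D \<and>
        pathstart p = of_real R \<and> pathfinish p = z \<longrightarrow>
        I = contour_integral p g - integral {R..} (\<lambda>x. g (of_real x)))"

text \<open>Simultaneous choices of \<open>Z\<close>, \<open>\<xi>\<close>, \<open>(z/Z)\<^sup>1\<^sup>/\<^sup>2\<close> and of the coefficients \<open>E\<^sub>s\<close>.\<close>

record branches =
  bZ :: "complex \<Rightarrow> complex"
  bxi :: "complex \<Rightarrow> complex"
  bq :: "complex \<Rightarrow> complex"
  bE :: "nat \<Rightarrow> complex \<Rightarrow> complex"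

text \<open>The branches continuous in \<open>D\<close> with \<open>Z > 0\<close>, \<open>\<xi>\<close> real and \<open>(z/Z)\<^sup>1\<^sup>/\<^sup>2 > 0\<close> on \<open>(0,\<infinity>)\<close>.
  Here \<open>L1\<close> and \<open>L2\<close> are the two logarithms in the definition of \<open>\<xi>\<close>.\<close>

definition branches_on :: "real \<Rightarrow> complex set \<Rightarrow> branches \<Rightarrow> bool" where
  "branches_on lam D B \<longleftrightarrow>
     continuous_on D (bZ B) \<and> (\<forall>z\<in>D. (bZ B z)\<^sup>2 = Zsq lam z) \<and>
     (\<forall>x>0. bZ B (of_real x) \<in> \<real> \<and> Re (bZ B (of_real x)) > 0) \<and>
     (\<exists>L1 L2. continuous_on D L1 \<and> continuous_on D L2 \<and>
        (\<forall>z\<in>D. exp (L1 z) = bZ B z + z - 2 * of_real lam \<and>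
               exp (L2 z) = (bZ B z - of_real lam * z + 2) / z \<and>
               bxi B z = bZ B z / 2 - of_real lam * L1 z - L2 z)) \<and>
     (\<forall>x>0. bxi B (of_real x) \<in> \<real>) \<and>
     continuous_on D (bq B) \<and> (\<forall>z\<in>D. (bq B z)\<^sup>2 = z / bZ B z) \<and>
     (\<forall>x>0. bq B (of_real x) \<in> \<real> \<and> Re (bq B (of_real x)) > 0) \<and>
     (\<forall>s\<ge>1. \<forall>z\<in>D. integral_from_infinity D (\<lambda>t. bZ B t * Fhat D (bZ B) lam s t / t) z
                     (2 * bE B s z))"

definition D1 :: "real \<Rightarrow> complex set" where
  "D1 lam = Cplus - gamma1 lam"

definition D2 :: "real \<Rightarrow> complex set" where
  "D2 lam = Cplus - gamma2 lam"

definition principal_branches :: "real \<Rightarrow> branches \<Rightarrow> bool" where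
  "principal_branches lam P \<longleftrightarrow> branches_on lam (D2 lam) P"

text \<open>\<open>C\<close> has the principal values \<open>P\<close> except in \<open>S_1\<close> and on \<open>gamma2\<close>, where it has the values
  continued from \<open>S_m1\<close> across \<open>gamma2\<close>: its members are branches continuous in the half plane cut
  along \<open>gamma1\<close> instead of \<open>gamma2\<close>.\<close>

definition continued_branches :: "real \<Rightarrow> branches \<Rightarrow> branches \<Rightarrow> bool" where
  "continued_branches lam P C \<longleftrightarrow> branches_on lam (D1 lam) C \<and>
     (\<forall>z \<in> D1 lam - (S_1 lam \<union> gamma2 lam).
        bZ C z = bZ P z \<and> bxi C z = bxi P z \<and> bq C z = bq P z \<and> (\<forall>s\<ge>1. bE C s z = bE P s z))"

definition E_at_0 :: "real \<Rightarrow> branches \<Rightarrow> nat \<Rightarrow> complex" where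
  "E_at_0 lam P s = Lim (at 0 within D2 lam) (bE P s)"

definition R2_arc_on :: "(real \<Rightarrow> complex) \<Rightarrow> real set \<Rightarrow> bool" where
  "R2_arc_on p I \<longleftrightarrow> (\<exists>p' p''. \<forall>\<tau>\<in>I.
     (p has_vector_derivative p' \<tau>) (at \<tau> within I) \<and>
     (p' has_vector_derivative p'' \<tau>) (at \<tau> within I) \<and>
     continuous (at \<tau> within I) p'' \<and> p' \<tau> \<noteq> 0)"

text \<open>Paths are parametrized by \<open>(0,1]\<close>; the singularity from which the path starts is the limit at
  \<open>0\<close> and need not be finite. The first arc has the half-open parameter interval \<open>(0, a 1]\<close>.\<close>

definition R2_chain :: "(real \<Rightarrow> complex) \<Rightarrow> bool" where
  "R2_chain p \<longleftrightarrow> (\<exists>m (a :: nat \<Rightarrow> real). a 0 = 0 \<and> a m = 1 \<and>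
     (\<forall>i<m. a i < a (Suc i) \<and> R2_arc_on p ({a i..a (Suc i)} \<inter> {0<..1})))"

definition starts_at_0 :: "(real \<Rightarrow> complex) \<Rightarrow> bool" where
  "starts_at_0 p \<longleftrightarrow> (p \<longlongrightarrow> 0) (at_right 0)"

definition starts_at_plus_infinity :: "(real \<Rightarrow> complex) \<Rightarrow> bool" where
  "starts_at_plus_infinity p \<longleftrightarrow>
     filterlim p at_infinity (at_right 0) \<and> ((\<lambda>\<tau>. Arg (p \<tau>)) \<longlongrightarrow> 0) (at_right 0)"

definition progressive :: "real \<Rightarrow> real \<Rightarrow> complex set \<Rightarrow> branches \<Rightarrow> (real \<Rightarrow> complex) \<Rightarrow> bool" where
  "progressive lam \<delta> D B p \<longleftrightarrow>
     R2_chain p \<and> p ` {0<..1} \<subseteq> D \<and>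
     (mono_on {0<..1} (\<lambda>\<tau>. Re (bxi B (p \<tau>))) \<or> antimono_on {0<..1} (\<lambda>\<tau>. Re (bxi B (p \<tau>)))) \<and>
     (\<forall>\<tau>\<in>{0<..1}. dist (p \<tau>) (zplus lam) \<ge> \<delta>)"

definition progressive1 ::
  "real \<Rightarrow> real \<Rightarrow> branches \<Rightarrow> (real \<Rightarrow> complex) \<Rightarrow> complex \<Rightarrow> bool" where
  "progressive1 lam \<delta> C p z \<longleftrightarrow>
     progressive lam \<delta> (D1 lam) C p \<and> starts_at_0 p \<and> p 1 = z"

definition progressive2 ::
  "real \<Rightarrow> real \<Rightarrow> branches \<Rightarrow> (real \<Rightarrow> complex) \<Rightarrow> complex \<Rightarrow> bool" where
  "progressive2 lam \<delta> P p z \<longleftrightarrow>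
     progressive lam \<delta> (D2 lam) P p \<and> starts_at_plus_infinity p \<and> p 1 = z"

text \<open>The integral of \<open>\<bar>g(t) dt\<bar>\<close> along \<open>p\<close>; \<open>vector_derivative\<close> is unspecified at the finitely many
  corners of a chain.\<close>

definition speed_weighted :: "(real \<Rightarrow> complex) \<Rightarrow> (complex \<Rightarrow> complex) \<Rightarrow> real \<Rightarrow> real" where
  "speed_weighted p g \<tau> = norm (g (p \<tau>)) * norm (vector_derivative p (at \<tau>))"

definition abs_integral :: "(real \<Rightarrow> complex) \<Rightarrow> (complex \<Rightarrow> complex) \<Rightarrow> real" where
  "abs_integral p g = integral {0<..1} (speed_weighted p g)"

definition abs_integrable :: "(real \<Rightarrow> complex) \<Rightarrow> (complex \<Rightarrow> complex) \<Rightarrow> bool" where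
  "abs_integrable p g \<longleftrightarrow> speed_weighted p g integrable_on {0<..1}"

definition omega ::
  "real \<Rightarrow> complex set \<Rightarrow> (complex \<Rightarrow> complex) \<Rightarrow> nat \<Rightarrow> real \<Rightarrow> (real \<Rightarrow> complex) \<Rightarrow> real" where
  "omega lam D Z n \<mu> p =
     abs_integral p (\<lambda>t. Z t * Fhat D Z lam n t / t) +
     (\<Sum>s=1..n-1. 1 / (2 * \<mu> ^ s) * abs_integral p (\<lambda>t. Z t * Ghat D Z lam n s t / t))"

definition varpi ::
  "real \<Rightarrow> complex set \<Rightarrow> (complex \<Rightarrow> complex) \<Rightarrow> nat \<Rightarrow> real \<Rightarrow> (real \<Rightarrow> complex) \<Rightarrow> real" where
  "varpi lam D Z n \<mu> p =
     (\<Sum>s<n-1. 2 / \<mu> ^ s * abs_integral p (\<lambda>t. Z t * Fhat D Z lam (s + 1) t / t))"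

text \<open>All integrals occurring in \<open>omega\<close> and \<open>varpi\<close> are finite. (If one of them diverges, its
  value is \<open>\<infinity>\<close> in the mathematical text, whereas \<open>integral\<close> would return \<open>0\<close>.)\<close>

definition finite_integrals ::
  "real \<Rightarrow> complex set \<Rightarrow> (complex \<Rightarrow> complex) \<Rightarrow> nat \<Rightarrow> (real \<Rightarrow> complex) \<Rightarrow> bool" where
  "finite_integrals lam D Z n p \<longleftrightarrow>
     (\<forall>s\<in>{1..n}. abs_integrable p (\<lambda>t. Z t * Fhat D Z lam s t / t)) \<and>
     (\<forall>s\<in>{1..n-1}. abs_integrable p (\<lambda>t. Z t * Ghat D Z lam n s t / t))"

end

theory Submission
  imports Defs
begin

text \<open>
  Along a path, let \<open>h\<close> be the ratio of the solution and of \<open>(z/Z)\<^sup>1\<^sup>/\<^sup>2 exp (u \<xi> + \<Sum> E\<^sub>s / u\<^sup>s)\<close>, where \<open>u = \<mu>\<close>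
  for \<open>M\<close> and \<open>u = -\<mu>\<close> for \<open>W\<close>, and let \<open>k = dh/d\<xi>\<close>. By the recursion for the coefficients the
  denominator solves the equation up to a relative error \<open>R\<close> of order \<open>u\<^sup>1\<^sup>-\<^sup>N\<close>. Hence \<open>h + k/2u\<close> and
  \<open>-k/2u\<close> satisfy a first order system whose only large coefficient, \<open>-2u\<close>, is damping in the
  direction of increasing \<open>Re (u \<xi>)\<close>. On a progressive path Gronwall's inequality therefore bounds
  \<open>h - 1\<close> by the integrals \<open>\<omega>\<close> and \<open>\<varpi>\<close>; the start values \<open>h = 1\<close> and \<open>k = 0\<close> at the singularity come from
  the asymptotics that define \<open>M\<close> and \<open>W\<close>, together with Cauchy's estimate for the derivative.

  Hardly anything about the level curves is needed. A cut that misses \<open>z\<^sup>+\<close> admits no continuous branch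
  of \<open>(z/Z)\<^sup>1\<^sup>/\<^sup>2\<close>, so the existence of the branches shows that \<open>S_m1\<close> is not empty; as it is the component
  of the points near \<open>0\<close> and bounded, \<open>S_1\<close> and both cuts stay away from \<open>0\<close>, and the cut \<open>gamma2\<close>
  stays away from \<open>\<infinity>\<close>.
\<close>

section \<open>Branches of inverse functions and Gronwall inequalities\<close>

text \<open>The sets \<open>Cplus - K\<close> contain parts of the real axis, and the
  \<open>E_s\<close> are known only through integrals along paths, so the calculus of holomorphic
  functions on open sets does not apply to them. Derivatives are taken relative to the set, and
  \<open>E_s\<close> is differentiated only along a given path whose points can be joined to the
  positive axis. A path also starts at a singularity outside its parameter interval: estimates are
  proved on \<open>[\<epsilon>, 1]\<close> and then \<open>\<epsilon>\<close> tends to 0, which is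
  why limits of \<open>h\<close> and \<open>k\<close> are needed. In the variable
  \<open>\<xi>\<close> the equation for \<open>h\<close> reads
  \<open>h'' + 2 (u + \<sigma>) h' + R h = 0\<close>, where \<open>\<sigma>\<close> is the
  derivative of \<open>\<Sum> E_s / u^s\<close>. The constants of the theorem come out exactly: the
  source \<open>R / 2u\<close> contributes half of \<open>\<omega> / \<mu>^N\<close>, and the factor
  2 returns when \<open>h - 1\<close> is bounded by the two components together. The form with
  \<open>n\<close> and \<open>r\<close> is the case \<open>N = n + r\<close>, the last
  \<open>r\<close> terms of the exponent being moved into the error factor.\<close>

lemma has_field_derivative_of_compose:
  fixes f :: "complex \<Rightarrow> complex"
  assumes \<phi>: "(\<phi> has_field_derivative c) (at (f z))" and "c \<noteq> 0"
    and cont: "continuous (at z within S) f"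
    and comp: "((\<lambda>x. \<phi> (f x)) has_field_derivative d) (at z within S)"
  shows "(f has_field_derivative d / c) (at z within S)"
proof -
  \<comment> \<open>Caratheodory's form of differentiability avoids dividing by
    \<open>f x - f z\<close>, which may vanish: the difference quotient of the composition is that
    of \<open>f\<close> times \<open>k (f x)\<close>, and \<open>k (f x)\<close> tends to
    \<open>c \<noteq> 0\<close>.\<close>
  obtain k where k: "\<And>y. \<phi> y - \<phi> (f z) = k y * (y - f z)" "isCont k (f z)" "k (f z) = c"
    using \<phi> by (auto simp: CARAT_DERIV)
  have lim_k: "((\<lambda>x. k (f x)) \<longlongrightarrow> c) (at z within S)"
    using isCont_tendsto_compose[OF k(2), of f "at z within S"] cont k(3)
    by (simp add: continuous_within)
  have "((\<lambda>x. (\<phi> (f x) - \<phi> (f z)) / (x - z) / k (f x)) \<longlongrightarrow> d / c) (at z within S)"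
    using comp \<open>c \<noteq> 0\<close> unfolding has_field_derivative_iff by (intro tendsto_divide lim_k)
  moreover have "\<forall>\<^sub>F x in at z within S.
      (\<phi> (f x) - \<phi> (f z)) / (x - z) / k (f x) = (f x - f z) / (x - z)"
    using tendsto_imp_eventually_ne[OF lim_k \<open>c \<noteq> 0\<close>] by eventually_elim (simp add: k(1))
  ultimately show ?thesis
    unfolding has_field_derivative_iff by (rule Lim_transform_eventually)
qed

lemma connected_power2_eq_1:
  fixes f :: "complex \<Rightarrow> complex"
  assumes "connected S" "continuous_on S f" "\<And>z. z \<in> S \<Longrightarrow> (f z)\<^sup>2 = 1" "z0 \<in> S" "f z0 = 1" "z \<in> S"
  shows "f z = 1"
proof -
  have "f ` S \<subseteq> {1, -1}" using assms(3) by (auto simp: power2_eq_1_iff)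
  then have "finite (f ` S)" by (rule finite_subset) simp
  then have "f constant_on S"
    using assms by (intro continuous_finite_range_constant)
  then show ?thesis using assms(4-6) by (auto simp: constant_on_def)
qed

text \<open>The values lie in the discrete set of multiples of \<open>2 \<pi> \<i>\<close>. Only the
  fact that the constant is imaginary is kept: two such constants enter \<open>\<xi>\<close> with
  weights \<open>lam\<close> and 1, and what can be determined is their weighted sum.\<close>

lemma connected_exp_eq_1:
  fixes f :: "complex \<Rightarrow> complex"
  assumes "connected S" "continuous_on S f" "\<And>z. z \<in> S \<Longrightarrow> exp (f z) = 1"
  obtains c where "\<And>z. z \<in> S \<Longrightarrow> f z = \<i> * of_real c"
proof (cases "S = {}")
  case False
  then obtain z0 where z0: "z0 \<in> S" by auto
  have "f constant_on S"
  proof (rule continuous_discrete_range_constant[OF assms(1,2)])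
    fix x assume x: "x \<in> S"
    have "2 * pi \<le> norm (f y - f x)" if "y \<in> S" "f y \<noteq> f x" for y
    proof -
      have "exp (f y) = exp (f x)" using assms(3) x that by simp
      then obtain n :: int where n: "f y = f x + of_int (2 * n) * of_real pi * \<i>"
        by (auto simp: exp_eq)
      with that have "n \<noteq> 0" by auto
      then have "1 \<le> \<bar>of_int n :: real\<bar>" by linarith
      moreover have "norm (f y - f x) = 2 * pi * \<bar>of_int n\<bar>"
        by (simp add: n norm_mult)
      ultimately show ?thesis by simp
    qed
    then show "\<exists>e>0. \<forall>y. y \<in> S \<and> f y \<noteq> f x \<longrightarrow> e \<le> norm (f y - f x)"
      by (intro exI[of _ "2 * pi"]) auto
  qed
  then obtain k where k: "\<And>z. z \<in> S \<Longrightarrow> f z = k" by (auto simp: constant_on_def)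
  have "exp k = 1" using assms(3) z0 k by metis
  then have "Re k = 0" by (simp add: exp_eq_1)
  then have "k = \<i> * of_real (Im k)" by (simp add: complex_eq_iff)
  with k that show ?thesis by metis
qed (use that in auto)

text \<open>If \<open>I\<close> denotes the right side of the integral inequality, its derivative
  exceeds \<open>a I\<close> by at most \<open>b\<close>. After multiplication by
  \<open>exp (- \<integral> a)\<close>, which is at most 1, subtracting \<open>\<integral> b\<close>
  leaves a nonincreasing function \<open>G\<close>.\<close>

lemma Gronwall_integral:
  fixes m a b :: "real \<Rightarrow> real"
  assumes "s \<le> t" and cont: "continuous_on {s..t} m" "continuous_on {s..t} a" "continuous_on {s..t} b"
    and nonneg: "\<And>x. x \<in> {s..t} \<Longrightarrow> 0 \<le> a x" "\<And>x. x \<in> {s..t} \<Longrightarrow> 0 \<le> b x"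
    and le: "\<And>x. x \<in> {s..t} \<Longrightarrow> m x \<le> c + integral {s..x} (\<lambda>y. a y * m y + b y)"
  shows "m t \<le> (c + integral {s..t} b) * exp (integral {s..t} a)"
proof -
  define I where "I x = c + integral {s..x} (\<lambda>y. a y * m y + b y)" for x
  define G where "G x = I x * exp (- integral {s..x} a) - integral {s..x} b" for x
  have D: "(G has_real_derivative
      (a x * m x + b x) * exp (- integral {s..x} a) - I x * a x * exp (- integral {s..x} a) - b x)
      (at x within {s..t})" if "x \<in> {s..t}" for x
  proof -
    have "(I has_real_derivative a x * m x + b x) (at x within {s..t})"
      unfolding I_def using that cont
      by (auto intro!: derivative_eq_intros integral_has_real_derivative continuous_intros)
    moreover have "((\<lambda>x. integral {s..x} a) has_real_derivative a x) (at x within {s..t})"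
      using that cont by (intro integral_has_real_derivative) auto
    moreover have "((\<lambda>x. integral {s..x} b) has_real_derivative b x) (at x within {s..t})"
      using that cont by (intro integral_has_real_derivative) auto
    ultimately show ?thesis
      unfolding G_def by (auto intro!: derivative_eq_intros)
  qed
  have Dle: "(a x * m x + b x) * exp (- integral {s..x} a) - I x * a x * exp (- integral {s..x} a) - b x \<le> 0"
    if x: "x \<in> {s..t}" for x
  proof -
    have "a x * m x \<le> a x * I x" using le[OF x] nonneg(1)[OF x] by (simp add: I_def mult_left_mono)
    then have "(a x * m x - I x * a x) * exp (- integral {s..x} a) \<le> 0"
      by (intro mult_nonpos_nonneg) (auto simp: mult.commute)
    moreover have "0 \<le> integral {s..x} a"
      using x nonneg by (intro integral_nonneg integrable_continuous_interval
          continuous_on_subset[OF cont(2)]) auto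
    then have "b x * exp (- integral {s..x} a) \<le> b x * 1"
      using nonneg(2)[OF x] by (intro mult_left_mono) auto
    ultimately show ?thesis by (simp add: algebra_simps)
  qed
  have "G t \<le> G s"
  proof (rule DERIV_nonpos_imp_decreasing_open[OF \<open>s \<le> t\<close>])
    show "\<exists>y. (G has_real_derivative y) (at x) \<and> y \<le> 0" if "s < x" "x < t" for x
      using D[of x] Dle[of x] that by (auto simp: at_within_Icc_at)
    show "continuous_on {s..t} G"
      using D by (meson DERIV_continuous continuous_on_eq_continuous_within)
  qed
  then have "I t * exp (- integral {s..t} a) \<le> c + integral {s..t} b"
    by (simp add: G_def I_def)
  then have "I t \<le> (c + integral {s..t} b) * exp (integral {s..t} a)"
    by (simp add: exp_minus field_simps)
  with le[of t] \<open>s \<le> t\<close> show ?thesis by (simp add: I_def)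
qed

text \<open>The first equation is integrated as it stands, the second with the integrating factor
  \<open>exp (2 u x)\<close>. Because \<open>u Re x\<close> is nondecreasing, the quotients of this
  factor that occur have modulus at most 1, so \<open>u\<close> disappears from the bound. Both
  components then obey one integral inequality with the common majorant \<open>w\<close>.\<close>

lemma two_component_Gronwall:
  fixes y1 y2 x x' \<sigma> \<rho> :: "real \<Rightarrow> complex" and u :: real
  assumes "s \<le> t"
    and x: "\<And>v. v \<in> {s..t} \<Longrightarrow> (x has_vector_derivative x' v) (at v within {s..t})"
    and y1: "\<And>v. v \<in> {s..t} \<Longrightarrow> (y1 has_vector_derivative
       x' v * (2 * \<sigma> v * y2 v - \<rho> v * (y1 v + y2 v))) (at v within {s..t})"
    and y2: "\<And>v. v \<in> {s..t} \<Longrightarrow> (y2 has_vector_derivative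
       x' v * (- 2 * of_real u * y2 v - 2 * \<sigma> v * y2 v + \<rho> v * (y1 v + y2 v))) (at v within {s..t})"
    and cont: "continuous_on {s..t} x'" "continuous_on {s..t} \<sigma>" "continuous_on {s..t} \<rho>"
    and mono: "mono_on {s..t} (\<lambda>v. u * Re (x v))"
  shows "max (norm (y1 t - 1)) (norm (y2 t)) \<le>
      (max (norm (y1 s - 1)) (norm (y2 s)) + integral {s..t} (\<lambda>v. norm (x' v * \<rho> v))) *
      exp (integral {s..t} (\<lambda>v. 2 * norm (x' v * \<sigma> v) + 2 * norm (x' v * \<rho> v)))"
proof -
  define m where "m v = max (norm (y1 v - 1)) (norm (y2 v))" for v
  define w where "w v = 2 * norm (x' v * \<sigma> v) * norm (y2 v) + norm (x' v * \<rho> v) * norm (y1 v + y2 v)" for v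
  define a where "a v = 2 * norm (x' v * \<sigma> v) + 2 * norm (x' v * \<rho> v)" for v
  define b where "b v = norm (x' v * \<rho> v)" for v
  have cont_x: "continuous_on {s..t} x" and cont_y: "continuous_on {s..t} y1" "continuous_on {s..t} y2"
    using x y1 y2 has_vector_derivative_continuous continuous_on_eq_continuous_within by blast+
  note conts = cont cont_x cont_y
  have cont_w: "continuous_on {s..t} w" unfolding w_def by (intro continuous_intros conts)
  have cont_m: "continuous_on {s..t} m" unfolding m_def by (intro continuous_intros conts)
  have cont_a: "continuous_on {s..t} a" unfolding a_def by (intro continuous_intros conts)
  have cont_b: "continuous_on {s..t} b" unfolding b_def by (intro continuous_intros conts)
  have bound1: "norm (y1 v - 1) \<le> norm (y1 s - 1) + integral {s..v} w" if v: "v \<in> {s..t}" for v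
  proof -
    let ?f = "\<lambda>v. x' v * (2 * \<sigma> v * y2 v - \<rho> v * (y1 v + y2 v))"
    have "(?f has_integral y1 v - y1 s) {s..v}"
      using v by (intro fundamental_theorem_of_calculus)
        (auto intro!: has_vector_derivative_within_subset[OF y1])
    then have "y1 v - y1 s = integral {s..v} ?f" by (simp add: integral_unique)
    also have "norm \<dots> \<le> integral {s..v} w"
    proof (rule integral_norm_bound_integral)
      show "?f integrable_on {s..v}" "w integrable_on {s..v}"
        using v by (auto intro!: integrable_continuous_interval continuous_intros
            continuous_on_subset[OF cont_w] conts[THEN continuous_on_subset])
      show "norm (?f q) \<le> w q" for q
      proof -
        have "?f q = 2 * (x' q * \<sigma> q) * y2 q - x' q * \<rho> q * (y1 q + y2 q)" by (simp add: algebra_simps)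
        also have "norm \<dots> \<le> w q"
          unfolding w_def by (rule order.trans[OF norm_triangle_ineq4]) (simp add: norm_mult)
        finally show ?thesis .
      qed
    qed
    finally have "norm (y1 v - y1 s) \<le> integral {s..v} w" .
    moreover have "norm (y1 v - 1) \<le> norm (y1 v - y1 s) + norm (y1 s - 1)"
      using norm_triangle_ineq[of "y1 v - y1 s" "y1 s - 1"] by simp
    ultimately show ?thesis by simp
  qed
  have bound2: "norm (y2 v) \<le> norm (y2 s) + integral {s..v} w" if v: "v \<in> {s..t}" for v
  proof -
    let ?e = "\<lambda>q. exp (2 * of_real u * (x q - x v))"
    let ?f = "\<lambda>q. ?e q * (x' q * (\<rho> q * (y1 q + y2 q) - 2 * \<sigma> q * y2 q))"
    have norm_e: "norm (?e q) \<le> 1" if "q \<in> {s..v}" for q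
      using monotone_onD[OF mono, of q v] that v by (simp add: algebra_simps)
    have "((\<lambda>q. ?e q * y2 q) has_vector_derivative ?f q) (at q within {s..v})" if "q \<in> {s..v}" for q
    proof -
      have 1: "(x has_vector_derivative x' q) (at q within {s..v})"
        "(y2 has_vector_derivative
       x' q * (- 2 * of_real u * y2 q - 2 * \<sigma> q * y2 q + \<rho> q * (y1 q + y2 q))) (at q within {s..v})"
        using that v by (auto intro: has_vector_derivative_within_subset[OF y2[of q, simplified]]
            has_vector_derivative_within_subset[OF x])
      have "((\<lambda>z. exp (2 * of_real u * (z - x v))) has_field_derivative
          exp (2 * of_real u * (x q - x v)) * (2 * of_real u)) (at (x q) within x ` {s..v})"
        by (auto intro!: derivative_eq_intros)
      from field_vector_diff_chain_within[OF 1(1) this]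
      have "(?e has_vector_derivative x' q * (?e q * (2 * of_real u))) (at q within {s..v})"
        by (simp add: o_def)
      from has_vector_derivative_mult[OF this 1(2)] show ?thesis
        by (rule has_vector_derivative_eq_rhs) (simp add: algebra_simps)
    qed
    then have "(?f has_integral ?e v * y2 v - ?e s * y2 s) {s..v}"
      using v by (intro fundamental_theorem_of_calculus) auto
    then have "y2 v - ?e s * y2 s = integral {s..v} ?f" by (simp add: integral_unique)
    also have "norm \<dots> \<le> integral {s..v} w"
    proof (rule integral_norm_bound_integral)
      show "?f integrable_on {s..v}" "w integrable_on {s..v}"
        using v by (auto intro!: integrable_continuous_interval continuous_intros
            continuous_on_subset[OF cont_w] conts[THEN continuous_on_subset])
      show "norm (?f q) \<le> w q" if "q \<in> {s..v}" for q
      proof -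
        have "norm (?f q) \<le> 1 * norm (x' q * (\<rho> q * (y1 q + y2 q) - 2 * \<sigma> q * y2 q))"
          unfolding norm_mult[of "?e q"] by (intro mult_right_mono norm_e that) auto
        also have "\<dots> = norm (x' q * \<rho> q * (y1 q + y2 q) - 2 * (x' q * \<sigma> q) * y2 q)"
          by (simp add: algebra_simps)
        also have "\<dots> \<le> w q"
          unfolding w_def by (rule order.trans[OF norm_triangle_ineq4]) (simp add: norm_mult)
        finally show ?thesis .
      qed
    qed
    finally have "norm (y2 v - ?e s * y2 s) \<le> integral {s..v} w" .
    moreover have "norm (y2 v) \<le> norm (y2 v - ?e s * y2 s) + norm (?e s * y2 s)"
      using norm_triangle_ineq[of "y2 v - ?e s * y2 s" "?e s * y2 s"] by simp
    moreover have "norm (?e s * y2 s) \<le> 1 * norm (y2 s)"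
      unfolding norm_mult using v by (intro mult_right_mono norm_e) auto
    ultimately show ?thesis by simp
  qed
  have "m t \<le> (m s + integral {s..t} b) * exp (integral {s..t} a)"
  proof (rule Gronwall_integral[OF \<open>s \<le> t\<close> cont_m cont_a cont_b])
    fix v assume v: "v \<in> {s..t}"
    show "0 \<le> a v" "0 \<le> b v" by (auto simp: a_def b_def)
    have "m v \<le> m s + integral {s..v} w"
      using bound1[OF v] bound2[OF v] unfolding m_def by linarith
    also have "integral {s..v} w \<le> integral {s..v} (\<lambda>y. a y * m y + b y)"
    proof (rule integral_le)
      show "w integrable_on {s..v}" "(\<lambda>y. a y * m y + b y) integrable_on {s..v}"
        using v by (auto intro!: integrable_continuous_interval continuous_intros
            cont_w[THEN continuous_on_subset] cont_a[THEN continuous_on_subset]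
            cont_b[THEN continuous_on_subset] cont_m[THEN continuous_on_subset])
      fix q assume "q \<in> {s..v}"
      \<comment> \<open>Comparing the first component with 1 splits off the source \<open>b\<close>;
        the remaining \<open>2 m\<close> is the reason for the factor 2 of the \<open>\<rho>\<close>
        term in \<open>a\<close>.\<close>
      have "norm (y1 q + y2 q) \<le> norm (y1 q - 1) + norm (y2 q) + 1"
        using norm_triangle_ineq[of "y1 q - 1" "y2 q + 1"] norm_triangle_ineq[of "y2 q" 1] by simp
      then have "norm (y1 q + y2 q) \<le> 2 * m q + 1" by (simp add: m_def)
      moreover have "norm (y2 q) \<le> m q" by (simp add: m_def)
      ultimately have "w q \<le> 2 * norm (x' q * \<sigma> q) * m q + norm (x' q * \<rho> q) * (2 * m q + 1)"
        unfolding w_def by (intro add_mono mult_left_mono) auto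
      then show "w q \<le> a q * m q + b q" by (simp add: a_def b_def algebra_simps)
    qed
    finally show "m v \<le> m s + integral {s..v} (\<lambda>y. a y * m y + b y)" by simp
  qed
  then show ?thesis unfolding m_def a_def[abs_def] b_def[abs_def] .
qed

section \<open>The closed upper half plane\<close>

lemma Cplus_eq: "Cplus = {z. z \<noteq> 0 \<and> 0 \<le> Im z}"
proof -
  have "0 \<le> Arg z \<longleftrightarrow> 0 \<le> Im z" if "z \<noteq> 0" for z
    using Arg_lt_pi[of z] Arg_eq_0[of z] Im_Ln_pos_le[of z] that by (auto simp: Arg_def Arg_le_pi Im_Ln_le_pi)
  then show ?thesis by (auto simp: Cplus_def Arg_le_pi)
qed

lemma of_real_in_Cplus [simp]: "x \<noteq> 0 \<Longrightarrow> of_real x \<in> Cplus"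
  by (simp add: Cplus_eq)

lemma Cplus_polar:
  assumes "z \<in> Cplus"
  shows "z = of_real (norm z) * exp (\<i> * of_real (Arg z))" "0 \<le> Arg z" "Arg z \<le> pi"
  using assms Arg_eq[of z] by (auto simp: Cplus_def Arg_le_pi)

lemma polar_in_Cplus: "0 < r \<Longrightarrow> 0 \<le> \<theta> \<Longrightarrow> \<theta> \<le> pi \<Longrightarrow> of_real r * exp (\<i> * of_real \<theta>) \<in> Cplus"
  by (simp add: Cplus_eq Im_exp exp_Euler[symmetric] sin_ge_zero)

text \<open>Multiplication by \<open>- \<i>\<close> turns \<open>Cplus\<close> into the closed right
  half plane without 0, which avoids the cut of \<open>Ln\<close>. This gives control of
  \<open>Ln\<close> on \<open>Cplus\<close> up to and including the negative axis, where
  \<open>Ln\<close> is discontinuous as a function on the plane.\<close>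

lemma Ln_Cplus:
  assumes "z \<in> Cplus"
  shows "Ln z = Ln (- \<i> * z) + \<i> * of_real (pi / 2)" and "- \<i> * z \<notin> \<real>\<^sub>\<le>\<^sub>0"
proof -
  have z: "z \<noteq> 0" "0 \<le> Im z" using assms by (auto simp: Cplus_eq)
  show "- \<i> * z \<notin> \<real>\<^sub>\<le>\<^sub>0" using z by (auto simp: complex_nonpos_Reals_iff complex_eq_iff)
  have "\<bar>Im (Ln (- \<i> * z))\<bar> \<le> pi / 2" using z by (intro iffD2[OF Re_Ln_pos_le]) auto
  then show "Ln z = Ln (- \<i> * z) + \<i> * of_real (pi / 2)"
  proof (intro Ln_unique)
    show "exp (Ln (- \<i> * z) + \<i> * of_real (pi / 2)) = z"
      using z by (simp add: exp_add exp_Euler[of "of_real pi / 2", simplified] cis_conv_exp[symmetric])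
        (simp add: complex_eq_iff)
  qed (use z in \<open>auto simp: abs_le_iff intro: less_le_trans[of _ 0]\<close>)
qed

lemma continuous_on_Ln_Cplus: "continuous_on Cplus Ln"
proof -
  have "continuous_on Cplus (\<lambda>z. Ln (- \<i> * z) + \<i> * of_real (pi / 2))"
    by (intro continuous_intros) (use Ln_Cplus(2) in auto)
  then show ?thesis by (rule continuous_on_eq) (metis Ln_Cplus(1))
qed

lemma has_field_derivative_Ln_Cplus:
  assumes "z \<in> Cplus" "D \<subseteq> Cplus"
  shows "(Ln has_field_derivative 1 / z) (at z within D)"
proof -
  have "((\<lambda>z. Ln (- \<i> * z) + \<i> * of_real (pi / 2)) has_field_derivative 1 / z) (at z within Cplus)"
    using Ln_Cplus(2)[OF assms(1)] assms(1) by (auto intro!: derivative_eq_intros simp: Cplus_eq field_simps)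
  then have "(Ln has_field_derivative 1 / z) (at z within Cplus)"
    by (rule has_field_derivative_transform_within[OF _ zero_less_one])
       (use assms in \<open>metis Ln_Cplus(1)\<close>)+
  then show ?thesis by (rule DERIV_subset) fact
qed

lemma Zsq_zplus [simp]: assumes "0 \<le> lam" "lam < 1" shows "Zsq lam (zplus lam) = 0"
proof -
  have "lam\<^sup>2 \<le> 1" using assms by (simp add: abs_square_le_1)
  then have "(of_real (sqrt (1 - lam\<^sup>2)) :: complex)\<^sup>2 = 1 - of_real (lam\<^sup>2)"
    unfolding of_real_power[symmetric] by simp
  then show ?thesis
    by (simp add: Zsq_def zplus_def power2_sum power_mult_distrib) (simp add: algebra_simps power2_eq_square)
qed

lemma Im_zplus_pos: assumes "0 \<le> lam" "lam < 1" shows "0 < Im (zplus lam)"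
  using assms by (simp add: zplus_def abs_square_less_1)

text \<open>The other zero \<open>4 lam - zplus lam\<close> is the conjugate of
  \<open>zplus lam\<close> and lies below the real axis.\<close>

lemma Zsq_eq_0_iff: 
  assumes lam: "0 \<le> lam" "lam < 1" and "z \<in> Cplus"
  shows "Zsq lam z = 0 \<longleftrightarrow> z = zplus lam"
proof
  assume "Zsq lam z = 0"
  moreover have "Zsq lam z - Zsq lam (zplus lam) = (z - zplus lam) * (z + zplus lam - 4 * of_real lam)"
    by (simp add: Zsq_def algebra_simps power2_eq_square)
  ultimately have "(z - zplus lam) * (z + zplus lam - 4 * of_real lam) = 0"
    using Zsq_zplus[OF lam] by simp
  moreover have "Im (z + zplus lam - 4 * of_real lam) > 0"
    using Im_zplus_pos[OF lam] \<open>z \<in> Cplus\<close> by (simp add: Cplus_eq)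
  then have "z + zplus lam - 4 * of_real lam \<noteq> 0" by (metis less_irrefl zero_complex.sel(2))
  ultimately show "z = zplus lam" by simp
qed (use lam in simp)

lemma zplus_in_Cplus: assumes "0 \<le> lam" "lam < 1" shows "zplus lam \<in> Cplus"
  using Im_zplus_pos[OF assms] by (auto simp: Cplus_eq)

text \<open>A small step upwards from \<open>z\<close> stays in \<open>Cplus\<close> and off the
  closed set. This makes relative limits unique, hence also the derivative that
  \<open>deriv_within\<close> selects, even at points of the real axis.\<close>

lemma at_within_Cplus_diff_not_bot:
  assumes "closed K" "z \<in> Cplus - K"
  shows "at z within (Cplus - K) \<noteq> bot"
proof -
  have "open (- K - {0})" using assms by (intro open_Diff) auto
  then obtain e where e: "e > 0" "ball z e \<subseteq> - K - {0}"
    using assms by (auto simp: open_contains_ball Cplus_eq)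
  have "z islimpt (Cplus - K)"
  proof (rule islimpt_approachable[THEN iffD2], intro allI impI)
    fix \<epsilon> :: real assume "\<epsilon> > 0"
    define d where "d = min e \<epsilon> / 2"
    have d: "0 < d" "d < e" "d < \<epsilon>" using e \<open>\<epsilon> > 0\<close> by (auto simp: d_def)
    have "z + \<i> * of_real d \<in> ball z e" using d by (simp add: dist_norm norm_mult)
    then have "z + \<i> * of_real d \<in> - K - {0}" using e by blast
    then have "z + \<i> * of_real d \<in> Cplus - K" using d assms by (auto simp: Cplus_eq)
    then show "\<exists>x'\<in>Cplus - K. x' \<noteq> z \<and> dist x' z < \<epsilon>"
      using d by (intro bexI[of _ "z + \<i> * of_real d"]) (auto simp: dist_norm norm_mult)
  qed
  then show ?thesis by (simp add: trivial_limit_within)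
qed

section \<open>The coefficients\<close>

lemma norm_poly_le_small:
  fixes p :: "complex poly"
  assumes "norm z \<le> 1"
  shows "norm (poly p z) \<le> (\<Sum>i\<le>degree p. norm (coeff p i))"
  unfolding poly_altdef
proof (rule sum_norm_le)
  show "norm (coeff p i * z ^ i) \<le> norm (coeff p i)" for i
    using assms by (simp add: norm_mult norm_power mult_left_le power_le_one)
qed

lemma norm_poly_le_large:
  fixes p :: "complex poly"
  assumes "1 \<le> norm z" "degree p \<le> d"
  shows "norm (poly p z) \<le> (\<Sum>i\<le>degree p. norm (coeff p i)) * norm z ^ d"
  unfolding poly_altdef sum_distrib_right
proof (rule sum_norm_le)
  show "norm (coeff p i * z ^ i) \<le> norm (coeff p i) * norm z ^ d" if "i \<in> {..degree p}" for i
    using assms that by (auto simp: norm_mult norm_power intro!: mult_left_mono power_increasing)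
qed

text \<open>The numerators in \<open>F s = z * P / Z ^ (3 s + 3)\<close>; they are the same for
  every branch of \<open>Z\<close>. In the recursion \<open>[:4, - 4 lam, 1:]\<close> is
  \<open>Zsq\<close>, \<open>[:- 2 lam, 1:]\<close> comes from the derivative of \<open>Z\<close>,
  and \<open>3 m + 6\<close> is the exponent of \<open>Z\<close> in
  \<open>F (Suc m)\<close>.\<close>

fun Fpoly :: "real \<Rightarrow> nat \<Rightarrow> complex poly" where
  "Fpoly lam 0 = 0"
| "Fpoly lam (Suc 0) = smult (- 1/2) [:16 * of_real lam, 4 * of_real lam ^ 2 - 16, 0, 1:]"
| "Fpoly lam (Suc (Suc m)) =
     - (pderiv (pCons 0 (Fpoly lam (Suc m))) * [:4, - 4 * of_real lam, 1:]
        - smult (of_nat (3 * m + 6)) (pCons 0 (Fpoly lam (Suc m)) * [:- 2 * of_real lam, 1:]))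
     - smult (1/2) (pCons 0 (\<Sum>j=1..m. Fpoly lam j * Fpoly lam (Suc m - j)))"

text \<open>Against the denominator \<open>Z ^ (3 s + 3)\<close> this bound gives
  \<open>F s = O(1 / z^2)\<close> at infinity, which is the decay needed for the integrals that
  define \<open>E_s\<close>.\<close>

lemma degree_Fpoly: "degree (Fpoly lam s) \<le> 3 * s"
proof (induction s rule: less_induct)
  case (less s)
  consider "s = 0" | "s = 1" | m where "s = Suc (Suc m)"
    by (metis One_nat_def not0_implies_Suc)
  then show ?case
  proof cases
    case 3
    have p: "degree (pCons 0 (Fpoly lam (Suc m))) \<le> 3 * m + 4"
      using less[of "Suc m"] 3 by (simp add: degree_pCons_eq_if)
    have "degree (pderiv (pCons 0 (Fpoly lam (Suc m)))) \<le> 3 * m + 3"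
      using p by (simp add: degree_pderiv)
    then have 1: "degree (pderiv (pCons 0 (Fpoly lam (Suc m))) * [:4, - 4 * of_real lam, 1:]) \<le> 3 * s"
      by (intro degree_mult_le[THEN order.trans]) (simp add: 3)
    have "degree (pCons 0 (Fpoly lam (Suc m)) * [:- 2 * of_real lam, 1:]) \<le> 3 * s"
      using p by (intro degree_mult_le[THEN order.trans]) (simp add: 3)
    then have 2: "degree (smult (of_nat (3 * m + 6)) (pCons 0 (Fpoly lam (Suc m)) * [:- 2 * of_real lam, 1:])) \<le> 3 * s"
      by (rule order.trans[OF degree_smult_le])
    have "degree (\<Sum>j=1..m. Fpoly lam j * Fpoly lam (Suc m - j)) \<le> 3 * m + 3"
    proof (rule degree_sum_le)
      fix j assume "j \<in> {1..m}"
      then have "degree (Fpoly lam j) \<le> 3 * j" "degree (Fpoly lam (Suc m - j)) \<le> 3 * (Suc m - j)"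
        using 3 by (auto intro!: less)
      then show "degree (Fpoly lam j * Fpoly lam (Suc m - j)) \<le> 3 * m + 3"
        using \<open>j \<in> {1..m}\<close> by (intro degree_mult_le[THEN order.trans]) auto
    qed simp
    then have 4: "degree (smult (1/2) (pCons 0 (\<Sum>j=1..m. Fpoly lam j * Fpoly lam (Suc m - j)))) \<le> 3 * s"
      by (intro order.trans[OF degree_smult_le] order.trans[OF degree_pCons_le]) (simp add: 3)
    show ?thesis
      unfolding 3 Fpoly.simps unfolding 3[symmetric]
      by (intro degree_diff_le 4 2 1 order.trans[OF eq_refl[OF degree_minus]])
  qed auto
qed

text \<open>\<open>K\<close> is a closed set of the plane whose trace on \<open>Cplus\<close> is the
  cut. That it contains the turning point keeps \<open>Z\<close> from vanishing on the
  domain.\<close>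

locale liouville_sheet =
  fixes lam :: real and K :: "complex set" and Z :: "complex \<Rightarrow> complex"
  assumes lam: "0 \<le> lam" "lam < 1" and closed_K: "closed K"
    and cont_Z: "continuous_on (Cplus - K) Z"
    and Z_sq: "\<And>z. z \<in> Cplus - K \<Longrightarrow> (Z z)\<^sup>2 = Zsq lam z"
    and zplus_K: "zplus lam \<in> K"
begin

abbreviation "D \<equiv> Cplus - K"
abbreviation "F \<equiv> Fhat D Z lam"
abbreviation "G \<equiv> Ghat D Z lam"

lemma nonzero: assumes "z \<in> D" shows "z \<noteq> 0" "Z z \<noteq> 0"
proof -
  show "z \<noteq> 0" using assms by (simp add: Cplus_eq)
  have "Zsq lam z \<noteq> 0" using assms zplus_K lam by (subst Zsq_eq_0_iff) auto
  then show "Z z \<noteq> 0" using Z_sq[OF assms] by auto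
qed

lemma deriv_Z: assumes "z \<in> D" shows "(Z has_field_derivative (z - 2 * of_real lam) / Z z) (at z within D)"
proof -
  have "((\<lambda>z. (Z z)\<^sup>2) has_field_derivative 2 * z - 4 * of_real lam) (at z within D)"
  proof (rule has_field_derivative_transform_within[OF _ zero_less_one assms])
    show "(Zsq lam has_field_derivative 2 * z - 4 * of_real lam) (at z within D)"
      unfolding Zsq_def by (auto intro!: derivative_eq_intros)
  qed (use Z_sq in auto)
  moreover have "((\<lambda>w. w\<^sup>2) has_field_derivative 2 * Z z) (at (Z z))"
    by (auto intro!: derivative_eq_intros)
  moreover have "continuous (at z within D) Z"
    using cont_Z assms by (simp add: continuous_on_eq_continuous_within)
  ultimately have "(Z has_field_derivative (2 * z - 4 * of_real lam) / (2 * Z z)) (at z within D)"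
    using nonzero[OF assms] by (intro has_field_derivative_of_compose[where \<phi> = "\<lambda>w. w\<^sup>2"]) auto
  moreover have "(2 * z - 4 * of_real lam) / (2 * Z z) = (z - 2 * of_real lam) / Z z"
    using nonzero[OF assms] by (simp add: field_simps)
  ultimately show ?thesis by simp
qed

lemma deriv_within_eq:
  assumes "(g has_field_derivative d) (at z within D)" "z \<in> D"
  shows "deriv_within D g z = d"
  unfolding deriv_within_def
proof (rule the_equality)
  show "e = d" if "(g has_field_derivative e) (at z within D)" for e
    using that assms at_within_Cplus_diff_not_bot[OF closed_K]
    unfolding has_field_derivative_iff by (intro tendsto_unique) auto
qed fact

text \<open>The shape polynomial over power of \<open>Z\<close> survives differentiation because
  \<open>Z\<close> has derivative \<open>(z - 2 lam) / Z\<close> and \<open>Z^2\<close> is a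
  polynomial. The exponent rises by 2 here, and by one more through the factor \<open>z / Z\<close>
  of the recursion.\<close>

lemma deriv_F_form:
  assumes "z \<in> D"
  shows "((\<lambda>z. z * poly p z / Z z ^ k) has_field_derivative
    (poly (pderiv (pCons 0 p)) z * Zsq lam z - of_nat k * z * poly p z * (z - 2 * of_real lam)) / Z z ^ (k + 2))
     (at z within D)"
proof -
  have "((\<lambda>z. poly (pCons 0 p) z / Z z ^ k) has_field_derivative
    (poly (pderiv (pCons 0 p)) z * Z z ^ k - poly (pCons 0 p) z * (of_nat k * ((z - 2 * of_real lam) / Z z) * Z z ^ (k - 1))) / (Z z ^ k * Z z ^ k))
     (at z within D)" (is "(_ has_field_derivative ?d) _")
    using nonzero[OF assms]
    by (auto intro!: derivative_eq_intros deriv_Z assms poly_DERIV[THEN DERIV_subset] simp: algebra_simps pderiv_pCons)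
  moreover have "?d = (poly (pderiv (pCons 0 p)) z * (Z z)\<^sup>2 - of_nat k * z * poly p z * (z - 2 * of_real lam)) / Z z ^ (k + 2)"
    using nonzero[OF assms] by (cases k) (simp_all add: field_simps power2_eq_square)
  ultimately show ?thesis using Z_sq[OF assms] by simp
qed

lemma Fhat_eq:
  assumes "z \<in> D"
  shows "F s z = z * poly (Fpoly lam s) z / Z z ^ (3 * s + 3)"
  using assms
proof (induction s arbitrary: z rule: less_induct)
  case (less s)
  have Z: "Z z \<noteq> 0" using nonzero less.prems by auto
  consider "s = 0" | "s = 1" | m where "s = Suc (Suc m)"
    by (metis One_nat_def not0_implies_Suc)
  then show ?case
  proof cases
    case 2
    then show ?thesis using Z by (simp add: field_simps power2_eq_square power3_eq_cube)
  next
    case 3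
    let ?p = "Fpoly lam (Suc m)" and ?k = "3 * Suc m + 3"
    have "((\<lambda>z. F (Suc m) z) has_field_derivative
      (poly (pderiv (pCons 0 ?p)) z * Zsq lam z - of_nat ?k * z * poly ?p z * (z - 2 * of_real lam)) / Z z ^ (?k + 2))
         (at z within D)"
      by (rule has_field_derivative_transform_within[OF deriv_F_form[OF less.prems] zero_less_one less.prems])
         (simp add: less.IH 3)
    from deriv_within_eq[OF this less.prems]
    have d: "deriv_within D (F (Suc m)) z = 
       (poly (pderiv (pCons 0 ?p)) z * Zsq lam z - of_nat ?k * z * poly ?p z * (z - 2 * of_real lam)) / Z z ^ (?k + 2)" .
    have "F j z * F (Suc m - j) z = z\<^sup>2 * poly (Fpoly lam j * Fpoly lam (Suc m - j)) z / Z z ^ (?k + 3)"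
      if "j \<in> {1..m}" for j
    proof -
      \<comment> \<open>The exponents of the two factors add up to \<open>3 (m + 1) + 6\<close>
        whatever \<open>j\<close> is, and this is also the exponent of the derivative term after
        division by \<open>Z\<close>.\<close>
      have "Z z ^ (?k + 3) = Z z ^ (3 * j + 3) * Z z ^ (3 * (Suc m - j) + 3)"
        unfolding power_add[symmetric] using that by (intro arg_cong[of _ _ "\<lambda>n. Z z ^ n"]) auto
      then show ?thesis using that less.prems 3 by (simp add: less.IH power2_eq_square)
    qed
    then have sum: "(\<Sum>j=1..m. F j z * F (Suc m - j) z) =
        z\<^sup>2 * poly (\<Sum>j=1..m. Fpoly lam j * Fpoly lam (Suc m - j)) z / Z z ^ (?k + 3)"
      by (simp add: poly_sum sum_distrib_left sum_divide_distrib)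
    let ?S = "\<Sum>j=1..m. Fpoly lam j * Fpoly lam (Suc m - j)"
    have e: "Z z ^ (?k + 3) = Z z * Z z ^ (?k + 2)" by (simp add: eval_nat_numeral)
    have "F s z = - (z / Z z) * ((poly (pderiv (pCons 0 ?p)) z * Zsq lam z - of_nat ?k * z * poly ?p z * (z - 2 * of_real lam)) / Z z ^ (?k + 2))
       - 1 / 2 * (z\<^sup>2 * poly ?S z / Z z ^ (?k + 3))"
      unfolding 3 Fhat.simps d sum ..
    also have "\<dots> = z * (- (poly (pderiv (pCons 0 ?p)) z * Zsq lam z - of_nat ?k * z * poly ?p z * (z - 2 * of_real lam))
       - 1 / 2 * (z * poly ?S z)) / Z z ^ (?k + 3)"
      using Z unfolding e by (simp add: field_simps power2_eq_square)
    also have "\<dots> = z * poly (Fpoly lam s) z / Z z ^ (3 * s + 3)"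
      unfolding 3 by (simp add: Zsq_def algebra_simps power2_eq_square)
    finally show ?thesis .
  qed auto
qed

text \<open>The recursion read backwards: it defines \<open>F (Suc s)\<close> by the derivative of
  \<open>F s\<close>, so it can be solved for that derivative. Existence of the derivative has to
  come first, from the closed form, because \<open>deriv_within\<close> is a definite
  description.\<close>

lemma deriv_F:
  assumes "z \<in> D" "1 \<le> s"
  shows "(F s has_field_derivative
     - (Z z / z) * (F (Suc s) z + 1/2 * (\<Sum>j=1..s-1. F j z * F (s - j) z))) (at z within D)"
proof -
  have "\<exists>d. (F s has_field_derivative d) (at z within D)"
    by (rule exI, rule has_field_derivative_transform_within[OF deriv_F_form[OF assms(1)] zero_less_one assms(1)])
       (simp add: Fhat_eq)
  then obtain d where d: "(F s has_field_derivative d) (at z within D)" ..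
  obtain m where m: "s = Suc m" using assms(2) by (cases s) auto
  have "F (Suc s) z = - (z / Z z) * d - 1/2 * (\<Sum>j=1..s-1. F j z * F (s - j) z)"
    using deriv_within_eq[OF d assms(1)] unfolding m Fhat.simps by simp
  then have "d = - (Z z / z) * (F (Suc s) z + 1/2 * (\<Sum>j=1..s-1. F j z * F (s - j) z))"
    using nonzero[OF assms(1)] by (simp add: field_simps)
  with d show ?thesis by simp
qed

lemma continuous_on_F: "continuous_on D (F s)"
proof -
  have "continuous_on D (\<lambda>z. z * poly (Fpoly lam s) z / Z z ^ (3 * s + 3))"
    using nonzero by (intro continuous_intros cont_Z) auto
  then show ?thesis by (rule continuous_on_eq) (simp add: Fhat_eq)
qed

lemma continuous_on_G: "continuous_on D (G n s)"
  unfolding Ghat_def by (intro continuous_intros continuous_on_F)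

lemma F_bound_small:
  obtains B where "B > 0" "\<And>z. z \<in> D \<Longrightarrow> norm z \<le> 1 \<Longrightarrow> 1 \<le> norm (Z z) \<Longrightarrow> norm (F s z) \<le> B * norm z"
proof
  define B where "B = (\<Sum>i\<le>degree (Fpoly lam s). norm (coeff (Fpoly lam s) i)) + 1"
  show "B > 0" unfolding B_def by (intro add_nonneg_pos sum_nonneg) auto
  fix z assume z: "z \<in> D" "norm z \<le> 1" "1 \<le> norm (Z z)"
  have "norm (F s z) = norm z * norm (poly (Fpoly lam s) z) / norm (Z z) ^ (3 * s + 3)"
    by (simp add: Fhat_eq[OF z(1)] norm_mult norm_divide norm_power)
  also have "\<dots> \<le> norm z * B / 1"
    using norm_poly_le_small[OF z(2), of "Fpoly lam s"] z(3) unfolding B_def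
    by (intro frac_le mult_left_mono one_le_power) (auto intro!: mult_nonneg_nonneg add_nonneg_nonneg sum_nonneg)
  finally show "norm (F s z) \<le> B * norm z" by (simp add: mult.commute)
qed

lemma F_bound_large:
  obtains B where "B > 0" "\<And>z. z \<in> D \<Longrightarrow> 1 \<le> norm z \<Longrightarrow> norm z / 2 \<le> norm (Z z) \<Longrightarrow> norm (F s z) \<le> B / norm z ^ 2"
proof
  define B0 where "B0 = (\<Sum>i\<le>degree (Fpoly lam s). norm (coeff (Fpoly lam s) i)) + 1"
  define B where "B = B0 * 2 ^ (3 * s + 3)"
  have "B0 > 0" unfolding B0_def by (intro add_nonneg_pos sum_nonneg) auto
  then show "B > 0" by (simp add: B_def)
  fix z assume z: "z \<in> D" "1 \<le> norm z" "norm z / 2 \<le> norm (Z z)"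
  have "norm (F s z) = norm z * norm (poly (Fpoly lam s) z) / norm (Z z) ^ (3 * s + 3)"
    by (simp add: Fhat_eq[OF z(1)] norm_mult norm_divide norm_power)
  also have "\<dots> \<le> norm z * (B0 * norm z ^ (3 * s)) / (norm z / 2) ^ (3 * s + 3)"
  proof (intro frac_le mult_left_mono power_mono)
    show "norm (poly (Fpoly lam s) z) \<le> B0 * norm z ^ (3 * s)"
      using norm_poly_le_large[OF z(2) degree_Fpoly[of lam s]] by (auto simp: B0_def algebra_simps intro: add_increasing)
    have "z \<noteq> 0" using nonzero z by auto
    then show "0 < (norm z / 2) ^ (3 * s + 3)" by simp
  qed (use z \<open>B0 > 0\<close> in auto)
  also have "\<dots> = B / norm z ^ 2"
    using nonzero[OF z(1)] by (simp add: B_def field_simps power_add power2_eq_square power3_eq_cube)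
  finally show "norm (F s z) \<le> B / norm z ^ 2" .
qed

end

section \<open>Integrals from infinity along paths\<close>

text \<open>At a point that no path in \<open>D\<close> joins to the positive axis,
  \<open>integral_from_infinity\<close> holds for every value, so nothing is known about
  \<open>E_s\<close> there. Integrability of all continuous functions is included so that the
  integral over a prolonged path splits into its two parts.\<close>

definition reachable :: "complex set \<Rightarrow> complex \<Rightarrow> bool" where
  "reachable D z \<longleftrightarrow> (\<exists>R>0. \<exists>\<gamma>. valid_path \<gamma> \<and> path_image \<gamma> \<subseteq> D \<and>
     pathstart \<gamma> = of_real R \<and> pathfinish \<gamma> = z \<and>
     (\<forall>g. continuous_on D g \<longrightarrow> g contour_integrable_on \<gamma>))"

lemma reachable_of_real:
  assumes "x > 0" "of_real x \<in> D"
  shows "reachable D (of_real x)"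
  unfolding reachable_def
  using assms by (intro exI[of _ x] conjI exI[of _ "linepath (of_real x) (of_real x)"])
    (auto simp: contour_integrable_on_def intro: has_contour_integral_trivial)

lemma integral_from_infinity_of_real:
  assumes "x > 0" "of_real x \<in> D" "integral_from_infinity D g (of_real x) I"
  shows "I = - integral {x..} (\<lambda>x. g (of_real x))"
proof -
  have "I = contour_integral (linepath (of_real x) (of_real x)) g - integral {x..} (\<lambda>x. g (of_real x))"
    using assms(3)[unfolded integral_from_infinity_def, rule_format, OF assms(1), of "linepath (of_real x) (of_real x)"] assms(2)
    by simp
  then show ?thesis by simp
qed

text \<open>The substitution is obtained by differentiating the primitive of the integrand composed
  with the affine change of parameter. Nothing is divided by \<open>t - c\<close>, so the degenerate
  arc \<open>c = t\<close> is covered.\<close>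

lemma reparametrized_arc:
  fixes p p' :: "real \<Rightarrow> complex"
  assumes "c \<le> t"
    and p: "\<And>v. v \<in> {c..t} \<Longrightarrow> (p has_vector_derivative p' v) (at v within {c..t})"
    and p': "continuous_on {c..t} p'"
  defines "q \<equiv> \<lambda>s. p (c + (t - c) * s)"
  shows "valid_path q" "pathstart q = p c" "pathfinish q = p t" "path_image q = p ` {c..t}"
    "continuous_on (p ` {c..t}) g \<Longrightarrow>
      (g has_contour_integral integral {c..t} (\<lambda>v. p' v * g (p v))) q"
proof -
  let ?l = "\<lambda>s. c + (t - c) * s"
  have l: "?l ` {0..1} = {c..t}"
  proof -
    have "(+) c ` {0..t - c} = {c..t}" by simp
    moreover have "(*) (t - c) ` {0..1} = {0..t - c}" using \<open>c \<le> t\<close> by (subst image_mult_atLeastAtMost_if) auto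
    ultimately show ?thesis by (simp add: image_image[symmetric, of "(+) c" "(*) (t - c)"])
  qed
  have dl: "(?l has_vector_derivative (t - c)) (at s within S)" for s S
    by (auto intro!: derivative_eq_intros)
  have dq: "(q has_vector_derivative (t - c) *\<^sub>R p' (?l s)) (at s within {0..1})" if "s \<in> {0..1}" for s
  proof -
    have "?l s \<in> {c..t}" using l that by blast
    then show ?thesis
      using vector_diff_chain_within[OF dl, of p "p' (?l s)" s "{0..1}"] p unfolding l by (simp add: q_def o_def)
  qed
  then have cont: "continuous_on {0..1} q"
    using has_vector_derivative_continuous continuous_on_eq_continuous_within by blast
  have cont': "continuous_on {0..1} (\<lambda>s. (t - c) *\<^sub>R p' (?l s))"
    by (intro continuous_intros continuous_on_compose2[OF p']) (use l in auto)
  show "valid_path q"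
    unfolding valid_path_def piecewise_C1_differentiable_on_def C1_differentiable_on_def
  \<comment> \<open>At the end points only one-sided derivatives are available, so both are put into
    the exceptional set.\<close>
  proof (intro conjI cont exI[of _ "{0,1}"] exI[of _ "\<lambda>s. (t - c) *\<^sub>R p' (?l s)"] ballI)
    show "(q has_vector_derivative (t - c) *\<^sub>R p' (?l s)) (at s)" if "s \<in> {0..1} - {0, 1}" for s
      using dq[of s] that by (auto simp: at_within_Icc_at)
    show "continuous_on ({0..1} - {0, 1}) (\<lambda>s. (t - c) *\<^sub>R p' (?l s))"
      by (rule continuous_on_subset[OF cont']) auto
  qed auto
  show "pathstart q = p c" "pathfinish q = p t" by (auto simp: pathstart_def pathfinish_def q_def)
  show "path_image q = p ` {c..t}" unfolding path_image_def q_def using l by (metis image_image)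
  assume g: "continuous_on (p ` {c..t}) g"
  let ?G = "\<lambda>v. p' v * g (p v)"
  have "continuous_on {c..t} p"
    using p has_vector_derivative_continuous continuous_on_eq_continuous_within by blast
  then have G: "continuous_on {c..t} ?G"
    by (intro continuous_intros p' continuous_on_compose2[OF g]) auto
  have "((\<lambda>s. integral {c..?l s} ?G) has_vector_derivative (t - c) *\<^sub>R ?G (?l s)) (at s within {0..1})"
    if "s \<in> {0..1}" for s
  proof -
    have "?l s \<in> {c..t}" using l that by blast
    then show ?thesis
      using vector_diff_chain_within[OF dl, of "\<lambda>v. integral {c..v} ?G" "?G (?l s)" s "{0..1}"]
        integral_has_vector_derivative[OF G, of "?l s"] unfolding l by (simp add: o_def)
  qed
  then have "((\<lambda>s. (t - c) *\<^sub>R ?G (?l s)) has_integral (integral {c..?l 1} ?G - integral {c..?l 0} ?G)) {0..1}"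
    by (intro fundamental_theorem_of_calculus) auto
  then have "((\<lambda>s. (t - c) *\<^sub>R ?G (?l s)) has_integral (integral {c..t} ?G)) {0..1}"
    by simp
  then show "(g has_contour_integral integral {c..t} ?G) q"
    unfolding has_contour_integral_def
  proof (rule has_integral_eq[rotated])
    fix s :: real assume "s \<in> {0..1}"
    then have "vector_derivative q (at s within {0..1}) = (t - c) *\<^sub>R p' (?l s)"
      using dq by (intro vector_derivative_within_closed_interval) auto
    then show "(t - c) *\<^sub>R ?G (?l s) = g (q s) * vector_derivative q (at s within {0..1})"
      by (simp add: q_def)
  qed
qed

text \<open>Prolonging one fixed path to \<open>p c\<close> by the arc represents both values with
  the same \<open>R\<close>. The improper integral over \<open>{R..}\<close> therefore cancels in
  the difference, whatever its value is.\<close>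

lemma reachable_arc:
  fixes p p' :: "real \<Rightarrow> complex"
  assumes "c \<le> t"
    and p: "\<And>v. v \<in> {c..t} \<Longrightarrow> (p has_vector_derivative p' v) (at v within {c..t})"
    and p': "continuous_on {c..t} p'"
    and D: "p ` {c..t} \<subseteq> D" and reach: "reachable D (p c)"
  shows "reachable D (p t)"
    and "\<lbrakk>continuous_on D g; integral_from_infinity D g (p c) i; integral_from_infinity D g (p t) j\<rbrakk> \<Longrightarrow>
       j - i = integral {c..t} (\<lambda>v. p' v * g (p v))"
proof -
  define q where "q = (\<lambda>s. p (c + (t - c) * s))"
  note q = reparametrized_arc[OF \<open>c \<le> t\<close> p p', folded q_def]
  obtain R \<gamma> where \<gamma>: "R > 0" "valid_path \<gamma>" "path_image \<gamma> \<subseteq> D" "pathstart \<gamma> = of_real R"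
    "pathfinish \<gamma> = p c" "\<And>g. continuous_on D g \<Longrightarrow> g contour_integrable_on \<gamma>"
    using reach unfolding reachable_def by blast
  have int_q: "(g has_contour_integral integral {c..t} (\<lambda>v. p' v * g (p v))) q" if "continuous_on D g" for g
    using q(5) continuous_on_subset[OF that D] by blast
  have join: "valid_path (\<gamma> +++ q)" "path_image (\<gamma> +++ q) \<subseteq> D" "pathstart (\<gamma> +++ q) = of_real R"
    "pathfinish (\<gamma> +++ q) = p t"
    using \<gamma> q(1-4) D by (auto intro!: valid_path_join simp: path_image_join)
  show "reachable D (p t)"
    unfolding reachable_def
    using join \<gamma> q(1) int_q[THEN has_contour_integral_integrable]
    by (intro exI[of _ R] exI[of _ "\<gamma> +++ q"] conjI) auto
  assume g: "continuous_on D g" and ij: "integral_from_infinity D g (p c) i" "integral_from_infinity D g (p t) j"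
  have "i = contour_integral \<gamma> g - integral {R..} (\<lambda>x. g (of_real x))"
    using ij(1) \<gamma> unfolding integral_from_infinity_def by blast
  moreover have "j = contour_integral (\<gamma> +++ q) g - integral {R..} (\<lambda>x. g (of_real x))"
    using ij(2) join \<gamma>(1) unfolding integral_from_infinity_def by blast
  moreover have "contour_integral (\<gamma> +++ q) g = contour_integral \<gamma> g + contour_integral q g"
    using \<gamma> q(1) g int_q[OF g] has_contour_integral_integrable by (intro contour_integral_join) auto
  ultimately show "j - i = integral {c..t} (\<lambda>v. p' v * g (p v))"
    using contour_integral_unique[OF int_q[OF g]] by simp
qed

text \<open>The arc of the circle from \<open>norm z\<close> to \<open>z\<close> has length at most
  \<open>\<pi> norm z\<close>. It serves near 0 and near infinity, where whole half circles belong
  to the domain.\<close>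

lemma reachable_circle:
  assumes z: "z \<in> Cplus" and D: "\<And>w. w \<in> Cplus \<Longrightarrow> norm w = norm z \<Longrightarrow> w \<in> D"
  shows "reachable D z"
    and "\<lbrakk>continuous_on D g; integral_from_infinity D g z i; integral_from_infinity D g (of_real (norm z)) j;
       \<And>w. w \<in> Cplus \<Longrightarrow> norm w = norm z \<Longrightarrow> norm (g w) \<le> B\<rbrakk>
       \<Longrightarrow> norm (i - j) \<le> B * norm z * pi"
proof -
  define r where "r = norm z"
  have r: "r > 0" using z by (auto simp: r_def Cplus_eq)
  let ?p = "\<lambda>\<theta>. of_real r * exp (\<i> * of_real \<theta>)" and ?p' = "\<lambda>\<theta>. of_real r * (\<i> * exp (\<i> * of_real \<theta>))"
  note polar = Cplus_polar[OF z, folded r_def]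
  have p: "(?p has_vector_derivative ?p' v) (at v within S)" for v S
    by (rule has_vector_derivative_real_field)  (auto intro!: derivative_eq_intros)
  have p': "continuous_on S ?p'" for S by (intro continuous_intros)
  have in_D: "?p v \<in> Cplus" "norm (?p v) = norm z" "?p v \<in> D" if "v \<in> {0..Arg z}" for v
  proof -
    show 1: "?p v \<in> Cplus" using that polar r by (intro polar_in_Cplus) auto
    show "norm (?p v) = norm z" using r by (simp add: norm_mult r_def)
    with 1 show "?p v \<in> D" by (rule D)
  qed
  have p0: "?p 0 = of_real r" by simp
  have "(of_real r :: complex) \<in> D" using in_D(3)[of 0] polar by simp
  then have "reachable D (?p 0)" unfolding p0 by (rule reachable_of_real[OF r])
  note arc = reachable_arc[where p = ?p and p' = ?p', OF polar(2) p p' _ this]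
  have "reachable D (?p (Arg z))" by (rule arc(1)) (use in_D in auto)
  then show "reachable D z" using polar(1) by simp
  assume g: "continuous_on D g" "integral_from_infinity D g z i" "integral_from_infinity D g (of_real (norm z)) j"
    and B: "\<And>w. w \<in> Cplus \<Longrightarrow> norm w = norm z \<Longrightarrow> norm (g w) \<le> B"
  have cont: "continuous_on {0..Arg z} (\<lambda>v. ?p' v * g (?p v))"
    by (intro continuous_intros continuous_on_compose2[OF g(1)]) (use in_D in auto)
  have "i - j = integral {0..Arg z} (\<lambda>v. ?p' v * g (?p v))"
    using g polar(1) by (intro arc(2)) (use in_D in \<open>auto simp: r_def\<close>)
  also have "norm \<dots> \<le> r * B * (Arg z - 0)"
  proof (rule integral_bound[OF polar(2) cont])
    show "norm (?p' v * g (?p v)) \<le> r * B" if "v \<in> {0..Arg z}" for v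
      using B[OF in_D(1,2)[OF that]] r by (simp add: norm_mult)
  qed
  also have "r * B * (Arg z - 0) \<le> r * B * pi"
    using order.trans[OF norm_ge_zero B[OF in_D(1,2)[of 0]]] polar r by (intro mult_left_mono) auto
  finally show "norm (i - j) \<le> B * norm z * pi" by (simp add: r_def mult_ac)
qed

section \<open>The regions near the origin\<close>

text \<open>For small \<open>z\<close> a root \<open>v\<close> of \<open>Zsq\<close> is close to 2
  or to -2. Up to bounded terms \<open>Re_xi\<close> is \<open>ln (norm z)\<close> or at least
  \<open>- ln (norm z)\<close> respectively, so in neither case can it equal the fixed
  level.\<close>

lemma level_set_near_0:
  assumes lam: "0 \<le> lam" "lam < 1"
  obtains r where "0 < r" "level_set lam \<inter> ball 0 r = {}"
proof
  define L where "L = Re_xi lam 0 (zplus lam)"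
  \<comment> \<open>The summands account for the level, for
    \<open>\<bar>Re v\<bar> / 2 \<le> 3/2\<close>, and for the first logarithm: it is at most
    \<open>ln 5\<close> where \<open>v\<close> is near -2 and at least \<open>ln (1 - lam)\<close>
    where \<open>v\<close> is near 2. Then \<open>ln (norm z) < - c\<close> outweighs them
    all.\<close>
  define c where "c = \<bar>L\<bar> + 3/2 + ln 5 + \<bar>ln (1 - lam)\<bar>"
  define r where "r = min ((1 - lam) / 4) (exp (- c))"
  show "0 < r" using lam by (simp add: r_def)
  have "z \<notin> level_set lam" if "norm z < r" for z
  proof
    assume "z \<in> level_set lam"
    then obtain v where z: "z \<noteq> 0" and v: "v\<^sup>2 = Zsq lam z" and eq: "Re_xi lam v z = L"
      by (auto simp: level_set_def L_def Cplus_eq)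
    have small: "4 * norm z \<le> 1 - lam" using that by (simp add: r_def)
    have "norm z < exp (- c)" using that by (simp add: r_def)
    then have lnz: "ln (norm z) < - c" using z by (metis ln_exp ln_less_cancel_iff exp_gt_zero zero_less_norm_iff)
    have lamz: "norm (of_real lam * z) \<le> norm z"
      using lam by (simp add: norm_mult mult_left_le_one_le)
    have near: "norm (w - 2) \<le> 5/2 * norm z" if w: "w\<^sup>2 = Zsq lam z" "0 \<le> Re w" for w
    proof -
      have "2 \<le> norm (w + 2)" using w(2) complex_Re_le_cmod[of "w + 2"] by simp
      then have "norm (w - 2) * 2 \<le> norm (w - 2) * norm (w + 2)" by (intro mult_left_mono) auto
      also have "\<dots> = norm (z * (z - 4 * of_real lam))"
        using w(1) unfolding norm_mult[symmetric] Zsq_def by (intro arg_cong[of _ _ norm]) (simp add: algebra_simps power2_eq_square)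
      also have "\<dots> \<le> norm z * (norm z + 4 * lam)"
        unfolding norm_mult[of z] using norm_triangle_ineq4[of z "4 * of_real lam"] lam
        by (intro mult_left_mono) (auto simp: norm_mult)
      also have "\<dots> \<le> norm z * 5" using small lam by (intro mult_left_mono) auto
      finally show ?thesis by simp
    qed
    show False
    proof (cases "0 \<le> Re v")
      case True
      note n = near[OF v True]
      have "Re v \<le> 3" using complex_Re_le_cmod[of "v - 2"] n small lam by simp
      moreover have "1 - lam \<le> norm (v + z - 2 * of_real lam)"
      proof -
        have "2 - 2 * lam \<le> norm (of_real (2 - 2 * lam) :: complex)" unfolding norm_of_real by simp
        also have "of_real (2 - 2 * lam) = (v + z - 2 * of_real lam) - ((v - 2) + z)" by simp
        also have "norm \<dots> \<le> norm (v + z - 2 * of_real lam) + norm ((v - 2) + z)"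
          by (rule norm_triangle_ineq4)
        also have "norm ((v - 2) + z) \<le> 5/2 * norm z + norm z"
          using n norm_triangle_ineq[of "v - 2" z] by simp
        finally show ?thesis using small norm_ge_zero[of z] by linarith
      qed
      then have "ln (1 - lam) \<le> ln (norm (v + z - 2 * of_real lam))" using lam by (intro ln_mono) auto
      then have "lam * ln (1 - lam) \<le> lam * ln (norm (v + z - 2 * of_real lam))"
        using lam by (intro mult_left_mono)
      moreover have "- \<bar>ln (1 - lam)\<bar> \<le> lam * ln (1 - lam)"
        using lam mult_left_le_one_le[of "\<bar>ln (1 - lam)\<bar>" lam] abs_mult[of lam "ln (1 - lam)"] by linarith
      moreover have "1 \<le> norm (v - of_real lam * z + 2)"
      proof -
        have "4 = norm ((v - of_real lam * z + 2) - ((v - 2) - of_real lam * z))" by simp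
        also have "\<dots> \<le> norm (v - of_real lam * z + 2) + norm ((v - 2) - of_real lam * z)"
          by (rule norm_triangle_ineq4)
        also have "norm ((v - 2) - of_real lam * z) \<le> 5/2 * norm z + norm z"
          using n lamz norm_triangle_ineq4[of "v - 2" "of_real lam * z"] by simp
        finally show ?thesis using small lam by simp
      qed
      then have "1 / norm z \<le> norm ((v - of_real lam * z + 2) / z)"
        using z by (simp add: norm_divide divide_right_mono)
      then have "ln (1 / norm z) \<le> ln (norm ((v - of_real lam * z + 2) / z))"
        using z by (intro ln_mono) auto
      then have "- ln (norm z) \<le> ln (norm ((v - of_real lam * z + 2) / z))"
        using z by (simp add: ln_div)
      moreover have "(0::real) < ln 5" by simp
      ultimately show False using eq lnz unfolding Re_xi_def c_def by linarith
    next
      case False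
      then have n: "norm (v + 2) \<le> 5/2 * norm z"
        using near[of "-v"] v norm_minus_cancel[of "v + 2"] by simp
      have "- 3 \<le> Re v" using complex_Re_le_cmod[of "- (v + 2)"] norm_minus_cancel[of "v + 2"] n small lam by simp
      moreover have "norm (v + z - 2 * of_real lam) \<le> 5"
      proof -
        have "norm (v + z - 2 * of_real lam) = norm ((v + 2) + z - of_real (2 + 2 * lam))" by (simp add: algebra_simps)
        also have "\<dots> \<le> norm (v + 2) + norm z + norm (of_real (2 + 2 * lam) :: complex)"
          using norm_triangle_ineq4[of "(v + 2) + z" "of_real (2 + 2 * lam)"] norm_triangle_ineq[of "v + 2" z]
          by linarith
        finally show ?thesis using n small lam unfolding norm_of_real by simp
      qed
      \<comment> \<open>If the argument vanishes, the convention \<open>ln 0 = 0\<close> gives the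
        bound.\<close>
      then have "ln (norm (v + z - 2 * of_real lam)) \<le> ln 5"
        by (cases "v + z - 2 * of_real lam = 0") auto
      then have "lam * ln (norm (v + z - 2 * of_real lam)) \<le> lam * ln 5"
        using lam by (intro mult_left_mono)
      moreover have "lam * ln 5 \<le> ln 5" using lam by (intro mult_left_le_one_le) auto
      moreover have "1 \<le> norm (v - 2 + of_real lam * z)"
      proof -
        have "4 = norm ((v + 2) + of_real lam * z - (v - 2 + of_real lam * z))" by simp
        also have "\<dots> \<le> norm ((v + 2) + of_real lam * z) + norm (v - 2 + of_real lam * z)"
          by (rule norm_triangle_ineq4)
        also have "norm ((v + 2) + of_real lam * z) \<le> 5/2 * norm z + norm z"
          using n lamz norm_triangle_ineq[of "v + 2" "of_real lam * z"] by simp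
        finally show ?thesis using small lam by simp
      qed
      have "1 - lam\<^sup>2 > 0" "lam\<^sup>2 \<ge> 0" using lam by (auto simp: abs_square_less_1)
      \<comment> \<open>The companion factor is near -4, so this product shows that the numerator in
        the second logarithm is of order \<open>z^2\<close> and the quotient by \<open>z\<close> is
        of order \<open>z\<close>.\<close>
      have "(v - of_real lam * z + 2) * (v - 2 + of_real lam * z) = z\<^sup>2 * of_real (1 - lam\<^sup>2)"
        using v by (simp add: Zsq_def algebra_simps power2_eq_square)
      then have prod: "norm (v - of_real lam * z + 2) * norm (v - 2 + of_real lam * z) = (norm z)\<^sup>2 * (1 - lam\<^sup>2)"
        using \<open>1 - lam\<^sup>2 > 0\<close> unfolding norm_mult[symmetric] by (simp add: norm_mult norm_power del: of_real_diff of_real_power)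
      then have pos: "0 < norm (v - of_real lam * z + 2)"
        using z \<open>1 - lam\<^sup>2 > 0\<close> by (metis mult_eq_0_iff norm_ge_zero less_le norm_eq_zero power_eq_0_iff)
      have nz: "norm ((v - of_real lam * z + 2) / z) \<le> norm z"
      proof -
        have "norm (v - of_real lam * z + 2) * 1 \<le> norm (v - of_real lam * z + 2) * norm (v - 2 + of_real lam * z)"
          using \<open>1 \<le> _\<close> by (intro mult_left_mono) auto
        also have "\<dots> \<le> (norm z)\<^sup>2 * 1" unfolding prod using \<open>lam\<^sup>2 \<ge> 0\<close> by (intro mult_left_mono) auto
        finally show "norm ((v - of_real lam * z + 2) / z) \<le> norm z"
          using z by (simp add: norm_divide divide_le_eq power2_eq_square)
      qed
      have "ln (norm ((v - of_real lam * z + 2) / z)) \<le> ln (norm z)"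
        using nz pos z by (intro ln_mono) auto
      ultimately show False using eq lnz unfolding Re_xi_def c_def by linarith
    qed
  qed
  then show "level_set lam \<inter> ball 0 r = {}" by auto
qed

text \<open>Punctured half discs and their exteriors become images of convex half strips, which
  settles their connectedness.\<close>

lemma exp_strip: "exp ` {w. 0 \<le> Im w \<and> Im w \<le> pi \<and> P (Re w)} = {z \<in> Cplus. P (ln (norm z))}"
proof (intro equalityI subsetI)
  fix z assume "z \<in> exp ` {w. 0 \<le> Im w \<and> Im w \<le> pi \<and> P (Re w)}"
  then show "z \<in> {z \<in> Cplus. P (ln (norm z))}" by (auto simp: Cplus_eq Im_exp sin_ge_zero)
next
  fix z assume z: "z \<in> {z \<in> Cplus. P (ln (norm z))}"
  then have "z \<noteq> 0" "0 \<le> Arg z" "Arg z \<le> pi" by (auto simp: Cplus_def)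
  then show "z \<in> exp ` {w. 0 \<le> Im w \<and> Im w \<le> pi \<and> P (Re w)}"
    using z by (intro image_eqI[of _ _ "Ln z"]) (auto simp: Arg_def)
qed

lemma connected_half_disc: "connected (Cplus \<inter> ball 0 r)"
proof (cases "r > 0")
  case True
  have "{z \<in> Cplus. ln (norm z) < ln r} = Cplus \<inter> ball 0 r" using True by (auto simp: Cplus_eq)
  moreover have "connected (exp ` {w. 0 \<le> Im w \<and> Im w \<le> pi \<and> Re w < ln r})"
  proof (intro connected_continuous_image convex_connected continuous_intros)
    have "{w. 0 \<le> Im w \<and> Im w \<le> pi \<and> Re w < ln r} = {w. 0 \<le> Im w} \<inter> {w. Im w \<le> pi} \<inter> {w. Re w < ln r}" by auto
    then show "convex {w. 0 \<le> Im w \<and> Im w \<le> pi \<and> Re w < ln r}"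
      using convex_halfspace_Im_ge convex_halfspace_Im_le convex_halfspace_Re_lt by (auto intro!: convex_Int)
  qed
  ultimately show ?thesis using exp_strip[of "\<lambda>x. x < ln r"] by simp
next
  case False
  then have "Cplus \<inter> ball 0 r = {}" by (auto dest: le_less_trans[OF norm_ge_zero])
  then show ?thesis by (metis connected_empty)
qed

lemma connected_outer_half_disc:
  assumes "r > 0" shows "connected {z \<in> Cplus. r < norm z}"
proof -
  have "{z \<in> Cplus. ln r < ln (norm z)} = {z \<in> Cplus. r < norm z}" using assms by (auto simp: Cplus_eq)
  moreover have "connected (exp ` {w. 0 \<le> Im w \<and> Im w \<le> pi \<and> ln r < Re w})"
  proof (intro connected_continuous_image convex_connected continuous_intros)
    have "{w. 0 \<le> Im w \<and> Im w \<le> pi \<and> ln r < Re w} = {w. 0 \<le> Im w} \<inter> {w. Im w \<le> pi} \<inter> {w. Re w > ln r}" by auto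
    then show "convex {w. 0 \<le> Im w \<and> Im w \<le> pi \<and> ln r < Re w}"
      using convex_halfspace_Im_ge convex_halfspace_Im_le convex_halfspace_Re_gt by (auto intro!: convex_Int)
  qed
  ultimately show ?thesis using exp_strip[of "\<lambda>x. ln r < x"] by simp
qed

text \<open>At \<open>zplus\<close> the branch \<open>q\<close> of \<open>(z/Z)\<^sup>1\<^sup>/\<^sup>2\<close> would have to be infinite.\<close>

lemma zplus_in_cut:
  assumes lam: "0 \<le> lam" "lam < 1" and "closed K"
    and cont: "continuous_on (Cplus - K) Z" "continuous_on (Cplus - K) q"
    and Z: "\<And>z. z \<in> Cplus - K \<Longrightarrow> (Z z)\<^sup>2 = Zsq lam z"
    and q: "\<And>z. z \<in> Cplus - K \<Longrightarrow> (q z)\<^sup>2 = z / Z z"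
  shows "zplus lam \<in> K"
proof (rule ccontr)
  assume "zplus lam \<notin> K"
  then have zp: "zplus lam \<in> Cplus - K" using zplus_in_Cplus[OF lam] by simp
  let ?F = "at (zplus lam) within (Cplus - K)"
  have "((\<lambda>z. (q z)\<^sup>2 * Z z) \<longlongrightarrow> (q (zplus lam))\<^sup>2 * Z (zplus lam)) ?F"
    using cont zp by (intro tendsto_intros) (auto simp: continuous_on_def)
  moreover have "Z (zplus lam) = 0" using Z[OF zp] lam by simp
  ultimately have "((\<lambda>z. (q z)\<^sup>2 * Z z) \<longlongrightarrow> 0) ?F" by simp
  moreover have "\<forall>\<^sub>F z in ?F. (q z)\<^sup>2 * Z z = z"
  proof -
    have "Z z \<noteq> 0" if "z \<in> Cplus - K" "z \<noteq> zplus lam" for z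
      using Z[OF that(1)] Zsq_eq_0_iff[OF lam] that by force
    then show ?thesis using q by (auto simp: eventually_at_filter)
  qed
  ultimately have "((\<lambda>z. z) \<longlongrightarrow> 0) ?F" by (rule Lim_transform_eventually)
  moreover have "((\<lambda>z. z) \<longlongrightarrow> zplus lam) ?F" by (rule tendsto_ident_at)
  ultimately have "zplus lam = 0"
    using at_within_Cplus_diff_not_bot[OF \<open>closed K\<close> zp] tendsto_unique by blast
  then show False using Im_zplus_pos[OF lam] by simp
qed

text \<open>\<open>S_m1\<close> is the component of the points near \<open>0\<close>; as it is bounded, these points are not in the
  unbounded component \<open>S_1\<close>.\<close>

lemma regions_near_0:
  assumes "S_m1 lam \<noteq> {}" and r: "0 < r" "level_set lam \<inter> ball 0 r = {}"
  shows "bounded (S_m1 lam)" "S_1 lam \<inter> ball 0 r = {}"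
proof -
  let ?U = "Cplus - level_set lam"
  define C where "C = connected_component_set ?U (of_real (r / 2))"
  have sub: "Cplus \<inter> ball 0 r \<subseteq> C"
    unfolding C_def using r of_real_in_Cplus[of "r / 2"]
    by (intro connected_component_maximal connected_half_disc) auto
  have comp: "bounded C \<and> z \<in> C" if z: "z \<in> S_m1 lam" for z
  proof -
    let ?C = "connected_component_set ?U z"
    have "0 \<in> closure ?C" and b: "bounded ?C" and "z \<in> ?U"
      using z by (auto simp: S_m1_def frontier_def)
    then obtain w where w: "w \<in> ?C" "norm w < r"
      using r closure_approachable[of 0 ?C] by auto
    then have "w \<in> Cplus" using connected_component_subset[of ?U z] by blast
    then have "w \<in> C" using w sub by auto
    then have "?C = C" using w(1) unfolding C_def by (metis connected_component_eq)
    then show ?thesis using b \<open>z \<in> ?U\<close> by (metis connected_component_refl_eq mem_Collect_eq)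
  qed
  with assms(1) have "bounded C" by blast
  then show "bounded (S_m1 lam)" using comp by (auto intro: bounded_subset)
  show "S_1 lam \<inter> ball 0 r = {}"
  proof (intro equals0I)
    fix w assume w: "w \<in> S_1 lam \<inter> ball 0 r"
    then obtain R where R: "R > 0" "\<And>x. x \<ge> R \<Longrightarrow> connected_component ?U w (of_real (- x))"
      by (auto simp: S_1_def)
    then have "w \<in> Cplus" using connected_component_in by fastforce
    with w sub have "w \<in> C" by auto
    then have in_C: "of_real (- x) \<in> C" if "x \<ge> R" for x
      using R(2)[OF that] unfolding C_def by (auto intro: connected_component_trans)
    obtain B where "\<And>z. z \<in> C \<Longrightarrow> norm z \<le> B" using \<open>bounded C\<close> by (auto simp: bounded_iff)
    from this[OF in_C[of "max R (B + 1)"]] have "\<bar>max R (B + 1)\<bar> \<le> B"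
      unfolding norm_of_real by simp
    then show False by simp
  qed
qed

section \<open>The truncated Riccati equation\<close>

text \<open>The products \<open>a j * a k\<close> are sorted by whether
  \<open>j + k \<le> M\<close>. The first part, with \<open>s = j + k\<close>, has the convolutions
  of the recursion; the second, with \<open>s = j + k - M\<close>, has the sums that define
  \<open>Ghat\<close> for \<open>n = M + 1\<close>.\<close>

lemma square_of_sum_split:
  fixes a :: "nat \<Rightarrow> complex"
  shows "(\<Sum>s=1..M. a s)\<^sup>2 =
    (\<Sum>s=1..M. \<Sum>j=1..s-1. a j * a (s - j)) + (\<Sum>s=1..M. \<Sum>k=s..M. a k * a (s + M - k))"
proof -
  let ?f = "\<lambda>(j, k). a j * a k"
  let ?P = "{(j, k). 1 \<le> j \<and> 1 \<le> k \<and> j + k \<le> M}"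
  let ?Q = "{(j, k). j \<le> M \<and> k \<le> M \<and> M < j + k}"
  have fin: "finite ?P" "finite ?Q"
    by (rule finite_subset[of _ "{..M} \<times> {..M}"]; auto)+
  have "(\<Sum>s=1..M. a s)\<^sup>2 = sum ?f ({1..M} \<times> {1..M})"
    by (simp add: power2_eq_square sum_product sum.cartesian_product)
  also have "{1..M} \<times> {1..M} = ?P \<union> ?Q" by auto
  also have "sum ?f (?P \<union> ?Q) = sum ?f ?P + sum ?f ?Q"
    using fin by (intro sum.union_disjoint) auto
  also have "sum ?f ?P = (\<Sum>(s,j)\<in>(SIGMA s:{1..M}. {1..s-1}). a j * a (s - j))"
    by (rule sum.reindex_bij_witness[of _ "\<lambda>(s,j). (j, s - j)" "\<lambda>(j,k). (j + k, j)"]) auto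
  also have "\<dots> = (\<Sum>s=1..M. \<Sum>j=1..s-1. a j * a (s - j))"
    by (subst sum.Sigma) auto
  also have "sum ?f ?Q = (\<Sum>(s,k)\<in>(SIGMA s:{1..M}. {s..M}). a k * a (s + M - k))"
    by (rule sum.reindex_bij_witness[of _ "\<lambda>(s,k). (k, s + M - k)" "\<lambda>(j,k). (j + k - M, j)"]) auto
  also have "\<dots> = (\<Sum>s=1..M. \<Sum>k=s..M. a k * a (s + M - k))"
    by (subst sum.Sigma) auto
  finally show ?thesis .
qed

text \<open>Inserting the truncated series \<open>u + \<Sum> f s / u ^ s\<close> into the Riccati equation, all terms of
  order below \<open>N - 1\<close> in \<open>1 / u\<close> cancel by the recursion.\<close>

lemma truncated_Riccati:
  fixes f :: "nat \<Rightarrow> complex" and u :: complex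
  assumes "u \<noteq> 0" "1 \<le> N"
  defines "\<sigma> \<equiv> \<Sum>s=1..N-1. f s / u ^ s"
  shows "(\<Sum>s=1..N-1. - 2 * (f (Suc s) + 1/2 * (\<Sum>j=1..s-1. f j * f (s - j))) / u ^ s)
      + 2 * u * \<sigma> + \<sigma>\<^sup>2 - 2 * f 1 =
    (- 2 * f N + (\<Sum>s=1..N-1. (\<Sum>k=s..N-1. f k * f (s + N - k - 1)) / u ^ s)) / u ^ (N - 1)"
proof -
  obtain M where M: "N = Suc M" using \<open>1 \<le> N\<close> by (cases N) auto
  \<comment> \<open>Telescoping: \<open>2 u\<close> times the term with index \<open>s + 1\<close>
    of the series is \<open>2 f (s + 1) / u ^ s\<close>, so only the last coefficient
    survives.\<close>
  have tel: "(\<Sum>s=1..M. - 2 * f (Suc s) / u ^ s) + 2 * u * (\<Sum>s=1..M. f s / u ^ s) - 2 * f 1 = - 2 * f (Suc M) / u ^ M"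
  proof (induction M)
    case (Suc M)
    have "2 * u * (f (Suc M) / u ^ Suc M) = 2 * f (Suc M) / u ^ M" using \<open>u \<noteq> 0\<close> by simp
    moreover have "(\<Sum>s=1..Suc M. - 2 * f (Suc s) / u ^ s) + 2 * u * (\<Sum>s=1..Suc M. f s / u ^ s) - 2 * f 1 =
        ((\<Sum>s=1..M. - 2 * f (Suc s) / u ^ s) + 2 * u * (\<Sum>s=1..M. f s / u ^ s) - 2 * f 1)
        + (- 2 * f (Suc (Suc M)) / u ^ Suc M + 2 * u * (f (Suc M) / u ^ Suc M))"
      by (simp add: distrib_left)
    ultimately show ?case unfolding Suc.IH by simp
  qed simp
  have "\<sigma>\<^sup>2 = (\<Sum>s=1..M. \<Sum>j=1..s-1. f j / u ^ j * (f (s - j) / u ^ (s - j))) +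
      (\<Sum>s=1..M. \<Sum>k=s..M. f k / u ^ k * (f (s + M - k) / u ^ (s + M - k)))"
    unfolding \<sigma>_def M diff_Suc_1 by (rule square_of_sum_split)
  also have "(\<Sum>s=1..M. \<Sum>j=1..s-1. f j / u ^ j * (f (s - j) / u ^ (s - j))) =
      (\<Sum>s=1..M. (\<Sum>j=1..s-1. f j * f (s - j)) / u ^ s)"
    by (intro sum.cong refl) (auto simp: sum_divide_distrib power_add[symmetric] intro!: sum.cong)
  also have "(\<Sum>s=1..M. \<Sum>k=s..M. f k / u ^ k * (f (s + M - k) / u ^ (s + M - k))) =
      (\<Sum>s=1..M. (\<Sum>k=s..M. f k * f (s + M - k)) / u ^ s) / u ^ M"
    unfolding sum_divide_distrib
    by (intro sum.cong refl) (auto simp: sum_divide_distrib power_add[symmetric] intro!: sum.cong)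
  finally have sq: "\<sigma>\<^sup>2 = (\<Sum>s=1..M. (\<Sum>j=1..s-1. f j * f (s - j)) / u ^ s) +
     (\<Sum>s=1..M. (\<Sum>k=s..M. f k * f (s + M - k)) / u ^ s) / u ^ M" .
  have "(\<Sum>s=1..M. - 2 * (f (Suc s) + 1/2 * (\<Sum>j=1..s-1. f j * f (s - j))) / u ^ s) =
     (\<Sum>s=1..M. - 2 * f (Suc s) / u ^ s) - (\<Sum>s=1..M. (\<Sum>j=1..s-1. f j * f (s - j)) / u ^ s)"
    unfolding sum_subtractf[symmetric] by (intro sum.cong refl) (simp add: diff_divide_distrib)
  then show ?thesis
    using tel unfolding sq unfolding \<sigma>_def M by (simp add: add_divide_distrib diff_divide_distrib algebra_simps)
qed

section \<open>Derivatives of the branches\<close>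

lemma has_field_derivative_log_branch:
  fixes L :: "complex \<Rightarrow> complex"
  assumes "continuous (at z within S) L" "((\<lambda>x. exp (L x)) has_field_derivative d) (at z within S)"
  shows "(L has_field_derivative d / exp (L z)) (at z within S)"
  by (rule has_field_derivative_of_compose[where \<phi> = exp, OF DERIV_exp _ assms]) simp

lemma has_field_derivative_sqrt_branch:
  fixes f :: "complex \<Rightarrow> complex"
  assumes "continuous (at z within S) f" "((\<lambda>x. (f x)\<^sup>2) has_field_derivative d) (at z within S)" "f z \<noteq> 0"
  shows "(f has_field_derivative d / (2 * f z)) (at z within S)"
proof (rule has_field_derivative_of_compose[where \<phi> = "\<lambda>w. w\<^sup>2", OF _ _ assms(1,2)])
  show "((\<lambda>w. w\<^sup>2) has_field_derivative 2 * f z) (at (f z))" by (auto intro!: derivative_eq_intros)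
qed (use assms in auto)

locale liouville_branches =
  fixes lam :: real and K :: "complex set" and B :: branches
  assumes lam': "0 \<le> lam" "lam < 1" and closed_K': "closed K" and branches: "branches_on lam (Cplus - K) B"
begin

abbreviation "Z \<equiv> bZ B"
abbreviation "\<xi> \<equiv> bxi B"
abbreviation "q \<equiv> bq B"
abbreviation "E \<equiv> bE B"

lemma branches_basic:
  "continuous_on (Cplus - K) Z" "\<And>z. z \<in> Cplus - K \<Longrightarrow> (Z z)\<^sup>2 = Zsq lam z"
  "continuous_on (Cplus - K) q" "\<And>z. z \<in> Cplus - K \<Longrightarrow> (q z)\<^sup>2 = z / Z z"
  "\<And>s z. 1 \<le> s \<Longrightarrow> z \<in> Cplus - K \<Longrightarrow> integral_from_infinity (Cplus - K) (\<lambda>t. Z t * Fhat (Cplus - K) Z lam s t / t) z (2 * E s z)"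
  using branches unfolding branches_on_def by simp_all

lemma branches_real:
  assumes "x > 0"
  shows "Z (of_real x) \<in> \<real>" "Re (Z (of_real x)) > 0" "\<xi> (of_real x) \<in> \<real>"
    "q (of_real x) \<in> \<real>" "Re (q (of_real x)) > 0"
  using branches assms unfolding branches_on_def by simp_all

sublocale liouville_sheet lam K Z
  by standard (use lam' closed_K' branches_basic zplus_in_cut[OF lam' closed_K' branches_basic(1,3,2,4)] in auto)

lemma xi_logs:
  obtains L1 L2 where "continuous_on D L1" "continuous_on D L2"
    "\<And>z. z \<in> D \<Longrightarrow> exp (L1 z) = Z z + z - 2 * of_real lam"
    "\<And>z. z \<in> D \<Longrightarrow> exp (L2 z) = (Z z - of_real lam * z + 2) / z"
    "\<And>z. z \<in> D \<Longrightarrow> \<xi> z = Z z / 2 - of_real lam * L1 z - L2 z"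
proof -
  have "\<exists>L1 L2. continuous_on D L1 \<and> continuous_on D L2 \<and>
      (\<forall>z\<in>D. exp (L1 z) = Z z + z - 2 * of_real lam \<and> exp (L2 z) = (Z z - of_real lam * z + 2) / z \<and>
         \<xi> z = Z z / 2 - of_real lam * L1 z - L2 z)"
    using branches unfolding branches_on_def by (elim conjE)
  then show ?thesis using that by blast
qed

lemma q_nonzero: "z \<in> D \<Longrightarrow> q z \<noteq> 0"
  using branches_basic(4)[of z] nonzero[of z] by auto

text \<open>Since \<open>Z\<close> has derivative \<open>(z - 2 lam) / Z\<close>, the two logarithms
  have derivatives \<open>1 / Z\<close> and \<open>- 2 / (z Z)\<close>. The sum of the three
  contributions is then \<open>Z^2 / (2 z Z)\<close>.\<close>

lemma deriv_xi:
  assumes z: "z \<in> D"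
  shows "(\<xi> has_field_derivative Z z / (2 * z)) (at z within D)"
proof -
  obtain L1 L2 where L: "continuous_on D L1" "continuous_on D L2"
    "\<And>z. z \<in> D \<Longrightarrow> exp (L1 z) = Z z + z - 2 * of_real lam"
    "\<And>z. z \<in> D \<Longrightarrow> exp (L2 z) = (Z z - of_real lam * z + 2) / z"
    "\<And>z. z \<in> D \<Longrightarrow> \<xi> z = Z z / 2 - of_real lam * L1 z - L2 z" using xi_logs by blast
  define d where "d = (z - 2 * of_real lam) / Z z"
  note nz = nonzero[OF z]
  have dZ: "(Z has_field_derivative d) (at z within D)" unfolding d_def by (rule deriv_Z[OF z])
  have e1: "Z z + z - 2 * of_real lam \<noteq> 0" using L(3)[OF z] exp_not_eq_zero by metis
  have e2: "(Z z - of_real lam * z + 2) / z \<noteq> 0" using L(4)[OF z] exp_not_eq_zero by metis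
  have e2': "Z z - of_real lam * z + 2 \<noteq> 0" using e2 by auto
  have "((\<lambda>z. exp (L1 z)) has_field_derivative d + 1) (at z within D)"
  proof (rule has_field_derivative_transform_within[OF _ zero_less_one z])
    show "((\<lambda>z. Z z + z - 2 * of_real lam) has_field_derivative d + 1) (at z within D)"
      by (auto intro!: derivative_eq_intros dZ)
  qed (simp add: L(3))
  then have L1: "(L1 has_field_derivative (d + 1) / (Z z + z - 2 * of_real lam)) (at z within D)"
    using has_field_derivative_log_branch[of z D L1, unfolded L(3)[OF z]] L(1) z
    unfolding continuous_on_eq_continuous_within by blast
  have "((\<lambda>z. exp (L2 z)) has_field_derivative ((d - of_real lam) * z - (Z z - of_real lam * z + 2)) / (z * z)) (at z within D)"
  proof (rule has_field_derivative_transform_within[OF _ zero_less_one z])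
    show "((\<lambda>z. (Z z - of_real lam * z + 2) / z) has_field_derivative
        ((d - of_real lam) * z - (Z z - of_real lam * z + 2)) / (z * z)) (at z within D)"
      using nz by (auto intro!: derivative_eq_intros dZ)
  qed (simp add: L(4))
  then have L2: "(L2 has_field_derivative ((d - of_real lam) * z - (Z z - of_real lam * z + 2)) / (z * z)
      / ((Z z - of_real lam * z + 2) / z)) (at z within D)"
    using has_field_derivative_log_branch[of z D L2, unfolded L(4)[OF z]] L(2) z
    unfolding continuous_on_eq_continuous_within by blast
  have t1: "(d + 1) / (Z z + z - 2 * of_real lam) = 1 / Z z"
  proof -
    have "d + 1 = (Z z + z - 2 * of_real lam) / Z z" using nz by (simp add: d_def field_simps)
    then show ?thesis using e1 by simp
  qed
  have "((d - of_real lam) * z - (Z z - of_real lam * z + 2)) * Z z = - 2 * (Z z - of_real lam * z + 2)"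
  proof -
    have dZ: "d * Z z = z - 2 * of_real lam" using nz by (simp add: d_def)
    have sq: "Z z * Z z = z * z - 4 * of_real lam * z + 4" using Z_sq[OF z] by (simp add: Zsq_def power2_eq_square)
    have "((d - of_real lam) * z - (Z z - of_real lam * z + 2)) * Z z = d * Z z * z - Z z * Z z - 2 * Z z"
      by (simp add: algebra_simps)
    then show ?thesis unfolding dZ sq by (simp add: algebra_simps)
  qed
  then have num: "(d - of_real lam) * z - (Z z - of_real lam * z + 2) = - 2 * (Z z - of_real lam * z + 2) / Z z"
    using nz by (simp add: eq_divide_eq)
  have cancel: "- 2 * X / Z z / (z * z) / (X / z) = - 2 / (Z z * z)" if "X \<noteq> 0" for X
    using nz that by simp
  have t2: "((d - of_real lam) * z - (Z z - of_real lam * z + 2)) / (z * z)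
      / ((Z z - of_real lam * z + 2) / z) = - 2 / (Z z * z)"
    unfolding num by (rule cancel[OF e2'])
  have "((\<lambda>z. Z z / 2 - of_real lam * L1 z - L2 z) has_field_derivative d / 2 - of_real lam * (1 / Z z) - - 2 / (Z z * z)) (at z within D)"
    using L1 L2 unfolding t1 t2 by (auto intro!: derivative_eq_intros dZ)
  moreover have "d / 2 - of_real lam * (1 / Z z) - - 2 / (Z z * z) = Z z / (2 * z)"
  proof -
    have "Z z / (2 * z) = (Z z * Z z) / (2 * z * Z z)" using nz by simp
    also have "Z z * Z z = z * z - 4 * of_real lam * z + 4" using Z_sq[OF z] by (simp add: Zsq_def power2_eq_square)
    also have "(z * z - 4 * of_real lam * z + 4) / (2 * z * Z z) = d / 2 - of_real lam * (1 / Z z) - - 2 / (Z z * z)"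
      using nz by (simp add: d_def field_simps)
    finally show ?thesis ..
  qed
  ultimately have "((\<lambda>z. Z z / 2 - of_real lam * L1 z - L2 z) has_field_derivative Z z / (2 * z)) (at z within D)" by simp
  then show ?thesis by (rule has_field_derivative_transform_within[OF _ zero_less_one z]) (simp add: L(5))
qed

text \<open>The logarithmic derivative of \<open>q\<close> with respect to \<open>\<xi>\<close>,
  where \<open>d\<xi>/dz = Z / (2 z)\<close>.\<close>

definition \<theta> :: "complex \<Rightarrow> complex" where
  "\<theta> z = (1 - z * (z - 2 * of_real lam) / (Z z)\<^sup>2) / Z z"

lemma deriv_q:
  assumes z: "z \<in> D"
  shows "(q has_field_derivative Z z / (2 * z) * (\<theta> z * q z)) (at z within D)"
proof -
  note nz = nonzero[OF z]
  moreover have "((\<lambda>z. (q z)\<^sup>2) has_field_derivative (Z z - z * ((z - 2 * of_real lam) / Z z)) / (Z z * Z z)) (at z within D)"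
  proof (rule has_field_derivative_transform_within[OF _ zero_less_one z])
    show "((\<lambda>z. z / Z z) has_field_derivative (Z z - z * ((z - 2 * of_real lam) / Z z)) / (Z z * Z z)) (at z within D)"
      using nz by (auto intro!: derivative_eq_intros deriv_Z z)
  qed (use branches_basic(4) in auto)
  ultimately have "(q has_field_derivative (Z z - z * ((z - 2 * of_real lam) / Z z)) / (Z z * Z z) / (2 * q z)) (at z within D)"
    using branches_basic(3) q_nonzero[OF z] z
    by (intro has_field_derivative_sqrt_branch) (auto simp: continuous_on_eq_continuous_within)
  moreover have "(Z z - z * ((z - 2 * of_real lam) / Z z)) / (Z z * Z z) / (2 * q z) = Z z / (2 * z) * (\<theta> z * q z)"
  proof -
    have "(Z z - z * ((z - 2 * of_real lam) / Z z)) / (Z z * Z z) = \<theta> z"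
    proof -
      have "(Z z - z * (a / Z z)) / (Z z * Z z) = (1 - z * a / (Z z)\<^sup>2) / Z z" for a
        using nz by (simp add: diff_divide_distrib power2_eq_square)
      then show ?thesis unfolding \<theta>_def .
    qed
    also have "\<theta> z = 2 * (Z z / (2 * z) * \<theta> z) * (q z)\<^sup>2"
      unfolding branches_basic(4)[OF z] using nz by simp
    finally have "(Z z - z * ((z - 2 * of_real lam) / Z z)) / (Z z * Z z) = 2 * (Z z / (2 * z) * \<theta> z) * (q z)\<^sup>2" .
    then show ?thesis using q_nonzero[OF z] by (simp add: power2_eq_square)
  qed
  ultimately show ?thesis by simp
qed

text \<open>This is where the explicit formula for \<open>F 1\<close> enters. When
  \<open>q exp (u \<xi>)\<close> is inserted into Whittaker's equation, written in the variable
  \<open>\<xi>\<close>, the terms with \<open>u\<close> cancel and the residual is the derivative of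
  \<open>\<theta>\<close> minus \<open>\<theta>^2\<close> plus \<open>1 / Z^2\<close>; the lemma
  identifies it as \<open>- 2 F 1\<close>.\<close>

lemma deriv_theta:
  assumes z: "z \<in> D"
  shows "(\<theta> has_field_derivative Z z / (2 * z) * ((\<theta> z)\<^sup>2 - 1 / (Z z)\<^sup>2 - 2 * F 1 z)) (at z within D)"
proof -
  note nz = nonzero[OF z]
  let ?W = "\<lambda>z. inverse (Z z)" and ?a = "\<lambda>z. z - 2 * of_real lam"
  \<comment> \<open>With \<open>w\<close> in place of \<open>1 / Z\<close> all expressions are
    polynomials in \<open>z\<close> and \<open>w\<close>. The single relation
    \<open>Zsq w^2 = 1\<close> is used to bring the terms to the same power of
    \<open>w\<close>.\<close>
  define w where "w = inverse (Z z)"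
  have Zw: "Z z * w = 1" using nz by (simp add: w_def)
  then have Qw: "Zsq lam z * w\<^sup>2 = 1"
    unfolding Z_sq[OF z, symmetric] power_mult_distrib[symmetric] by simp
  have dW: "(?W has_field_derivative - (?a z * w ^ 3)) (at z within D)"
    using DERIV_inverse'[OF deriv_Z[OF z] nz(2)]
    by (simp add: w_def divide_inverse power3_eq_cube mult_ac)
  have theta_eq: "\<theta> z = ?W z - z * ?a z * ?W z ^ 3" for z
    by (simp add: \<theta>_def divide_inverse power_inverse algebra_simps eval_nat_numeral)
  have "((\<lambda>z. W z - z * ?a z * W z ^ 3) has_field_derivative
      W' - ((2 * z - 2 * of_real lam) * W z ^ 3 + 3 * (W z)\<^sup>2 * W' * (z * ?a z))) (at z within D)"
    if "(W has_field_derivative W') (at z within D)" for W W'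
    by (auto intro!: derivative_eq_intros that simp: algebra_simps)
  from this[OF dW] have "(\<theta> has_field_derivative - (?a z * w ^ 3) -
      ((2 * z - 2 * of_real lam) * w ^ 3 + 3 * w\<^sup>2 * (- (?a z * w ^ 3)) * (z * ?a z))) (at z within D)"
    unfolding theta_eq[abs_def] w_def .
  moreover have "- (?a z * w ^ 3) - ((2 * z - 2 * of_real lam) * w ^ 3 + 3 * w\<^sup>2 * (- (?a z * w ^ 3)) * (z * ?a z))
     = (- (3 * z - 4 * of_real lam) * Zsq lam z + 3 * z * (?a z)\<^sup>2) * w ^ 5"
  proof -
    have "w ^ 3 = Zsq lam z * w\<^sup>2 * w ^ 3" unfolding Qw by simp
    then have w3: "w ^ 3 = Zsq lam z * w ^ 5" by (simp add: eval_nat_numeral)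
    have "- (?a z * w ^ 3) - ((2 * z - 2 * of_real lam) * w ^ 3 + 3 * w\<^sup>2 * (- (?a z * w ^ 3)) * (z * ?a z))
      = - (3 * z - 4 * of_real lam) * w ^ 3 + 3 * z * (?a z)\<^sup>2 * w ^ 5" by algebra
    also have "\<dots> = (- (3 * z - 4 * of_real lam) * Zsq lam z + 3 * z * (?a z)\<^sup>2) * w ^ 5"
      unfolding w3 by (simp add: distrib_right)
    finally show ?thesis .
  qed
  moreover have "Z z / (2 * z) * ((\<theta> z)\<^sup>2 - 1 / (Z z)\<^sup>2 - 2 * F 1 z)
     = (- (3 * z - 4 * of_real lam) * Zsq lam z + 3 * z * (?a z)\<^sup>2) * w ^ 5"
  proof -
    have F1: "2 * F 1 z = - z * (z ^ 3 - 16 * z + 4 * of_real lam ^ 2 * z + 16 * of_real lam) * w ^ 6"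
    proof -
      have "w ^ 6 = 1 / Z z ^ 6" by (simp add: w_def field_simps)
      then show ?thesis by simp
    qed
    have "(\<theta> z)\<^sup>2 - 1 / (Z z)\<^sup>2 - 2 * F 1 z = (w - z * ?a z * w ^ 3)\<^sup>2 - w\<^sup>2
        + z * (z ^ 3 - 16 * z + 4 * of_real lam ^ 2 * z + 16 * of_real lam) * w ^ 6"
      unfolding F1 theta_eq by (simp add: w_def power_one_over inverse_eq_divide)
    also have "\<dots> = 2 * z * ((- (3 * z - 4 * of_real lam) * Zsq lam z + 3 * z * (?a z)\<^sup>2) * w ^ 6)"
    proof -
      have e1: "(w - z * ?a z * w ^ 3)\<^sup>2 - w\<^sup>2 = (- 2 * z * ?a z * Zsq lam z + (z * ?a z)\<^sup>2) * w ^ 6"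
      proof -
        have "w ^ 4 = Zsq lam z * w\<^sup>2 * w ^ 4" unfolding Qw by simp
        then have w4: "w ^ 4 = Zsq lam z * w ^ 6" by (simp add: eval_nat_numeral)
        have "(w - z * ?a z * w ^ 3)\<^sup>2 - w\<^sup>2 = - 2 * z * ?a z * w ^ 4 + (z * ?a z)\<^sup>2 * w ^ 6"
          by algebra
        then show ?thesis unfolding w4 by (simp add: algebra_simps)
      qed
      have e2: "- 2 * z * ?a z * Zsq lam z + (z * ?a z)\<^sup>2 + z * (z ^ 3 - 16 * z + 4 * of_real lam ^ 2 * z + 16 * of_real lam)
         = 2 * z * (- (3 * z - 4 * of_real lam) * Zsq lam z + 3 * z * (?a z)\<^sup>2)"
        unfolding Zsq_def by algebra
      show ?thesis unfolding e1 distrib_right[symmetric] e2 by (rule mult.assoc)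
    qed
    finally have "Z z / (2 * z) * ((\<theta> z)\<^sup>2 - 1 / (Z z)\<^sup>2 - 2 * F 1 z) =
        (- (3 * z - 4 * of_real lam) * Zsq lam z + 3 * z * (?a z)\<^sup>2) * (Z z * w ^ 6)"
      using nz by simp
    also have "Z z * w ^ 6 = w ^ 5" using Zw by (simp add: eval_nat_numeral mult.assoc[symmetric])
    finally show ?thesis .
  qed
  ultimately show ?thesis by simp
qed

end

section \<open>The error system on a single arc\<close>

lemma whittaker_second_deriv:
  assumes "whittaker_solution \<kappa> \<mu> Y"
  shows "(Y has_field_derivative deriv Y w) (at w)" "(deriv Y has_field_derivative deriv (deriv Y) w) (at w)"
    "deriv (deriv Y) w = deriv Y w + (of_real \<mu> ^ 2 - 1/4 - of_real \<kappa> * exp w + (exp w)\<^sup>2 / 4) * Y w"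
proof -
  have Y: "Y holomorphic_on UNIV" using assms by (simp add: whittaker_solution_def)
  then show "(Y has_field_derivative deriv Y w) (at w)" by (auto intro: holomorphic_derivI)
  have "deriv Y holomorphic_on UNIV" using Y by (intro holomorphic_deriv) auto
  then show "(deriv Y has_field_derivative deriv (deriv Y) w) (at w)" by (auto intro: holomorphic_derivI)
  have "(deriv (deriv Y) w - deriv Y w) / (exp w)\<^sup>2 =
        ((of_real \<mu> ^ 2 - 1/4) / (exp w)\<^sup>2 - of_real \<kappa> / exp w + 1/4) * Y w"
    using assms by (simp add: whittaker_solution_def)
  then have "deriv (deriv Y) w - deriv Y w = (((of_real \<mu> ^ 2 - 1/4) / (exp w)\<^sup>2 - of_real \<kappa> / exp w + 1/4) * (exp w)\<^sup>2) * Y w"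
    by (simp add: divide_eq_eq)
  also have "((of_real \<mu> ^ 2 - 1/4) / (exp w)\<^sup>2 - of_real \<kappa> / exp w + 1/4) * (exp w)\<^sup>2 =
      of_real \<mu> ^ 2 - 1/4 - of_real \<kappa> * exp w + (exp w)\<^sup>2 / 4"
    by (simp add: left_diff_distrib distrib_right diff_divide_distrib power2_eq_square)
  finally show "deriv (deriv Y) w = deriv Y w + (of_real \<mu> ^ 2 - 1/4 - of_real \<kappa> * exp w + (exp w)\<^sup>2 / 4) * Y w"
    by (simp add: diff_eq_eq add.commute)
qed

text \<open>The algebra behind the equation for \<open>k\<close>: \<open>y0\<close> and
  \<open>y1\<close> stand for \<open>Y\<close> and its derivative, \<open>W\<close> for
  \<open>1 / Z\<close>, \<open>Q\<close> for \<open>Zsq\<close>, \<open>a\<close> for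
  \<open>z - 2 lam\<close>, \<open>th\<close>, \<open>s\<close>, \<open>r\<close>, \<open>f\<close>
  for \<open>\<theta>\<close>, \<open>\<sigma>\<close>, \<open>R\<close>, \<open>F 1\<close>. The
  left side is \<open>dk/d\<xi>\<close> by the product rule, the right side is
  \<open>- 2 (u + \<sigma>) k - R h\<close>.\<close>

lemma logarithmic_factor_identity:
  fixes A y0 y1 W th u s z a Q r f :: complex
  assumes "Q * W\<^sup>2 = 1" and th: "th = W - z * a * W ^ 3"
  shows "- (th + u + s) * (A * (2 * y1 * W - (th + u + s) * y0)) +
      A * (4 * W\<^sup>2 * (y1 + (u\<^sup>2 * Q / 4 - 1/4) * y0) - 4 * y1 * (z * a * W ^ 4)
        - ((th\<^sup>2 - W\<^sup>2 - 2 * f) + (r + 2 * f - 2 * u * s - s\<^sup>2)) * y0 - (th + u + s) * (2 * W * y1)) =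
      - 2 * (u + s) * (A * (2 * y1 * W - (th + u + s) * y0)) - r * (A * y0)"
proof -
  have "z * a * W ^ 4 = W\<^sup>2 - th * W" unfolding th by algebra
  moreover have "4 * W\<^sup>2 * (y1 + (u\<^sup>2 * Q / 4 - 1/4) * y0) = 4 * W\<^sup>2 * y1 + (u\<^sup>2 * (Q * W\<^sup>2) - W\<^sup>2) * y0"
    by (simp add: algebra_simps)
  ultimately show ?thesis unfolding assms(1) by (simp only:) (simp add: algebra_simps power2_eq_square)
qed

text \<open>For \<open>M\<close> one takes \<open>u = \<mu>\<close>, for \<open>W\<close> one takes \<open>u = - \<mu>\<close>; \<open>c\<close> normalizes the approximate solution.\<close>

locale liouville_solution = liouville_branches +
  fixes \<mu> u :: real and Y :: "complex \<Rightarrow> complex" and c :: complex and N :: nat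
  assumes \<mu>: "\<mu> > 0" and u: "\<bar>u\<bar> = \<mu>" and N: "1 \<le> N" and c: "c \<noteq> 0"
    and Y: "whittaker_solution (lam * \<mu>) \<mu> Y"
begin

abbreviation "w z \<equiv> Ln (of_real \<mu> * z)"

text \<open>Since \<open>E s\<close> has derivative \<open>F s\<close> with respect to
  \<open>\<xi>\<close>, this is the derivative of the truncated series in the exponent.\<close>

definition "\<sigma> z = (\<Sum>s=1..N-1. F s z / of_real u ^ s)"

text \<open>The right side of \<open>truncated_Riccati\<close>: the residual that remains when
  \<open>1 / A\<close> is inserted into the differential equation in the variable
  \<open>\<xi>\<close>.\<close>

definition "R z = (- 2 * F N z + (\<Sum>s=1..N-1. G N s z / of_real u ^ s)) / of_real u ^ (N - 1)"

text \<open>\<open>1/A\<close> is the approximate solution, and \<open>k\<close> is the derivative of \<open>h\<close> with respect to \<open>\<xi>\<close>.\<close>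

definition "A z = 1 / (c * q z * exp (of_real u * \<xi> z + (\<Sum>s=1..N-1. E s z / of_real u ^ s)))"

definition "h z = A z * Y (w z)"

definition "k z = A z * (2 * deriv Y (w z) / Z z - (\<theta> z + of_real u + \<sigma> z) * Y (w z))"

lemma u_nonzero: "u \<noteq> 0" using u \<mu> by auto

lemma exp_w: "z \<in> D \<Longrightarrow> exp (w z) = of_real \<mu> * z"
  using \<mu> nonzero[of z] by simp

lemma w_eq: "z \<in> D \<Longrightarrow> w z = of_real (ln \<mu>) + Ln z"
  using \<mu> nonzero[of z] by (simp add: Ln_times_of_real Ln_of_real)

lemma deriv_w:
  assumes "z \<in> D" shows "(w has_field_derivative 1 / z) (at z within D)"
proof (rule has_field_derivative_transform_within[OF _ zero_less_one assms])
  show "((\<lambda>z. of_real (ln \<mu>) + Ln z) has_field_derivative 1 / z) (at z within D)"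
    using DERIV_add[OF DERIV_const has_field_derivative_Ln_Cplus[of z D]] assms by simp
qed (use w_eq in auto)

lemma continuous_on_R: "continuous_on D R" and continuous_on_sigma: "continuous_on D \<sigma>"
  unfolding R_def \<sigma>_def using u_nonzero
  by (intro continuous_intros continuous_on_F continuous_on_G; simp)+

text \<open>Termwise differentiation by \<open>deriv_F\<close> leads to the left side of
  \<open>truncated_Riccati\<close>. The term \<open>2 F 1\<close> cancels the one in
  \<open>deriv_theta\<close> when \<open>\<theta> + \<sigma>\<close> is differentiated.\<close>

lemma deriv_sigma:
  assumes z: "z \<in> D"
  shows "(\<sigma> has_field_derivative Z z / (2 * z) * (R z + 2 * F 1 z - 2 * of_real u * \<sigma> z - (\<sigma> z)\<^sup>2)) (at z within D)"
proof -
  have "(\<sigma> has_field_derivative (\<Sum>s=1..N-1. - (Z z / z) * (F (Suc s) z + 1/2 * (\<Sum>j=1..s-1. F j z * F (s - j) z)) / of_real u ^ s)) (at z within D)"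
    unfolding \<sigma>_def by (intro DERIV_sum DERIV_cdivide deriv_F z) auto
  also have "(\<Sum>s=1..N-1. - (Z z / z) * (F (Suc s) z + 1/2 * (\<Sum>j=1..s-1. F j z * F (s - j) z)) / of_real u ^ s) =
    Z z / (2 * z) * (\<Sum>s=1..N-1. - 2 * (F (Suc s) z + 1/2 * (\<Sum>j=1..s-1. F j z * F (s - j) z)) / of_real u ^ s)"
  proof -
    have "- (Z z / z) * X / U = Z z / (2 * z) * (- 2 * X / U)" for X U :: complex by simp
    then show ?thesis unfolding sum_distrib_left by (intro sum.cong refl)
  qed
  also have "(\<Sum>s=1..N-1. - 2 * (F (Suc s) z + 1/2 * (\<Sum>j=1..s-1. F j z * F (s - j) z)) / of_real u ^ s) =
    R z + 2 * F 1 z - 2 * of_real u * \<sigma> z - (\<sigma> z)\<^sup>2"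
    using truncated_Riccati[of "of_real u" N "\<lambda>s. F s z"] u_nonzero N
    unfolding R_def \<sigma>_def Ghat_def by (simp add: algebra_simps)
  finally show ?thesis .
qed

text \<open>The functions \<open>h + k / 2u\<close> and \<open>- k / 2u\<close> diagonalize the equation for \<open>h\<close> up to small terms.\<close>

lemma arc_bound:
  fixes p p' :: "real \<Rightarrow> complex"
  assumes "a \<le> b"
    and p: "\<And>v. v \<in> {a..b} \<Longrightarrow> (p has_vector_derivative p' v) (at v within {a..b})"
    and p': "continuous_on {a..b} p'" and pD: "p ` {a..b} \<subseteq> D" and reach: "reachable D (p a)"
    and mono: "mono_on {a..b} (\<lambda>v. u * Re (\<xi> (p v)))"
  defines "m \<equiv> \<lambda>v. max (norm (h (p v) + k (p v) / (2 * of_real u) - 1)) (norm (k (p v) / (2 * of_real u)))"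
    and "x' \<equiv> \<lambda>v. Z (p v) / (2 * p v) * p' v"
  shows "m b \<le> (m a + integral {a..b} (\<lambda>v. norm (x' v * (R (p v) / (2 * of_real u))))) *
     exp (integral {a..b} (\<lambda>v. 2 * norm (x' v * \<sigma> (p v)) + 2 * norm (x' v * (R (p v) / (2 * of_real u)))))"
proof -
  have cont_p: "continuous_on {a..b} p"
    using p has_vector_derivative_continuous continuous_on_eq_continuous_within by blast
  have comp: "((\<lambda>v. f (p v)) has_vector_derivative x' v * d) (at v within {a..b})"
    if "(f has_field_derivative Z (p v) / (2 * p v) * d) (at (p v) within D)" "v \<in> {a..b}" for f d v
    using field_vector_diff_chain_within[OF p[OF that(2)] DERIV_subset[OF that(1) pD]]
    by (simp add: o_def x'_def mult_ac)
  have nz: "p v \<in> D" "p v \<noteq> 0" "Z (p v) \<noteq> 0" if "v \<in> {a..b}" for v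
  proof -
    show "p v \<in> D" using that pD by blast
    then show "p v \<noteq> 0" "Z (p v) \<noteq> 0" using nonzero by blast+
  qed
  have contD: "continuous_on {a..b} (\<lambda>v. f (p v))" if "continuous_on D f" for f :: "complex \<Rightarrow> complex"
    by (rule continuous_on_compose2[OF that cont_p pD])
  \<comment> \<open>\<open>E s\<close> is differentiated along the path only: its increment from
    \<open>p a\<close> is the integral over the arc, by \<open>reachable_arc\<close>.\<close>
  have dE: "((\<lambda>v. E s (p v)) has_vector_derivative x' v * F s (p v)) (at v within {a..b})"
    if s: "1 \<le> s" and v: "v \<in> {a..b}" for s v
  proof -
    let ?g = "\<lambda>t. Z t * F s t / t"
    have g: "continuous_on D ?g" using nonzero by (intro continuous_intros continuous_on_F cont_Z) auto
    have diff: "2 * E s (p r) - 2 * E s (p a) = integral {a..r} (\<lambda>v. p' v * ?g (p v))" if "r \<in> {a..b}" for r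
    proof -
      have r: "{a..r} \<subseteq> {a..b}" "a \<le> r" using that by auto
      have D: "p ` {a..r} \<subseteq> D" using pD r(1) by blast
      have pr: "(p has_vector_derivative p' v) (at v within {a..r})" if "v \<in> {a..r}" for v
        by (rule has_vector_derivative_within_subset[OF p r(1)]) (use that r(1) in blast)
      have i: "integral_from_infinity D ?g (p a) (2 * E s (p a))"
        by (rule branches_basic(5)[OF s nz(1)]) (use \<open>a \<le> b\<close> in simp)
      have j: "integral_from_infinity D ?g (p r) (2 * E s (p r))"
        by (rule branches_basic(5)[OF s nz(1)[OF that]])
      show ?thesis
        by (rule reachable_arc(2)[OF r(2) pr continuous_on_subset[OF p' r(1)] D reach g i j])
    qed
    have eq: "E s (p r) = E s (p a) + integral {a..r} (\<lambda>v. p' v * ?g (p v)) / 2" if "r \<in> {a..b}" for r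
      unfolding diff[OF that, symmetric] by (simp add: diff_divide_distrib)
    have "continuous_on {a..b} (\<lambda>v. p' v * ?g (p v))"
      by (intro continuous_on_mult p' contD g)
    note step = has_vector_derivative_divide[OF integral_has_vector_derivative[OF this v], of 2]
    have "((\<lambda>r. E s (p a) + integral {a..r} (\<lambda>v. p' v * ?g (p v)) / 2) has_vector_derivative p' v * ?g (p v) / 2) (at v within {a..b})"
      by (rule has_vector_derivative_eq_rhs[OF has_vector_derivative_add[OF has_vector_derivative_const step]]) simp
    then have "((\<lambda>v. E s (p v)) has_vector_derivative p' v * ?g (p v) / 2) (at v within {a..b})"
      by (rule has_vector_derivative_transform[OF v, rotated]) (rule eq)
    then show ?thesis by (simp add: x'_def mult_ac)
  qed
  have dxi: "((\<lambda>v. \<xi> (p v)) has_vector_derivative x' v) (at v within {a..b})" if "v \<in> {a..b}" for v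
    using comp[of \<xi> v 1] deriv_xi[of "p v"] that nz by simp
  have dA: "((\<lambda>v. A (p v)) has_vector_derivative x' v * (- (\<theta> (p v) + of_real u + \<sigma> (p v)) * A (p v))) (at v within {a..b})"
    if v: "v \<in> {a..b}" for v
  proof -
    let ?e = "\<lambda>v. of_real u * \<xi> (p v) + (\<Sum>s=1..N-1. E s (p v) / of_real u ^ s)"
    have "(?e has_vector_derivative of_real u * x' v + (\<Sum>s=1..N-1. x' v * F s (p v) / of_real u ^ s)) (at v within {a..b})"
      by (intro has_vector_derivative_add has_vector_derivative_mult_right has_vector_derivative_sum
          has_vector_derivative_divide dE dxi v) simp
    also have "of_real u * x' v + (\<Sum>s=1..N-1. x' v * F s (p v) / of_real u ^ s) = x' v * (of_real u + \<sigma> (p v))"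
      by (simp add: \<sigma>_def distrib_left sum_distrib_left)
    finally have de: "(?e has_vector_derivative x' v * (of_real u + \<sigma> (p v))) (at v within {a..b})" .
    have "((exp \<circ> (\<lambda>v. - ?e v)) has_vector_derivative - (x' v * (of_real u + \<sigma> (p v))) * exp (- ?e v)) (at v within {a..b})"
      by (rule field_vector_diff_chain_within[OF has_vector_derivative_minus[OF de] DERIV_subset[OF DERIV_exp subset_UNIV]])
    then have exp: "((\<lambda>v. exp (- ?e v)) has_vector_derivative - (x' v * (of_real u + \<sigma> (p v))) * exp (- ?e v)) (at v within {a..b})"
      unfolding o_def .
    have inv: "((\<lambda>v. inverse (q (p v))) has_vector_derivative x' v * (- \<theta> (p v) * inverse (q (p v)))) (at v within {a..b})"
    proof (rule comp[OF _ v])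
      show "((\<lambda>z. inverse (q z)) has_field_derivative Z (p v) / (2 * p v) * (- \<theta> (p v) * inverse (q (p v)))) (at (p v) within D)"
        by (rule DERIV_cong[OF DERIV_inverse'[OF deriv_q[OF nz(1)[OF v]] q_nonzero[OF nz(1)[OF v]]]])
           (use q_nonzero[OF nz(1)[OF v]] in simp)
    qed
    have D: "((\<lambda>v. 1 / c * (inverse (q (p v)) * exp (- ?e v))) has_vector_derivative
       1 / c * (inverse (q (p v)) * (- (x' v * (of_real u + \<sigma> (p v))) * exp (- ?e v)) +
       x' v * (- \<theta> (p v) * inverse (q (p v))) * exp (- ?e v))) (at v within {a..b})"
      by (intro has_vector_derivative_mult_right has_vector_derivative_mult exp inv)
    have A_eq: "A (p v) = 1 / c * (inverse (q (p v)) * exp (- ?e v))" for v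
      unfolding A_def exp_minus by (simp add: field_simps)
    have alg: "1 / c * (i * (- (x * (U + s)) * e) + x * (- t * i) * e) = x * (- (t + U + s) * (1 / c * (i * e)))"
      for i x U s e t :: complex
      by (simp add: algebra_simps add_divide_distrib)
    show ?thesis using D unfolding A_eq alg .
  qed
  note Yd = whittaker_second_deriv[OF Y]
  have dY: "((\<lambda>v. Y (w (p v))) has_vector_derivative x' v * (2 / Z (p v) * deriv Y (w (p v)))) (at v within {a..b})"
    and dY': "((\<lambda>v. deriv Y (w (p v))) has_vector_derivative x' v * (2 / Z (p v) * deriv (deriv Y) (w (p v)))) (at v within {a..b})"
    if v: "v \<in> {a..b}" for v
  proof -
    have chain: "((\<lambda>z. f (w z)) has_field_derivative Z (p v) / (2 * p v) * (2 / Z (p v) * f')) (at (p v) within D)"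
      if "(f has_field_derivative f') (at (w (p v)))" for f f'
      using DERIV_chain2[OF that deriv_w[OF nz(1)[OF v]]] nz[OF v] by simp
    show "((\<lambda>v. Y (w (p v))) has_vector_derivative x' v * (2 / Z (p v) * deriv Y (w (p v)))) (at v within {a..b})"
      by (rule comp[OF chain[OF Yd(1)] v])
    show "((\<lambda>v. deriv Y (w (p v))) has_vector_derivative x' v * (2 / Z (p v) * deriv (deriv Y) (w (p v)))) (at v within {a..b})"
      by (rule comp[OF chain[OF Yd(2)] v])
  qed
  have dh: "((\<lambda>v. h (p v)) has_vector_derivative x' v * k (p v)) (at v within {a..b})" if v: "v \<in> {a..b}" for v
    unfolding h_def k_def
    by (rule has_vector_derivative_eq_rhs[OF has_vector_derivative_mult[OF dA[OF v] dY[OF v]]])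
       (simp add: algebra_simps)
  \<comment> \<open>Together with \<open>dh\<close> this is the second order equation
    \<open>h'' + 2 (u + \<sigma>) h' + R h = 0\<close> in the variable \<open>\<xi>\<close>.\<close>
  have dk: "((\<lambda>v. k (p v)) has_vector_derivative
      x' v * (- 2 * (of_real u + \<sigma> (p v)) * k (p v) - R (p v) * h (p v))) (at v within {a..b})"
    if v: "v \<in> {a..b}" for v
  proof -
    let ?z = "p v"
    define W where "W = inverse (Z ?z)"
    note nzv = nz[OF v]
    have kfun: "(\<lambda>v. k (p v)) = (\<lambda>v. A (p v) * (2 * (deriv Y (w (p v)) * inverse (Z (p v)))
         - (\<theta> (p v) + of_real u + \<sigma> (p v)) * Y (w (p v))))"
      by (simp add: k_def divide_inverse mult.assoc)
    have QW: "Zsq lam ?z * W\<^sup>2 = 1"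
      using nzv unfolding Z_sq[OF nzv(1), symmetric] power_mult_distrib[symmetric] W_def by simp
    have th: "\<theta> ?z = W - ?z * (?z - 2 * of_real lam) * W ^ 3"
      by (simp add: \<theta>_def W_def divide_inverse power_inverse algebra_simps eval_nat_numeral)
    have quot: "- (inverse b * (d / b) * inverse b) = b / (2 * e) * (- 2 * (e * d * inverse b ^ 4))"
      if "b \<noteq> 0" "e \<noteq> 0" for b d e :: complex
      using that by (simp add: field_simps power4_eq_xxxx)
    have "((\<lambda>z. inverse (Z z)) has_field_derivative
        Z ?z / (2 * ?z) * (- 2 * (?z * (?z - 2 * of_real lam) * W ^ 4))) (at ?z within D)"
      unfolding W_def
      by (rule DERIV_cong[OF DERIV_inverse'[OF deriv_Z[OF nzv(1)] nzv(3)] quot[OF nzv(3,2)]])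
    from comp[OF this v] have dW: "((\<lambda>v. inverse (Z (p v))) has_vector_derivative
        x' v * (- 2 * (?z * (?z - 2 * of_real lam) * W ^ 4))) (at v within {a..b})" .
    have Y2: "deriv (deriv Y) (w ?z) = deriv Y (w ?z) + ((of_real u)\<^sup>2 * Zsq lam ?z / 4 - 1/4) * Y (w ?z)"
    proof -
      have "(of_real u :: complex)\<^sup>2 = (of_real \<mu>)\<^sup>2" using u by (metis of_real_power power2_abs)
      then show ?thesis
        unfolding Yd(3)[of "w ?z"] exp_w[OF nzv(1)] by (simp add: Zsq_def algebra_simps power2_eq_square add_divide_distrib diff_divide_distrib)
    qed
    have "((\<lambda>v. A (p v) * (2 * (deriv Y (w (p v)) * inverse (Z (p v)))
         - (\<theta> (p v) + of_real u + \<sigma> (p v)) * Y (w (p v)))) has_vector_derivative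
        A ?z * (2 * (deriv Y (w ?z) * (x' v * (- 2 * (?z * (?z - 2 * of_real lam) * W ^ 4)))
               + x' v * (2 / Z ?z * deriv (deriv Y) (w ?z)) * inverse (Z ?z))
             - ((\<theta> ?z + of_real u + \<sigma> ?z) * (x' v * (2 / Z ?z * deriv Y (w ?z))) +
                (x' v * ((\<theta> ?z)\<^sup>2 - 1 / (Z ?z)\<^sup>2 - 2 * F 1 ?z) + 0
                 + x' v * (R ?z + 2 * F 1 ?z - 2 * of_real u * \<sigma> ?z - (\<sigma> ?z)\<^sup>2)) * Y (w ?z)))
        + x' v * (- (\<theta> ?z + of_real u + \<sigma> ?z) * A ?z) * (2 * (deriv Y (w ?z) * inverse (Z ?z))
         - (\<theta> ?z + of_real u + \<sigma> ?z) * Y (w ?z))) (at v within {a..b})"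
      by (intro has_vector_derivative_mult has_vector_derivative_mult_right has_vector_derivative_diff
          has_vector_derivative_add has_vector_derivative_const dA dY dY' dW v
          comp[OF deriv_theta v] comp[OF deriv_sigma v] nzv(1))
    also have "A ?z * (2 * (deriv Y (w ?z) * (x' v * (- 2 * (?z * (?z - 2 * of_real lam) * W ^ 4)))
               + x' v * (2 / Z ?z * deriv (deriv Y) (w ?z)) * inverse (Z ?z))
             - ((\<theta> ?z + of_real u + \<sigma> ?z) * (x' v * (2 / Z ?z * deriv Y (w ?z))) +
                (x' v * ((\<theta> ?z)\<^sup>2 - 1 / (Z ?z)\<^sup>2 - 2 * F 1 ?z) + 0
                 + x' v * (R ?z + 2 * F 1 ?z - 2 * of_real u * \<sigma> ?z - (\<sigma> ?z)\<^sup>2)) * Y (w ?z)))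
        + x' v * (- (\<theta> ?z + of_real u + \<sigma> ?z) * A ?z) * (2 * (deriv Y (w ?z) * inverse (Z ?z))
         - (\<theta> ?z + of_real u + \<sigma> ?z) * Y (w ?z)) =
       x' v * (- (\<theta> ?z + of_real u + \<sigma> ?z) * (A ?z * (2 * deriv Y (w ?z) * W - (\<theta> ?z + of_real u + \<sigma> ?z) * Y (w ?z))) +
      A ?z * (4 * W\<^sup>2 * (deriv Y (w ?z) + ((of_real u)\<^sup>2 * Zsq lam ?z / 4 - 1/4) * Y (w ?z))
         - 4 * deriv Y (w ?z) * (?z * (?z - 2 * of_real lam) * W ^ 4)
        - (((\<theta> ?z)\<^sup>2 - W\<^sup>2 - 2 * F 1 ?z) + (R ?z + 2 * F 1 ?z - 2 * of_real u * \<sigma> ?z - (\<sigma> ?z)\<^sup>2)) * Y (w ?z)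
        - (\<theta> ?z + of_real u + \<sigma> ?z) * (2 * W * deriv Y (w ?z))))"
    proof -
      have W: "1 / (Z ?z)\<^sup>2 = W\<^sup>2" "\<And>x. x / Z ?z = x * W" "inverse (Z ?z) = W"
        by (simp_all add: W_def divide_inverse power_inverse)
      have alg: "B * (2 * (d1 * (x * (- 2 * (n * W ^ 4))) + x * (2 * W * d2) * W) - (T * (x * (2 * W * d1)) + (x * t1 + 0 + x * t2) * y))
          + x * (- T * B) * (2 * (d1 * W) - T * y) =
          x * (- T * (B * (2 * d1 * W - T * y)) + B * (4 * W\<^sup>2 * d2 - 4 * d1 * (n * W ^ 4) - (t1 + t2) * y - T * (2 * W * d1)))"
        for B d1 x n d2 T t1 t2 y :: complex
        by (simp add: algebra_simps power2_eq_square)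
      show ?thesis unfolding Y2[symmetric] W by (rule alg)
    qed
    also have "\<dots> = x' v * (- 2 * (of_real u + \<sigma> ?z) * k ?z - R ?z * h ?z)"
      unfolding logarithmic_factor_identity[OF QW th] by (simp add: k_def h_def W_def divide_inverse)
    finally show ?thesis unfolding kfun .
  qed
  define y1 where "y1 v = h (p v) + k (p v) / (2 * of_real u)" for v
  define y2 where "y2 v = - (k (p v) / (2 * of_real u))" for v
  define \<rho> where "\<rho> v = R (p v) / (2 * of_real u)" for v
  have sum: "y1 v + y2 v = h (p v)" for v by (simp add: y1_def y2_def)
  have "max (norm (y1 b - 1)) (norm (y2 b)) \<le>
      (max (norm (y1 a - 1)) (norm (y2 a)) + integral {a..b} (\<lambda>v. norm (x' v * \<rho> v))) *
      exp (integral {a..b} (\<lambda>v. 2 * norm (x' v * \<sigma> (p v)) + 2 * norm (x' v * \<rho> v)))"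
  proof (rule two_component_Gronwall[OF \<open>a \<le> b\<close> dxi _ _ _ _ _ mono])
    fix v assume v: "v \<in> {a..b}"
    have dk2: "((\<lambda>v. k (p v) / (2 * of_real u)) has_vector_derivative
        x' v * (- 2 * (of_real u + \<sigma> (p v)) * k (p v) - R (p v) * h (p v)) / (2 * of_real u)) (at v within {a..b})"
      by (intro has_vector_derivative_divide dk v)
    have "(y1 has_vector_derivative x' v * k (p v) +
        x' v * (- 2 * (of_real u + \<sigma> (p v)) * k (p v) - R (p v) * h (p v)) / (2 * of_real u)) (at v within {a..b})"
      unfolding y1_def[abs_def] by (intro has_vector_derivative_add dh v dk2)
    \<comment> \<open>The term \<open>k\<close> of \<open>dh\<close> cancels against
      \<open>- 2 u k / 2u\<close>, so no large coefficient is left in the first component.\<close>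
    then show "(y1 has_vector_derivative x' v * (2 * \<sigma> (p v) * y2 v - \<rho> v * (y1 v + y2 v))) (at v within {a..b})"
      unfolding sum by (rule has_vector_derivative_eq_rhs) (use u_nonzero in \<open>simp add: y2_def \<rho>_def field_simps\<close>)
    have "(y2 has_vector_derivative
        - (x' v * (- 2 * (of_real u + \<sigma> (p v)) * k (p v) - R (p v) * h (p v)) / (2 * of_real u))) (at v within {a..b})"
      unfolding y2_def[abs_def] by (intro has_vector_derivative_minus dk2)
    then show "(y2 has_vector_derivative x' v *
        (- 2 * of_real u * y2 v - 2 * \<sigma> (p v) * y2 v + \<rho> v * (y1 v + y2 v))) (at v within {a..b})"
      unfolding sum by (rule has_vector_derivative_eq_rhs) (use u_nonzero in \<open>simp add: y2_def \<rho>_def field_simps\<close>)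
  next
    show "continuous_on {a..b} x'" unfolding x'_def
      using nz by (intro continuous_intros contD cont_Z cont_p p') auto
    show "continuous_on {a..b} (\<lambda>v. \<sigma> (p v))" by (rule contD[OF continuous_on_sigma])
    show "continuous_on {a..b} \<rho>" unfolding \<rho>_def
      using u_nonzero by (intro continuous_intros contD[OF continuous_on_R]) auto
  qed
  then show ?thesis unfolding m_def y1_def y2_def \<rho>_def norm_minus_cancel .
qed

end

section \<open>The error bound on progressive paths\<close>

text \<open>Needed because \<open>speed_weighted\<close> involves \<open>vector_derivative\<close>,
  which is unspecified at the corners; pointwise comparisons are available only in the interior of
  an arc.\<close>

lemma integral_le_open:
  fixes f g :: "real \<Rightarrow> real"
  assumes "f integrable_on {c..d}" "g integrable_on {c..d}" "\<And>x. c < x \<Longrightarrow> x < d \<Longrightarrow> f x \<le> g x"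
  shows "integral {c..d} f \<le> integral {c..d} g"
  unfolding integral_open_interval_real
  by (rule integral_le) (use assms in \<open>auto simp: integrable_on_open_interval_real\<close>)

text \<open>A principle for properties of parameter intervals that hold on each smooth piece and
  compose. The intervals stay away from 0, because the first arc is half-open and its derivative
  need not be controlled at the singularity.\<close>

lemma R2_chain_induct:
  assumes chain: "R2_chain p"
    and arc: "\<And>c d p'. \<lbrakk>0 < c; c \<le> d; d \<le> 1; continuous_on {c..d} p';
        \<And>v. v \<in> {c..d} \<Longrightarrow> (p has_vector_derivative p' v) (at v within {c..d})\<rbrakk> \<Longrightarrow> Q c d"
    and trans: "\<And>c d e. \<lbrakk>0 < c; c \<le> d; d \<le> e; e \<le> 1; Q c d; Q d e\<rbrakk> \<Longrightarrow> Q c e"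
    and \<epsilon>: "0 < \<epsilon>" "\<epsilon> \<le> 1"
  shows "Q \<epsilon> 1"
proof -
  obtain M a where a: "a 0 = (0::real)" "a M = 1"
    and step: "\<And>i. i < M \<Longrightarrow> a i < a (Suc i)" "\<And>i. i < M \<Longrightarrow> R2_arc_on p ({a i..a (Suc i)} \<inter> {0<..1})"
    using chain unfolding R2_chain_def by blast
  have le1: "a i \<le> 1" if "i \<le> M" for i
    using that
  proof (induction i rule: inc_induct)
    case (step n)
    then show ?case using \<open>\<And>i. i < M \<Longrightarrow> a i < a (Suc i)\<close>[of n] by linarith
  qed (simp add: a)
  have single: "Q c d" if "i < M" "0 < c" "a i \<le> c" "c \<le> d" "d \<le> a (Suc i)" for i c d
  proof -
    have d: "d \<le> 1" using le1[of "Suc i"] that by simp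
    let ?I = "{a i..a (Suc i)} \<inter> {0<..1}"
    have sub: "{c..d} \<subseteq> ?I" using that d by auto
    obtain p' p'' where p: "\<And>v. v \<in> ?I \<Longrightarrow> (p has_vector_derivative p' v) (at v within ?I)"
      "\<And>v. v \<in> ?I \<Longrightarrow> (p' has_vector_derivative p'' v) (at v within ?I)"
      using step(2)[OF \<open>i < M\<close>] unfolding R2_arc_on_def by blast
    have "continuous_on ?I p'"
      using p(2) has_vector_derivative_continuous continuous_on_eq_continuous_within by blast
    then have "continuous_on {c..d} p'" using sub by (rule continuous_on_subset)
    moreover have "(p has_vector_derivative p' v) (at v within {c..d})" if "v \<in> {c..d}" for v
      by (rule has_vector_derivative_within_subset[OF p(1) sub]) (use that sub in blast)
    ultimately show "Q c d" using that d by (intro arc[of c d p'])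
  qed
  \<comment> \<open>Induction over the corners; the case \<open>i = 0\<close> is vacuous as
    \<open>a 0 = 0\<close>.\<close>
  have "\<forall>\<epsilon>. 0 < \<epsilon> \<and> \<epsilon> \<le> a i \<longrightarrow> Q \<epsilon> (a i)" if "i \<le> M" for i
    using that
  proof (induction i)
    case (Suc i)
    show ?case
    proof (intro allI impI)
      fix \<epsilon> assume \<epsilon>: "0 < \<epsilon> \<and> \<epsilon> \<le> a (Suc i)"
      have i: "i < M" using Suc.prems by simp
      show "Q \<epsilon> (a (Suc i))"
      proof (cases "\<epsilon> \<le> a i")
        case True
        then have "Q \<epsilon> (a i)" using Suc \<epsilon> by simp
        moreover have "Q (a i) (a (Suc i))"
          using \<epsilon> True step(1)[OF i] by (intro single[OF i]) auto
        ultimately show ?thesis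
          using \<epsilon> True step(1)[OF i] le1[OF Suc.prems] by (intro trans[of \<epsilon> "a i" "a (Suc i)"]) auto
      next
        case False
        then show ?thesis using \<epsilon> by (intro single[OF i]) auto
      qed
    qed
  qed (use a in force)
  from this[of M] \<epsilon> show ?thesis by (simp add: a)
qed

context liouville_solution
begin

text \<open>The bounds on single arcs are composed over \<open>[\<epsilon>, 1]\<close>, the
  integrals are enlarged to the whole path, and \<open>\<epsilon>\<close> tends to 0. The start
  value of the majorant vanishes in the limit, so that only the source integral remains in front of
  the exponential.\<close>

lemma path_bound:
  assumes chain: "R2_chain p" and pD: "p ` {0<..1} \<subseteq> D"
    and mono: "mono_on {0<..1} (\<lambda>\<tau>. u * Re (\<xi> (p \<tau>)))"
    and fin: "finite_integrals lam D Z N p"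
    and reach: "\<forall>\<^sub>F \<tau> in at_right 0. reachable D (p \<tau>)"
    and h0: "((\<lambda>\<tau>. h (p \<tau>)) \<longlongrightarrow> 1) (at_right 0)"
    and k0: "((\<lambda>\<tau>. k (p \<tau>)) \<longlongrightarrow> 0) (at_right 0)"
  shows "norm (h (p 1) - 1) \<le> omega lam D Z N \<mu> p / \<mu> ^ N *
     exp (varpi lam D Z N \<mu> p / \<mu> + omega lam D Z N \<mu> p / \<mu> ^ N)"
proof -
  define fF where "fF s = speed_weighted p (\<lambda>t. Z t * F s t / t)" for s
  define fG where "fG s = speed_weighted p (\<lambda>t. Z t * G N s t / t)" for s
  \<comment> \<open>In terms of the speed of \<open>\<xi>\<close> along the path, \<open>a\<close>
    dominates twice the norm of \<open>\<sigma>\<close> and \<open>b\<close> dominates twice the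
    norm of \<open>R / 2u\<close>. The 2 makes up for the factor 1/2 in
    \<open>d\<xi>/dz = Z / (2 z)\<close>, and the integral of \<open>b\<close> is exactly
    \<open>omega / \<mu>^N\<close>.\<close>
  define a where "a \<tau> = (\<Sum>s=1..N-1. fF s \<tau> / \<mu> ^ s)" for \<tau>
  define b where "b \<tau> = (fF N \<tau> + (\<Sum>s=1..N-1. 1 / (2 * \<mu> ^ s) * fG s \<tau>)) / \<mu> ^ N" for \<tau>
  have nonneg: "0 \<le> fF s \<tau>" "0 \<le> fG s \<tau>" for s \<tau> by (simp_all add: fF_def fG_def speed_weighted_def)
  have ab_nonneg: "0 \<le> a \<tau>" "0 \<le> b \<tau>" for \<tau>
    unfolding a_def b_def using \<mu> nonneg by (auto intro!: sum_nonneg divide_nonneg_pos add_nonneg_nonneg mult_nonneg_nonneg)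
  have intF: "(fF s has_integral abs_integral p (\<lambda>t. Z t * F s t / t)) {0<..1}" if "s \<in> {1..N}" for s
    using fin that unfolding finite_integrals_def abs_integrable_def abs_integral_def fF_def
    by (intro integrable_integral) blast
  have intG: "(fG s has_integral abs_integral p (\<lambda>t. Z t * G N s t / t)) {0<..1}" if "s \<in> {1..N-1}" for s
    using fin that unfolding finite_integrals_def abs_integrable_def abs_integral_def fG_def
    by (intro integrable_integral) blast
  define S where "S = (\<Sum>s=1..N-1. abs_integral p (\<lambda>t. Z t * F s t / t) / \<mu> ^ s)"
  define T where "T = omega lam D Z N \<mu> p / \<mu> ^ N"
  have int_a: "(a has_integral S) {0<..1}"
    unfolding a_def[abs_def] S_def by (intro has_integral_sum has_integral_divide intF) auto
  have int_b: "(b has_integral T) {0<..1}"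
    unfolding b_def[abs_def] T_def omega_def using N
    by (intro has_integral_divide has_integral_add has_integral_sum has_integral_mult_right intF intG) auto
  have sub01: "{c..d} \<subseteq> {0<..1}" if "0 < c" "d \<le> 1" for c d :: real using that by auto
  have int_on: "a integrable_on {c..d}" "b integrable_on {c..d}" if "0 < c" "d \<le> 1" for c d
    using integrable_on_subinterval[OF has_integral_integrable[OF int_a] sub01[OF that]]
      integrable_on_subinterval[OF has_integral_integrable[OF int_b] sub01[OF that]] by auto
  have int_nonneg: "0 \<le> integral {c..d} a" "0 \<le> integral {c..d} b" if "0 < c" "d \<le> 1" for c d
    using int_on[OF that] ab_nonneg by (auto intro!: integral_nonneg)
  define m where "m v = max (norm (h (p v) + k (p v) / (2 * of_real u) - 1)) (norm (k (p v) / (2 * of_real u)))" for v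
  \<comment> \<open>Reachability is carried along with the estimate, since the arc bound presupposes
    it at the start of every arc.\<close>
  define Q where "Q c d \<longleftrightarrow> (reachable D (p c) \<longrightarrow> reachable D (p d) \<and>
     m d \<le> (m c + integral {c..d} b / 2) * exp (integral {c..d} a + integral {c..d} b))" for c d
  have Q: "Q \<epsilon> 1" if "0 < \<epsilon>" "\<epsilon> \<le> 1" for \<epsilon>
  proof (rule R2_chain_induct[OF chain _ _ that])
    fix c d p'
    assume cd: "0 < c" "c \<le> d" "d \<le> 1" and p': "continuous_on {c..d} p'"
      and p: "\<And>v. v \<in> {c..d} \<Longrightarrow> (p has_vector_derivative p' v) (at v within {c..d})"
    have imD: "p ` {c..d} \<subseteq> D" using pD sub01[OF cd(1,3)] by blast
    show "Q c d" unfolding Q_def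
    proof (intro impI conjI)
      assume reach_c: "reachable D (p c)"
      show "reachable D (p d)" by (rule reachable_arc(1)[OF cd(2) p p' imD reach_c])
      define x' where "x' v = Z (p v) / (2 * p v) * p' v" for v
      define r where "r v = norm (x' v * (R (p v) / (2 * of_real u)))" for v
      define s where "s v = 2 * norm (x' v * \<sigma> (p v))" for v
      have cont_p: "continuous_on {c..d} p"
        using p has_vector_derivative_continuous continuous_on_eq_continuous_within by blast
      have contD: "continuous_on {c..d} (\<lambda>v. f (p v))" if "continuous_on D f" for f :: "complex \<Rightarrow> complex"
        by (rule continuous_on_compose2[OF that cont_p imD])
      have cont_x': "continuous_on {c..d} x'"
        unfolding x'_def[abs_def] using nonzero imD
        by (intro continuous_intros contD cont_Z cont_p p') auto
      have cont_r: "continuous_on {c..d} r" unfolding r_def[abs_def] using u_nonzero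
        by (intro continuous_intros contD[OF continuous_on_R] cont_x') auto
      have cont_s: "continuous_on {c..d} s" unfolding s_def[abs_def]
        by (intro continuous_intros contD[OF continuous_on_sigma] cont_x')
      have int_rs: "r integrable_on {c..d}" "s integrable_on {c..d}"
        using cont_r cont_s by (auto intro: integrable_continuous_interval)
      have deriv: "vector_derivative p (at v) = p' v" if "c < v" "v < d" for v
        using p[of v] that by (intro vector_derivative_at) (auto simp: at_within_Icc_at)
      define W where "W v = norm (Z (p v)) * norm (p' v) / norm (p v)" for v
      have W_nonneg: "0 \<le> W v" for v by (simp add: W_def)
      have fFG: "fF j v = W v * norm (F j (p v))" "fG j v = W v * norm (G N j (p v))" if "c < v" "v < d" for j v
        using deriv[OF that] by (simp_all add: fF_def fG_def speed_weighted_def W_def norm_mult norm_divide)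
      have s_le: "s v \<le> a v" if v: "c < v" "v < d" for v
      proof -
        have "s v = W v * norm (\<sigma> (p v))"
          by (simp add: s_def x'_def W_def norm_mult norm_divide)
        also have "norm (\<sigma> (p v)) \<le> (\<Sum>j=1..N-1. norm (F j (p v)) / \<mu> ^ j)"
          unfolding \<sigma>_def by (rule sum_norm_le) (simp add: norm_divide norm_power u)
        also have "W v * \<dots> = a v"
          unfolding a_def sum_distrib_left by (intro sum.cong refl) (simp add: fFG[OF v])
        finally show ?thesis using W_nonneg by (simp add: mult_left_mono)
      qed
      have r_le: "r v \<le> b v / 2" if v: "c < v" "v < d" for v
      proof -
        have "r v = W v * norm (R (p v)) / (4 * \<mu>)"
          by (simp add: r_def x'_def W_def norm_mult norm_divide u)
        also have "\<dots> \<le> W v * ((2 * norm (F N (p v)) + (\<Sum>j=1..N-1. norm (G N j (p v)) / \<mu> ^ j)) / \<mu> ^ (N - 1)) / (4 * \<mu>)"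
        proof (intro divide_right_mono mult_left_mono W_nonneg)
          have "norm (\<Sum>j=1..N-1. G N j (p v) / of_real u ^ j) \<le> (\<Sum>j=1..N-1. norm (G N j (p v)) / \<mu> ^ j)"
            by (rule sum_norm_le) (simp add: norm_divide norm_power u)
          then have "norm (- 2 * F N (p v) + (\<Sum>j=1..N-1. G N j (p v) / of_real u ^ j)) \<le>
             2 * norm (F N (p v)) + (\<Sum>j=1..N-1. norm (G N j (p v)) / \<mu> ^ j)"
            by (intro order.trans[OF norm_triangle_ineq]) (simp add: norm_mult)
          then show "norm (R (p v)) \<le> (2 * norm (F N (p v)) + (\<Sum>j=1..N-1. norm (G N j (p v)) / \<mu> ^ j)) / \<mu> ^ (N - 1)"
            unfolding R_def norm_divide norm_power using \<mu> u by (simp add: divide_right_mono)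
        qed (use \<mu> in auto)
        also have "\<dots> = b v / 2"
        proof -
          have "\<mu> ^ N = \<mu> * \<mu> ^ (N - 1)" using N by (simp add: power_eq_if)
          moreover have "(\<Sum>j=1..N-1. 1 / (2 * \<mu> ^ j) * fG j v) = W v * (\<Sum>j=1..N-1. norm (G N j (p v)) / \<mu> ^ j) / 2"
            unfolding sum_distrib_left sum_divide_distrib by (intro sum.cong refl) (simp add: fFG[OF v])
          ultimately show ?thesis
            unfolding b_def using \<mu> by (simp add: fFG[OF v] divide_simps) (simp add: algebra_simps)
        qed
        finally show ?thesis .
      qed
      have "m d \<le> (m c + integral {c..d} r) * exp (integral {c..d} (\<lambda>v. s v + 2 * r v))"
        using arc_bound[OF cd(2) p p' imD reach_c] mono_on_subset[OF mono sub01[OF cd(1,3)]]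
        unfolding m_def r_def[abs_def] s_def[abs_def] x'_def[abs_def] by simp
      also have "\<dots> \<le> (m c + integral {c..d} b / 2) * exp (integral {c..d} a + integral {c..d} b)"
      proof (intro mult_mono add_mono order_refl)
        have "integral {c..d} r \<le> integral {c..d} (\<lambda>v. b v / 2)"
          by (rule integral_le_open) (use int_rs int_on[OF cd(1,3)] r_le in \<open>auto intro: integrable_on_divide\<close>)
        then show "integral {c..d} r \<le> integral {c..d} b / 2" by simp
        have "integral {c..d} (\<lambda>v. s v + 2 * r v) \<le> integral {c..d} (\<lambda>v. a v + b v)"
        proof (rule integral_le_open)
          show "(\<lambda>v. s v + 2 * r v) integrable_on {c..d}" "(\<lambda>v. a v + b v) integrable_on {c..d}"
            using int_rs int_on[OF cd(1,3)] by (auto intro!: integrable_add integrable_on_mult_right)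
          show "s v + 2 * r v \<le> a v + b v" if "c < v" "v < d" for v
            using s_le[OF that] r_le[OF that] by simp
        qed
        also have "integral {c..d} (\<lambda>v. a v + b v) = integral {c..d} a + integral {c..d} b"
          by (intro integral_add int_on cd)
        finally show "exp (integral {c..d} (\<lambda>v. s v + 2 * r v)) \<le> exp (integral {c..d} a + integral {c..d} b)"
          by simp
        show "0 \<le> m c + integral {c..d} b / 2"
          using int_nonneg(2)[OF cd(1,3)] by (auto simp: m_def le_max_iff_disj intro!: add_nonneg_nonneg)
      qed auto
      finally show "m d \<le> (m c + integral {c..d} b / 2) * exp (integral {c..d} a + integral {c..d} b)" .
    qed
  next
    fix c d e assume cde: "0 < c" "c \<le> d" "d \<le> e" "e \<le> 1" and Q: "Q c d" "Q d e"
    have comb: "integral {c..e} f = integral {c..d} f + integral {d..e} f" if "f integrable_on {c..e}" for f :: "real \<Rightarrow> real"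
      using Henstock_Kurzweil_Integration.integral_combine[OF cde(2,3) that] by simp
    show "Q c e" unfolding Q_def
    proof (intro impI conjI)
      assume c: "reachable D (p c)"
      then have d: "reachable D (p d)" and 1: "m d \<le> (m c + integral {c..d} b / 2) * exp (integral {c..d} a + integral {c..d} b)"
        using Q(1) by (auto simp: Q_def)
      from d Q(2) show "reachable D (p e)" by (simp add: Q_def)
      let ?X = "integral {c..d} a + integral {c..d} b" and ?Y = "integral {d..e} a + integral {d..e} b"
      have "m e \<le> (m d + integral {d..e} b / 2) * exp ?Y" using d Q(2) by (simp add: Q_def)
      \<comment> \<open>As \<open>exp ?X \<ge> 1\<close>, the second source may be put under the
        first exponential; the estimate then keeps its form under composition.\<close>
      also have "\<dots> \<le> ((m c + integral {c..d} b / 2) * exp ?X + integral {d..e} b / 2 * exp ?X) * exp ?Y"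
      proof (intro mult_right_mono add_mono 1)
        have "0 \<le> ?X" "0 \<le> integral {d..e} b" using int_nonneg cde by auto
        then show "integral {d..e} b / 2 \<le> integral {d..e} b / 2 * exp ?X"
          by (simp add: mult_le_cancel_left1)
      qed auto
      also have "\<dots> = (m c + (integral {c..d} b + integral {d..e} b) / 2) * exp (?X + ?Y)"
        by (simp add: exp_add algebra_simps add_divide_distrib)
      finally show "m e \<le> (m c + integral {c..e} b / 2) * exp (integral {c..e} a + integral {c..e} b)"
        using int_on[OF cde(1,4)] by (simp add: comb algebra_simps)
    qed
  qed
  have "\<forall>\<^sub>F \<epsilon> in at_right 0. \<epsilon> \<in> {0<..<1::real}" by (rule eventually_at_right_real) simp
  with reach have "\<forall>\<^sub>F \<epsilon> in at_right 0. m 1 \<le> (m \<epsilon> + T / 2) * exp (S + T)"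
  proof eventually_elim
    case (elim \<epsilon>)
    then have "m 1 \<le> (m \<epsilon> + integral {\<epsilon>..1} b / 2) * exp (integral {\<epsilon>..1} a + integral {\<epsilon>..1} b)"
      using Q[of \<epsilon>] by (simp add: Q_def)
    also have "\<dots> \<le> (m \<epsilon> + T / 2) * exp (S + T)"
    proof -
      have "integral {\<epsilon>..1} f \<le> I" if "(f has_integral I) {0<..1}" "f integrable_on {\<epsilon>..1}" "\<And>x. 0 \<le> f x" for f :: "real \<Rightarrow> real" and I
        using integral_subset_le[OF sub01[of \<epsilon> 1] that(2) has_integral_integrable[OF that(1)]] that(3) elim
        by (simp add: integral_unique[OF that(1)])
      from this[OF int_a] this[OF int_b] have "integral {\<epsilon>..1} a \<le> S" "integral {\<epsilon>..1} b \<le> T"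
        using int_on ab_nonneg elim by auto
      then show ?thesis using int_nonneg[of \<epsilon> 1] elim
        by (intro mult_mono) (auto simp: m_def intro!: add_nonneg_nonneg simp: le_max_iff_disj)
    qed
    finally show ?case .
  qed
  moreover have "((\<lambda>\<epsilon>. (m \<epsilon> + T / 2) * exp (S + T)) \<longlongrightarrow> (0 + T / 2) * exp (S + T)) (at_right 0)"
  proof (intro tendsto_intros)
    have "((\<lambda>\<epsilon>. max (norm (h (p \<epsilon>) + k (p \<epsilon>) / (2 * of_real u) - 1)) (norm (k (p \<epsilon>) / (2 * of_real u)))) \<longlongrightarrow>
        max (norm (1 + 0 / (2 * of_real u) - 1 :: complex)) (norm (0 / (2 * of_real u) :: complex))) (at_right 0)"
      using u_nonzero by (intro tendsto_intros h0 k0) auto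
    then show "(m \<longlongrightarrow> 0) (at_right 0)" by (simp add: m_def[abs_def])
  qed
  ultimately have "m 1 \<le> (0 + T / 2) * exp (S + T)"
    by (intro tendsto_lowerbound[OF _ _ trivial_limit_at_right_real])
  \<comment> \<open>\<open>h\<close> is the sum of the two components. The factor 2 cancels the 1/2
    in \<open>T / 2\<close>.\<close>
  moreover have "norm (h (p 1) - 1) \<le> m 1 + m 1"
  proof -
    have "h (p 1) - 1 = (h (p 1) + k (p 1) / (2 * of_real u) - 1) - k (p 1) / (2 * of_real u)" by simp
    also have "norm \<dots> \<le> m 1 + m 1"
      by (rule order.trans[OF norm_triangle_ineq4]) (intro add_mono, auto simp: m_def)
    finally show ?thesis .
  qed
  ultimately have "norm (h (p 1) - 1) \<le> T * exp (S + T)" by simp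
  also have "\<dots> \<le> T * exp (varpi lam D Z N \<mu> p / \<mu> + T)"
  proof -
    have T: "0 \<le> T" using has_integral_nonneg[OF int_b] ab_nonneg by blast
    have S: "0 \<le> S" using has_integral_nonneg[OF int_a] ab_nonneg by blast
    \<comment> \<open>The index of \<open>varpi\<close> starts at 0, which the division by
      \<open>\<mu>\<close> compensates. Only half of \<open>varpi / \<mu>\<close> has been used in
      the exponent.\<close>
    have "varpi lam D Z N \<mu> p / \<mu> = 2 * S"
    proof -
      have "(\<Sum>s=1..N-1. abs_integral p (\<lambda>t. Z t * F s t / t) / \<mu> ^ s) =
          (\<Sum>s<N-1. abs_integral p (\<lambda>t. Z t * F (Suc s) t / t) / \<mu> ^ Suc s)"
        by (rule sum.reindex_bij_witness[of _ Suc "\<lambda>s. s - 1"]) auto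
      then show ?thesis
        unfolding varpi_def S_def sum_divide_distrib
        by (simp add: sum_distrib_left sum_divide_distrib mult_ac)
    qed
    then show ?thesis using S T by (intro mult_left_mono) auto
  qed
  finally show ?thesis by (simp add: T_def)
qed

end

section \<open>The branches near the singularities\<close>

lemma connected_sqrt_unique:
  fixes f g :: "complex \<Rightarrow> complex"
  assumes S: "connected S" "continuous_on S f" "continuous_on S g"
    and sq: "\<And>z. z \<in> S \<Longrightarrow> (f z)\<^sup>2 = (g z)\<^sup>2" "\<And>z. z \<in> S \<Longrightarrow> g z \<noteq> 0"
    and z0: "z0 \<in> S" "f z0 \<in> \<real>" "Re (f z0) > 0" "g z0 \<in> \<real>" "Re (g z0) > 0" and z: "z \<in> S"
  shows "f z = g z"
proof -
  have "f z0 = g z0 \<or> f z0 = - g z0" using sq(1)[OF z0(1)] by (simp add: power2_eq_iff)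
  then have eq: "f z0 = g z0" using z0 by auto
  have "f z / g z = 1"
  proof (rule connected_power2_eq_1[OF S(1) _ _ z0(1) _ z])
    show "continuous_on S (\<lambda>z. f z / g z)" using S sq by (intro continuous_intros) auto
    show "(f z / g z)\<^sup>2 = 1" if "z \<in> S" for z using sq that by (simp add: power_divide)
    show "f z0 / g z0 = 1" using eq sq(2) z0(1) by simp
  qed
  then show ?thesis using sq(2)[OF z] by (simp add: divide_eq_1_iff)
qed

lemma pos_real_if_near:
  assumes "(f \<longlongrightarrow> of_real a) F" "0 < (a::real)"
  shows "\<forall>\<^sub>F z in F. 0 < Re (f z)"
proof -
  have "((\<lambda>z. Re (f z)) \<longlongrightarrow> a) F" using tendsto_Re[OF assms(1)] by simp
  then show ?thesis using assms(2) by (rule order_tendstoD)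
qed

lemma not_nonpos_Reals_if_Re_pos: "0 < Re z \<Longrightarrow> z \<notin> \<real>\<^sub>\<le>\<^sub>0"
  by (auto simp: complex_nonpos_Reals_iff)

lemma nonzero_if_Re_pos: "0 < Re z \<Longrightarrow> z \<noteq> 0"
  by auto

text \<open>Cauchy's estimate for \<open>f - l\<close> on unit discs. The filter \<open>F'\<close>
  may be finer than \<open>F\<close>: in a strip, the limit must be known on a strip that is wider
  by 1.\<close>

lemma deriv_tendsto_0:
  fixes f :: "complex \<Rightarrow> complex"
  assumes hol: "f holomorphic_on UNIV" and lim: "(f \<longlongrightarrow> l) F"
    and enlarge: "\<And>P. eventually P F \<Longrightarrow> \<forall>\<^sub>F w in F'. \<forall>v\<in>cball w 1. P v"
  shows "(deriv f \<longlongrightarrow> 0) F'"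
proof (rule tendstoI)
  fix e :: real assume "e > 0"
  then have "\<forall>\<^sub>F w in F. dist (f w) l < e / 2" using lim by (intro tendstoD) auto
  then have "\<forall>\<^sub>F w in F'. \<forall>v\<in>cball w 1. dist (f v) l < e / 2" by (rule enlarge)
  then show "\<forall>\<^sub>F w in F'. dist (deriv f w) 0 < e"
  proof eventually_elim
    case (elim w)
    have d: "((\<lambda>v. f v - l) has_field_derivative deriv f w) (at w)"
      using holomorphic_derivI[OF hol] by (auto intro!: derivative_eq_intros)
    have "norm ((deriv ^^ 1) (\<lambda>v. f v - l) w) \<le> fact 1 * (e / 2) / 1 ^ 1"
    proof (rule Cauchy_inequality)
      show "(\<lambda>v. f v - l) holomorphic_on ball w 1"
        by (intro holomorphic_intros holomorphic_on_subset[OF hol]) auto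
      show "continuous_on (cball w 1) (\<lambda>v. f v - l)"
        by (intro continuous_intros holomorphic_on_imp_continuous_on holomorphic_on_subset[OF hol]) auto
      show "norm (f v - l) \<le> e / 2" if "norm (w - v) = 1" for v
      proof -
        have "v \<in> cball w 1" using that by (simp add: dist_norm)
        then show ?thesis using elim by (auto simp: dist_norm dest!: bspec)
      qed
    qed simp
    then show ?case using DERIV_imp_deriv[OF d] \<open>e > 0\<close> by simp
  qed
qed

text \<open>Limits are taken in all of \<open>Cplus\<close> rather than in a cut domain. That a cut
  stays away from the singularity appears as the separate hypothesis that \<open>z \<in> D\<close>
  eventually.\<close>

definition near_0 :: "complex filter" where "near_0 = at 0 within Cplus"

definition near_infinity :: "complex filter" where "near_infinity = inf at_infinity (principal Cplus)"

lemma eventually_near_0: "eventually P near_0 \<longleftrightarrow> (\<exists>r>0. \<forall>z\<in>Cplus \<inter> ball 0 r. P z)"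
  unfolding near_0_def eventually_at by (force simp: Cplus_eq)

lemma eventually_near_infinity: "eventually P near_infinity \<longleftrightarrow> (\<exists>r>0. \<forall>z\<in>{z \<in> Cplus. r < norm z}. P z)"
proof -
  have "eventually P near_infinity \<longleftrightarrow> (\<exists>b. \<forall>z\<in>Cplus. b \<le> norm z \<longrightarrow> P z)"
    unfolding near_infinity_def eventually_inf_principal eventually_at_infinity by auto
  also have "\<dots> \<longleftrightarrow> (\<exists>r>0. \<forall>z\<in>{z \<in> Cplus. r < norm z}. P z)"
  proof safe
    fix b assume "\<forall>z\<in>Cplus. b \<le> norm z \<longrightarrow> P z"
    then show "\<exists>r>0. \<forall>z\<in>{z \<in> Cplus. r < norm z}. P z"
      by (intro exI[of _ "max b 1"]) auto
  next
    fix r :: real assume "0 < r" "\<forall>z\<in>{z \<in> Cplus. r < norm z}. P z"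
    then show "\<exists>b. \<forall>z\<in>Cplus. b \<le> norm z \<longrightarrow> P z"
      by (intro exI[of _ "r + 1"]) auto
  qed
  finally show ?thesis .
qed

lemma tendsto_near_0: "((\<lambda>z. z) \<longlongrightarrow> 0) near_0"
  unfolding near_0_def by (rule tendsto_ident_at)

lemma tendsto_near_infinity: "((\<lambda>z. inverse z) \<longlongrightarrow> 0) near_infinity"
  unfolding near_infinity_def
  by (rule tendsto_mono[OF inf_le1]) (rule tendsto_inverse_0)

section \<open>Explicit formulas for the branches near the singularities\<close>

context liouville_branches
begin

text \<open>The logarithms that define \<open>\<xi>\<close> may differ from the given ones by
  imaginary constants. As \<open>\<xi>\<close> is real on the positive axis, the combination of
  these constants that enters \<open>\<xi>\<close> is 0, although each of them may be
  nonzero.\<close>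

lemma xi_eq_on_connected:
  assumes S: "connected S" "S \<subseteq> D" and x: "x > 0" "of_real x \<in> S"
    and l: "continuous_on S l1" "continuous_on S l2"
      "\<And>z. z \<in> S \<Longrightarrow> exp (l1 z) = Z z + z - 2 * of_real lam"
      "\<And>z. z \<in> S \<Longrightarrow> exp (l2 z) = (Z z - of_real lam * z + 2) / z"
    and real: "l1 (of_real x) \<in> \<real>" "l2 (of_real x) \<in> \<real>" and z: "z \<in> S"
  shows "\<xi> z = Z z / 2 - of_real lam * l1 z - l2 z"
proof -
  obtain L1 L2 where L: "continuous_on D L1" "continuous_on D L2"
    "\<And>z. z \<in> D \<Longrightarrow> exp (L1 z) = Z z + z - 2 * of_real lam"
    "\<And>z. z \<in> D \<Longrightarrow> exp (L2 z) = (Z z - of_real lam * z + 2) / z"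
    "\<And>z. z \<in> D \<Longrightarrow> \<xi> z = Z z / 2 - of_real lam * L1 z - L2 z" using xi_logs by blast
  have SD: "z \<in> D" if "z \<in> S" for z using S(2) that by blast
  have exp1: "exp (L1 z - l1 z) = 1" "exp (L2 z - l2 z) = 1" if "z \<in> S" for z
    using L(3,4)[OF SD[OF that]] l(3,4)[OF that] exp_not_eq_zero[of "l1 z"] exp_not_eq_zero[of "l2 z"]
    by (simp_all add: exp_diff)
  have cont: "continuous_on S (\<lambda>z. L1 z - l1 z)" "continuous_on S (\<lambda>z. L2 z - l2 z)"
    using S(2) L(1,2) l(1,2) by (auto intro!: continuous_intros intro: continuous_on_subset)
  obtain c1 where c1: "\<And>z. z \<in> S \<Longrightarrow> L1 z - l1 z = \<i> * of_real c1"
    using connected_exp_eq_1[OF S(1) cont(1) exp1(1)] by blast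
  obtain c2 where c2: "\<And>z. z \<in> S \<Longrightarrow> L2 z - l2 z = \<i> * of_real c2"
    using connected_exp_eq_1[OF S(1) cont(2) exp1(2)] by blast
  have xi: "\<xi> z = Z z / 2 - of_real lam * l1 z - l2 z - \<i> * of_real (lam * c1 + c2)" if "z \<in> S" for z
  proof -
    have "L1 z = l1 z + \<i> * of_real c1" "L2 z = l2 z + \<i> * of_real c2"
      using c1[OF that] c2[OF that] by (simp_all add: diff_eq_eq add.commute)
    then show ?thesis unfolding L(5)[OF SD[OF that]] by (simp add: algebra_simps)
  qed
  have "Im (\<xi> (of_real x)) = 0" "Im (Z (of_real x)) = 0" "Im (l1 (of_real x)) = 0" "Im (l2 (of_real x)) = 0"
    using branches_real[OF x(1)] real by (simp_all add: complex_is_Real_iff)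
  with arg_cong[OF xi[OF x(2)], of Im] have "lam * c1 + c2 = 0" by simp
  then show ?thesis using xi[OF z] by simp
qed

lemma Z_real_eq: "x > 0 \<Longrightarrow> Z (of_real x) = of_real (Re (Z (of_real x)))"
  using branches_real by (simp add: complex_is_Real_iff complex_eq_iff)

text \<open>\<open>Zsq\<close> is near 4, so \<open>csqrt\<close> provides a continuous root on a
  half disc. Both roots are positive at a real point, and connectedness excludes a change of sign
  elsewhere.\<close>

lemma Z_near_0:
  assumes ev: "\<forall>\<^sub>F z in near_0. z \<in> D"
  shows "(Z \<longlongrightarrow> 2) near_0"
proof -
  have lim: "(Zsq lam \<longlongrightarrow> of_real 4) near_0"
    unfolding Zsq_def by (rule tendsto_eq_intros tendsto_near_0 refl | simp)+
  have "\<forall>\<^sub>F z in near_0. z \<in> D \<and> 0 < Re (Zsq lam z)"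
    by (rule eventually_conj[OF ev pos_real_if_near[OF lim]]) simp
  then obtain r where r: "r > 0" "\<And>z. z \<in> Cplus \<inter> ball 0 r \<Longrightarrow> z \<in> D \<and> 0 < Re (Zsq lam z)"
    unfolding eventually_near_0 by blast
  let ?S = "Cplus \<inter> ball 0 r"
  have x: "of_real (r/2) \<in> ?S" using r(1) of_real_in_Cplus[of "r/2"] by auto
  have eq: "Z z = csqrt (Zsq lam z)" if "z \<in> ?S" for z
  proof (rule connected_sqrt_unique[OF connected_half_disc[of r] _ _ _ _ x _ _ _ _ that])
    show "continuous_on ?S Z" using r by (intro continuous_on_subset[OF cont_Z]) auto
    show "continuous_on ?S (\<lambda>z. csqrt (Zsq lam z))"
    proof (rule continuous_on_compose2[OF continuous_on_csqrt])
      show "continuous_on ?S (Zsq lam)" unfolding Zsq_def by (intro continuous_intros)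
    qed (use r(2) not_nonpos_Reals_if_Re_pos in auto)
    show "(Z z)\<^sup>2 = (csqrt (Zsq lam z))\<^sup>2" "csqrt (Zsq lam z) \<noteq> 0" if "z \<in> ?S" for z
      using r(2)[OF that] Z_sq[of z] by auto
    show "Z (of_real (r/2)) \<in> \<real>" "Re (Z (of_real (r/2))) > 0" using branches_real[of "r/2"] r(1) by auto
    have "Zsq lam (of_real (r/2)) = of_real ((r/2)\<^sup>2 - 4 * lam * (r/2) + 4)" by (simp add: Zsq_def)
    moreover have "0 < Re (Zsq lam (of_real (r/2)))" using r(2)[OF x] by simp
    ultimately have pos: "0 < (r/2)\<^sup>2 - 4 * lam * (r/2) + 4"
      and "csqrt (Zsq lam (of_real (r/2))) = of_real (sqrt ((r/2)\<^sup>2 - 4 * lam * (r/2) + 4))"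
      by (simp_all only: Re_complex_of_real of_real_sqrt[OF less_imp_le])
    then show "csqrt (Zsq lam (of_real (r/2))) \<in> \<real>" "Re (csqrt (Zsq lam (of_real (r/2)))) > 0"
      using pos by (simp_all only: Reals_of_real Re_complex_of_real real_sqrt_gt_zero)
  qed
  have "((\<lambda>z. csqrt (Zsq lam z)) \<longlongrightarrow> csqrt (of_real 4)) near_0"
    by (rule isCont_tendsto_compose[OF _ lim]) (simp add: continuous_at_csqrt)
  moreover have "\<forall>\<^sub>F z in near_0. csqrt (Zsq lam z) = Z z"
    unfolding eventually_near_0 using r(1) eq by (metis (no_types))
  ultimately have "(Z \<longlongrightarrow> csqrt (of_real 4)) near_0" by (rule Lim_transform_eventually)
  moreover have "csqrt (of_real 4) = 2" by simp
  ultimately show ?thesis by simp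
qed

text \<open>The arguments of the first two logarithms tend to the positive numbers
  \<open>2 - 2 lam\<close> and 4, so principal logarithms are continuous there. The singular
  behaviour is carried by \<open>Ln z\<close> alone.\<close>

lemma branches_near_0:
  assumes ev: "\<forall>\<^sub>F z in near_0. z \<in> D"
  shows "\<forall>\<^sub>F z in near_0. \<xi> z = Z z / 2 - of_real lam * Ln (Z z + z - 2 * of_real lam) - Ln (Z z - of_real lam * z + 2) + Ln z
     \<and> q z = exp (Ln z / 2) / csqrt (Z z)"
proof -
  have lims: "(Z \<longlongrightarrow> of_real 2) near_0"
    "((\<lambda>z. Z z + z - 2 * of_real lam) \<longlongrightarrow> of_real (2 - 2 * lam)) near_0"
    "((\<lambda>z. Z z - of_real lam * z + 2) \<longlongrightarrow> of_real 4) near_0"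
    by (rule tendsto_eq_intros Z_near_0[OF ev] tendsto_near_0 refl | simp)+
  have "\<forall>\<^sub>F z in near_0. z \<in> D \<and> 0 < Re (Z z) \<and> 0 < Re (Z z + z - 2 * of_real lam) \<and> 0 < Re (Z z - of_real lam * z + 2)"
    by (intro eventually_conj ev pos_real_if_near[OF lims(1)] pos_real_if_near[OF lims(2)] pos_real_if_near[OF lims(3)])
       (use lam in auto)
  then obtain r where r: "r > 0" and S: "\<And>z. z \<in> Cplus \<inter> ball 0 r \<Longrightarrow> z \<in> D \<and> 0 < Re (Z z) \<and>
      0 < Re (Z z + z - 2 * of_real lam) \<and> 0 < Re (Z z - of_real lam * z + 2)"
    unfolding eventually_near_0 by blast
  let ?S = "Cplus \<inter> ball 0 r"
  define x where "x = r / 2"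
  have xr: "x > 0" "x < r" using r by (auto simp: x_def)
  then have x: "x > 0" "of_real x \<in> ?S" by auto
  note conn = connected_half_disc[of r]
  have SD: "?S \<subseteq> D" using S by blast
  have contZ: "continuous_on ?S Z" by (rule continuous_on_subset[OF cont_Z SD])
  have contLn: "continuous_on ?S Ln" by (rule continuous_on_subset[OF continuous_on_Ln_Cplus]) auto
  define X where "X = Re (Z (of_real x))"
  have ZX: "Z (of_real x) = of_real X" "X > 0" using Z_real_eq[OF x(1)] branches_real[OF x(1)] by (auto simp: X_def)
  show ?thesis
    unfolding eventually_near_0
  proof (intro exI[of _ r] conjI r ballI)
    fix z assume z: "z \<in> ?S"
    have "\<xi> z = Z z / 2 - of_real lam * Ln (Z z + z - 2 * of_real lam) - (Ln (Z z - of_real lam * z + 2) - Ln z)"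
    proof (rule xi_eq_on_connected[OF conn SD x _ _ _ _ _ _ z])
      show "continuous_on ?S (\<lambda>z. Ln (Z z + z - 2 * of_real lam))"
        by (intro continuous_intros contZ) (use S not_nonpos_Reals_if_Re_pos in blast)
      show "continuous_on ?S (\<lambda>z. Ln (Z z - of_real lam * z + 2) - Ln z)"
        by (rule continuous_on_diff[OF _ contLn], intro continuous_intros contZ) (use S not_nonpos_Reals_if_Re_pos in blast)
      fix z assume z: "z \<in> ?S"
      show "exp (Ln (Z z + z - 2 * of_real lam)) = Z z + z - 2 * of_real lam"
        using S[OF z] by (intro exp_Ln nonzero_if_Re_pos) blast
      have "Z z - of_real lam * z + 2 \<noteq> 0" using S[OF z] nonzero_if_Re_pos by blast
      then show "exp (Ln (Z z - of_real lam * z + 2) - Ln z) = (Z z - of_real lam * z + 2) / z"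
        using nonzero[of z] S[OF z] by (simp add: exp_diff)
    next
      have p: "0 < X + x - 2 * lam" "0 < X - lam * x + 2" using S[OF x(2)] ZX by simp_all
      have "Ln (Z (of_real x) + of_real x - 2 * of_real lam) = of_real (ln (X + x - 2 * lam))"
        using p by (simp add: ZX Ln_of_real[symmetric])
      then show "Ln (Z (of_real x) + of_real x - 2 * of_real lam) \<in> \<real>" by simp
      have "Ln (Z (of_real x) - of_real lam * of_real x + 2) - Ln (of_real x) = of_real (ln (X - lam * x + 2) - ln x)"
        using p x by (simp add: ZX Ln_of_real[symmetric])
      then show "Ln (Z (of_real x) - of_real lam * of_real x + 2) - Ln (of_real x) \<in> \<real>" by simp
    qed
    then show "\<xi> z = Z z / 2 - of_real lam * Ln (Z z + z - 2 * of_real lam) - Ln (Z z - of_real lam * z + 2) + Ln z"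
      by simp
    show "q z = exp (Ln z / 2) / csqrt (Z z)"
    proof (rule connected_sqrt_unique[OF conn _ _ _ _ x(2) _ _ _ _ z])
      show "continuous_on ?S q" by (rule continuous_on_subset[OF branches_basic(3) SD])
      show "continuous_on ?S (\<lambda>z. exp (Ln z / 2) / csqrt (Z z))"
      proof (rule continuous_on_divide)
        show "continuous_on ?S (\<lambda>z. exp (Ln z / 2))"
          by (intro continuous_on_exp continuous_on_divide contLn continuous_on_const) simp
        show "continuous_on ?S (\<lambda>z. csqrt (Z z))"
          by (rule continuous_on_compose2[OF continuous_on_csqrt contZ]) (use S not_nonpos_Reals_if_Re_pos in auto)
      qed (use S nonzero in auto)
      show "(q z)\<^sup>2 = (exp (Ln z / 2) / csqrt (Z z))\<^sup>2" "exp (Ln z / 2) / csqrt (Z z) \<noteq> 0" if "z \<in> ?S" for z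
        using S[OF that] nonzero[of z] branches_basic(4)[of z] by (auto simp: power_divide exp_double[symmetric])
      show "q (of_real x) \<in> \<real>" "Re (q (of_real x)) > 0" using branches_real[OF x(1)] by auto
      have "exp (Ln (of_real x) / 2) / csqrt (Z (of_real x)) = of_real (exp (ln x / 2) / sqrt X)"
        using x(1) ZX(2) by (simp add: ZX(1) Ln_of_real exp_of_real[symmetric])
      then show "exp (Ln (of_real x) / 2) / csqrt (Z (of_real x)) \<in> \<real>"
        "Re (exp (Ln (of_real x) / 2) / csqrt (Z (of_real x))) > 0" using ZX(2) by simp_all
    qed
  qed
qed

lemma Z_near_infinity:
  assumes ev: "\<forall>\<^sub>F z in near_infinity. z \<in> D"
  shows "((\<lambda>z. Z z / z) \<longlongrightarrow> 1) near_infinity"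
proof -
  define P where "P z = 1 - 4 * of_real lam * inverse z + 4 * inverse z * inverse z" for z :: complex
  have lim: "(P \<longlongrightarrow> of_real 1) near_infinity"
    unfolding P_def by (rule tendsto_eq_intros tendsto_near_infinity refl | simp)+
  have "\<forall>\<^sub>F z in near_infinity. z \<in> D \<and> 0 < Re (P z)"
    by (rule eventually_conj[OF ev pos_real_if_near[OF lim]]) simp
  then obtain r where r: "r > 0" "\<And>z. z \<in> Cplus \<Longrightarrow> r < norm z \<Longrightarrow> z \<in> D \<and> 0 < Re (P z)"
    unfolding eventually_near_infinity by blast
  let ?S = "{z \<in> Cplus. r < norm z}"
  define x where "x = 2 * r"
  have x0: "x > 0" "r < x" using r(1) by (auto simp: x_def)
  then have x: "of_real x \<in> ?S" by auto
  have S0: "z \<noteq> 0" if "z \<in> ?S" for z using that by (auto simp: Cplus_eq)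
  have eq: "Z z / z = csqrt (P z)" if "z \<in> ?S" for z
  proof (rule connected_sqrt_unique[OF connected_outer_half_disc[OF r(1)] _ _ _ _ x _ _ _ _ that])
    show "continuous_on ?S (\<lambda>z. Z z / z)"
      using r S0 by (intro continuous_intros continuous_on_subset[OF cont_Z]) auto
    have "continuous_on ?S P" unfolding P_def using S0 by (intro continuous_intros) auto
    then show "continuous_on ?S (\<lambda>z. csqrt (P z))"
      by (rule continuous_on_compose2[OF continuous_on_csqrt]) (use r(2) not_nonpos_Reals_if_Re_pos in auto)
    show "(Z z / z)\<^sup>2 = (csqrt (P z))\<^sup>2" "csqrt (P z) \<noteq> 0" if "z \<in> ?S" for z
    proof -
      have "(Z z / z)\<^sup>2 = (z\<^sup>2 - 4 * of_real lam * z + 4) / z\<^sup>2"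
        using r(2)[of z] that Z_sq[of z] by (simp add: power_divide Zsq_def)
      also have "\<dots> = P z" using S0[OF that] by (simp add: P_def divide_simps power2_eq_square) (simp add: algebra_simps)
      finally show "(Z z / z)\<^sup>2 = (csqrt (P z))\<^sup>2" by simp
      show "csqrt (P z) \<noteq> 0" using r(2)[of z] that by auto
    qed
    have "Z (of_real x) / of_real x = of_real (Re (Z (of_real x)) / x)"
      unfolding of_real_divide Z_real_eq[OF x0(1), symmetric] ..
    then show "Z (of_real x) / of_real x \<in> \<real>" "Re (Z (of_real x) / of_real x) > 0"
      using branches_real(2)[OF x0(1)] x0(1) by (metis Reals_of_real, simp)
    have P: "P (of_real x) = of_real (1 - 4 * lam * inverse x + 4 * inverse x * inverse x)" by (simp add: P_def)
    have "0 < Re (P (of_real x))" using r(2)[of "of_real x"] x by blast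
    then have "0 < 1 - 4 * lam * inverse x + 4 * inverse x * inverse x" unfolding P Re_complex_of_real .
    then have "csqrt (P (of_real x)) = of_real (sqrt (1 - 4 * lam * inverse x + 4 * inverse x * inverse x))"
      unfolding P by (intro of_real_sqrt[symmetric]) simp
    with \<open>0 < 1 - _ + _\<close> show "csqrt (P (of_real x)) \<in> \<real>" "Re (csqrt (P (of_real x))) > 0" by simp_all
  qed
  have "((\<lambda>z. csqrt (P z)) \<longlongrightarrow> csqrt (of_real 1)) near_infinity"
    by (rule isCont_tendsto_compose[OF _ lim]) (simp add: continuous_at_csqrt)
  moreover have "\<forall>\<^sub>F z in near_infinity. csqrt (P z) = Z z / z"
    unfolding eventually_near_infinity using r(1) eq by (metis (no_types))
  ultimately have "((\<lambda>z. Z z / z) \<longlongrightarrow> csqrt (of_real 1)) near_infinity" by (rule Lim_transform_eventually)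
  then show ?thesis by simp
qed

text \<open>Taking \<open>z\<close> out of each argument leaves factors with the positive limits 2
  and \<open>1 - lam\<close>, to which principal logarithms apply; the power of \<open>z\<close>
  contributes the term \<open>- lam Ln z\<close>.\<close>

lemma branches_near_infinity:
  assumes ev: "\<forall>\<^sub>F z in near_infinity. z \<in> D"
  shows "\<forall>\<^sub>F z in near_infinity. \<xi> z = Z z / 2 - of_real lam * (Ln z + Ln (Z z / z + 1 - 2 * of_real lam * inverse z))
       - Ln (Z z / z - of_real lam + 2 * inverse z) \<and> q z = 1 / csqrt (Z z / z)"
proof -
  have lims: "((\<lambda>z. Z z / z) \<longlongrightarrow> of_real 1) near_infinity"
    "((\<lambda>z. Z z / z + 1 - 2 * of_real lam * inverse z) \<longlongrightarrow> of_real 2) near_infinity"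
    "((\<lambda>z. Z z / z - of_real lam + 2 * inverse z) \<longlongrightarrow> of_real (1 - lam)) near_infinity"
  proof -
    show 1: "((\<lambda>z. Z z / z) \<longlongrightarrow> of_real 1) near_infinity" using Z_near_infinity[OF ev] by simp
    have "((\<lambda>z. Z z / z + 1 - 2 * of_real lam * inverse z) \<longlongrightarrow> of_real 1 + 1 - 2 * of_real lam * 0) near_infinity"
      by (intro tendsto_add tendsto_diff tendsto_mult tendsto_const 1 tendsto_near_infinity)
    then show "((\<lambda>z. Z z / z + 1 - 2 * of_real lam * inverse z) \<longlongrightarrow> of_real 2) near_infinity" by simp
    have "((\<lambda>z. Z z / z - of_real lam + 2 * inverse z) \<longlongrightarrow> of_real 1 - of_real lam + 2 * 0) near_infinity"
      by (intro tendsto_add tendsto_diff tendsto_mult tendsto_const 1 tendsto_near_infinity)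
    then show "((\<lambda>z. Z z / z - of_real lam + 2 * inverse z) \<longlongrightarrow> of_real (1 - lam)) near_infinity" by simp
  qed
  have "\<forall>\<^sub>F z in near_infinity. z \<in> D \<and> 0 < Re (Z z / z) \<and> 0 < Re (Z z / z + 1 - 2 * of_real lam * inverse z)
      \<and> 0 < Re (Z z / z - of_real lam + 2 * inverse z)"
    by (intro eventually_conj ev pos_real_if_near[OF lims(1)] pos_real_if_near[OF lims(2)] pos_real_if_near[OF lims(3)])
       (use lam in auto)
  then obtain r where r: "r > 0" and S: "\<And>z. z \<in> Cplus \<Longrightarrow> r < norm z \<Longrightarrow> z \<in> D \<and> 0 < Re (Z z / z) \<and>
      0 < Re (Z z / z + 1 - 2 * of_real lam * inverse z) \<and> 0 < Re (Z z / z - of_real lam + 2 * inverse z)"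
    unfolding eventually_near_infinity by blast
  let ?S = "{z \<in> Cplus. r < norm z}"
  define x where "x = 2 * r"
  have xr: "x > 0" "r < x" using r by (auto simp: x_def)
  then have x: "x > 0" "of_real x \<in> ?S" by auto
  have S0: "z \<noteq> 0" if "z \<in> ?S" for z using that by (auto simp: Cplus_eq)
  note conn = connected_outer_half_disc[OF r]
  have SD: "?S \<subseteq> D" using S by blast
  have contZ: "continuous_on ?S (\<lambda>z. Z z / z)"
    using S0 by (intro continuous_intros continuous_on_subset[OF cont_Z SD]) auto
  have contLn: "continuous_on ?S Ln" by (rule continuous_on_subset[OF continuous_on_Ln_Cplus]) auto
  have contI: "continuous_on ?S inverse" using S0 by (intro continuous_intros) auto
  define X where "X = Re (Z (of_real x)) / x"
  have ZX: "Z (of_real x) / of_real x = of_real X" "X > 0"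
  proof -
    show "Z (of_real x) / of_real x = of_real X"
      unfolding X_def of_real_divide Z_real_eq[OF x(1), symmetric] ..
    show "X > 0" using branches_real(2)[OF x(1)] x(1) by (simp add: X_def)
  qed
  show ?thesis
    unfolding eventually_near_infinity
  proof (intro exI[of _ r] conjI r ballI)
    fix z assume z: "z \<in> ?S"
    show "\<xi> z = Z z / 2 - of_real lam * (Ln z + Ln (Z z / z + 1 - 2 * of_real lam * inverse z)) - Ln (Z z / z - of_real lam + 2 * inverse z)"
    proof (rule xi_eq_on_connected[OF conn SD x _ _ _ _ _ _ z])
      show "continuous_on ?S (\<lambda>z. Ln z + Ln (Z z / z + 1 - 2 * of_real lam * inverse z))"
        by (rule continuous_on_add[OF contLn], intro continuous_intros contZ contI) (use S S0 not_nonpos_Reals_if_Re_pos in blast)+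
      show "continuous_on ?S (\<lambda>z. Ln (Z z / z - of_real lam + 2 * inverse z))"
        by (intro continuous_intros contZ contI) (use S S0 not_nonpos_Reals_if_Re_pos in blast)+
      fix z assume z: "z \<in> ?S"
      have nz: "Z z / z + 1 - 2 * of_real lam * inverse z \<noteq> 0" "Z z / z - of_real lam + 2 * inverse z \<noteq> 0"
        using S[of z] z nonzero_if_Re_pos by blast+
      show "exp (Ln z + Ln (Z z / z + 1 - 2 * of_real lam * inverse z)) = Z z + z - 2 * of_real lam"
        unfolding exp_add exp_Ln[OF nz(1)] exp_Ln[OF S0[OF z]] using S0[OF z] by (simp add: field_simps)
      show "exp (Ln (Z z / z - of_real lam + 2 * inverse z)) = (Z z - of_real lam * z + 2) / z"
        unfolding exp_Ln[OF nz(2)] using S0[OF z] by (simp add: field_simps)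
    next
      have p: "0 < X + 1 - 2 * lam * inverse x" "0 < X - lam + 2 * inverse x"
      proof -
        have "Z (of_real x) / of_real x + 1 - 2 * of_real lam * inverse (of_real x) = of_real (X + 1 - 2 * lam * inverse x)"
          "Z (of_real x) / of_real x - of_real lam + 2 * inverse (of_real x) = of_real (X - lam + 2 * inverse x)"
          unfolding ZX(1) by simp_all
        then show "0 < X + 1 - 2 * lam * inverse x" "0 < X - lam + 2 * inverse x"
          using S[of "of_real x"] x(2) by (metis Re_complex_of_real mem_Collect_eq)+
      qed
      have "Ln (of_real x) + Ln (Z (of_real x) / of_real x + 1 - 2 * of_real lam * inverse (of_real x)) =
          of_real (ln x + ln (X + 1 - 2 * lam * inverse x))"
        unfolding ZX(1) using p x by (simp add: Ln_of_real[symmetric])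
      then show "Ln (of_real x) + Ln (Z (of_real x) / of_real x + 1 - 2 * of_real lam * inverse (of_real x)) \<in> \<real>" by simp
      have "Ln (Z (of_real x) / of_real x - of_real lam + 2 * inverse (of_real x)) = of_real (ln (X - lam + 2 * inverse x))"
        unfolding ZX(1) using p x by (simp add: Ln_of_real[symmetric])
      then show "Ln (Z (of_real x) / of_real x - of_real lam + 2 * inverse (of_real x)) \<in> \<real>" by simp
    qed
    show "q z = 1 / csqrt (Z z / z)"
    proof (rule connected_sqrt_unique[OF conn _ _ _ _ x(2) _ _ _ _ z])
      show "continuous_on ?S q" by (rule continuous_on_subset[OF branches_basic(3) SD])
      have "continuous_on ?S (\<lambda>z. csqrt (Z z / z))"
        by (rule continuous_on_compose2[OF continuous_on_csqrt contZ]) (use S not_nonpos_Reals_if_Re_pos in auto)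
      then show "continuous_on ?S (\<lambda>z. 1 / csqrt (Z z / z))"
        by (intro continuous_intros) (use S nonzero S0 in auto)
      show "(q z)\<^sup>2 = (1 / csqrt (Z z / z))\<^sup>2" "1 / csqrt (Z z / z) \<noteq> 0" if "z \<in> ?S" for z
        using S[of z] that S0[OF that] nonzero[of z] branches_basic(4)[of z] by (auto simp: power_divide)
      show "q (of_real x) \<in> \<real>" "Re (q (of_real x)) > 0" using branches_real[OF x(1)] by auto
      have "1 / csqrt (Z (of_real x) / of_real x) = of_real (1 / sqrt X)"
        unfolding ZX(1) using ZX(2) by simp
      then show "1 / csqrt (Z (of_real x) / of_real x) \<in> \<real>"
        "Re (1 / csqrt (Z (of_real x) / of_real x)) > 0" using ZX(2) by simp_all
    qed
  qed
qed

end

section \<open>Limits of the coefficients and of the logarithmic derivatives at the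
  singularities\<close>

lemma near_0_neq_bot: "near_0 \<noteq> bot"
proof -
  have "0 islimpt Cplus"
  proof (rule islimpt_approachable[THEN iffD2], intro allI impI)
    fix e :: real assume "e > 0"
    then show "\<exists>x'\<in>Cplus. x' \<noteq> 0 \<and> dist x' 0 < e"
      by (intro bexI[of _ "of_real (e / 2)"]) (auto simp del: of_real_divide)
  qed
  then show ?thesis by (simp add: near_0_def trivial_limit_within)
qed

text \<open>The oscillation bound makes the values along a real null sequence a Cauchy sequence.
  Passing to the limit in one of the two arguments then gives
  \<open>norm (f z - l) \<le> C * norm z\<close>.\<close>

lemma convergent_near_0:
  fixes f :: "complex \<Rightarrow> complex"
  assumes r: "r > 0"
    and osc: "\<And>z z'. \<lbrakk>z \<in> Cplus \<inter> ball 0 r; z' \<in> Cplus \<inter> ball 0 r\<rbrakk> \<Longrightarrow> norm (f z - f z') \<le> C * (norm z + norm z')"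
  shows "\<exists>l. (f \<longlongrightarrow> l) near_0"
proof -
  \<comment> \<open>The summand 2 keeps already \<open>x 0\<close> strictly below
    \<open>r\<close>.\<close>
  define x where "x n = r / (real n + 2)" for n :: nat
  have x: "0 < x n" "x n < r" for n
  proof -
    show "0 < x n" using r by (simp add: x_def)
    have "r * 1 < r * (real n + 2)" using r by (intro mult_strict_left_mono) auto
    then show "x n < r" by (simp add: x_def divide_less_eq)
  qed
  have x_in: "of_real (x n) \<in> Cplus \<inter> ball 0 r" for n
  proof -
    have "x n \<noteq> 0" "\<bar>x n\<bar> < r" using x(1)[of n] x(2)[of n] by linarith+
    then show ?thesis by simp
  qed
  have x0: "x \<longlonglongrightarrow> 0" unfolding x_def by real_asymp
  have C: "0 \<le> C"
  proof -
    have "0 \<le> C * (norm (of_real (x 0) :: complex) + norm (of_real (x 0) :: complex))"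
      using osc[OF x_in x_in, of 0 0] norm_ge_zero order.trans by blast
    then show ?thesis using x(1)[of 0] by (simp add: zero_le_mult_iff)
  qed
  define X where "X n = f (of_real (x n))" for n
  have XC: "norm (X m - X n) \<le> C * (x m + x n)" for m n
    using osc[OF x_in x_in, of m n] x(1)[of m] x(1)[of n] by (simp add: X_def)
  have "Cauchy X"
  proof (rule CauchyI)
    fix e :: real assume "e > 0"
    have "(\<lambda>n. C * x n) \<longlonglongrightarrow> C * 0" by (intro tendsto_intros x0)
    then have "\<forall>\<^sub>F n in sequentially. C * x n < e / 2" using \<open>e > 0\<close> by (intro order_tendstoD(2)) auto
    then obtain M where M: "\<And>n. n \<ge> M \<Longrightarrow> C * x n < e / 2" by (auto simp: eventually_sequentially)
    have "norm (X m - X n) < e" if "M \<le> m" "M \<le> n" for m n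
      using XC[of m n] M[OF that(1)] M[OF that(2)] by (simp add: distrib_left)
    then show "\<exists>M. \<forall>m\<ge>M. \<forall>n\<ge>M. norm (X m - X n) < e" by blast
  qed
  then obtain l where l: "X \<longlonglongrightarrow> l" using Cauchy_convergent_iff convergent_def by blast
  have bound: "norm (f z - l) \<le> C * norm z" if z: "z \<in> Cplus \<inter> ball 0 r" for z
  proof (rule tendsto_le[OF sequentially_bot])
    show "(\<lambda>n. norm (f z - X n)) \<longlonglongrightarrow> norm (f z - l)" by (intro tendsto_intros l)
    have "(\<lambda>n. C * (norm z + x n)) \<longlonglongrightarrow> C * (norm z + 0)" by (intro tendsto_intros x0)
    then show "(\<lambda>n. C * (norm z + x n)) \<longlonglongrightarrow> C * norm z" by simp
    show "\<forall>\<^sub>F n in sequentially. norm (f z - X n) \<le> C * (norm z + x n)"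
    proof (rule always_eventually, rule allI)
      show "norm (f z - X n) \<le> C * (norm z + x n)" for n
        using osc[OF z x_in[of n]] x(1)[of n] by (simp add: X_def)
    qed
  qed
  have "((\<lambda>z. f z - l) \<longlongrightarrow> 0) near_0"
  proof (rule Lim_null_comparison)
    show "\<forall>\<^sub>F z in near_0. norm (f z - l) \<le> C * norm z"
      unfolding eventually_near_0 using r bound by blast
    show "((\<lambda>z. C * norm z) \<longlongrightarrow> 0) near_0"
      using tendsto_mult_right_zero[OF tendsto_norm_zero[OF tendsto_near_0]] .
  qed
  then show ?thesis using LIM_zero_cancel by blast
qed

context liouville_branches
begin

lemma eventually_reachable_near_0:
  assumes "\<forall>\<^sub>F z in near_0. z \<in> D"
  shows "\<forall>\<^sub>F z in near_0. reachable D z"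
  using assms unfolding eventually_near_0
proof (elim exE conjE, intro exI conjI ballI)
  fix r z assume "\<forall>z\<in>Cplus \<inter> ball 0 r. z \<in> D" "z \<in> Cplus \<inter> ball 0 r"
  then show "reachable D z" by (intro reachable_circle(1)) auto
qed

lemma eventually_reachable_near_infinity:
  assumes "\<forall>\<^sub>F z in near_infinity. z \<in> D"
  shows "\<forall>\<^sub>F z in near_infinity. reachable D z"
  using assms unfolding eventually_near_infinity
proof (elim exE conjE, intro exI conjI ballI)
  fix r z assume "\<forall>z\<in>{z \<in> Cplus. r < norm z}. z \<in> D" "z \<in> {z \<in> Cplus. r < norm z}"
  then show "reachable D z" by (intro reachable_circle(1)) auto
qed

lemma F_near_0:
  assumes ev: "\<forall>\<^sub>F z in near_0. z \<in> D"
  obtains C r where "C > 0" "r > 0"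
    "\<And>z. z \<in> Cplus \<inter> ball 0 r \<Longrightarrow> z \<in> D \<and> norm (F s z) \<le> C * norm z \<and> norm (Z z * F s z / z) \<le> C"
proof -
  obtain B where B: "B > 0" "\<And>z. z \<in> D \<Longrightarrow> norm z \<le> 1 \<Longrightarrow> 1 \<le> norm (Z z) \<Longrightarrow> norm (F s z) \<le> B * norm z"
    using F_bound_small by blast
  have limZ: "((\<lambda>z. norm (Z z)) \<longlongrightarrow> 2) near_0" using tendsto_norm[OF Z_near_0[OF ev]] by simp
  have lim0: "((\<lambda>z. norm z) \<longlongrightarrow> 0) near_0" using tendsto_norm[OF tendsto_near_0] by simp
  have "\<forall>\<^sub>F z in near_0. z \<in> D \<and> norm z < 1 \<and> 1 < norm (Z z) \<and> norm (Z z) < 3"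
    by (intro eventually_conj ev order_tendstoD[OF limZ] order_tendstoD[OF lim0]) auto
  then obtain r where r: "r > 0" "\<And>z. z \<in> Cplus \<inter> ball 0 r \<Longrightarrow> z \<in> D \<and> norm z < 1 \<and> 1 < norm (Z z) \<and> norm (Z z) < 3"
    unfolding eventually_near_0 by blast
  show ?thesis
  proof (rule that[of "3 * B" r])
    fix z assume z: "z \<in> Cplus \<inter> ball 0 r"
    note * = r(2)[OF z]
    have Fz: "norm (F s z) \<le> B * norm z" using * by (intro B(2)) auto
    also have "B * norm z \<le> 3 * B * norm z" using B(1) by (intro mult_right_mono) auto
    finally have 1: "norm (F s z) \<le> 3 * B * norm z" .
    have "norm (Z z * F s z / z) = norm (Z z) * norm (F s z) / norm z" by (simp add: norm_mult norm_divide)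
    also have "\<dots> \<le> 3 * (B * norm z) / norm z"
      using * Fz by (intro divide_right_mono mult_mono) auto
    also have "\<dots> = 3 * B" using * nonzero by simp
    finally show "z \<in> D \<and> norm (F s z) \<le> 3 * B * norm z \<and> norm (Z z * F s z / z) \<le> 3 * B" using * 1 by simp
  qed (use B r in auto)
qed

lemma F_tendsto_near_0:
  assumes ev: "\<forall>\<^sub>F z in near_0. z \<in> D"
  shows "(F s \<longlongrightarrow> 0) near_0"
proof -
  obtain C r where C: "C > 0" "r > 0"
    "\<And>z. z \<in> Cplus \<inter> ball 0 r \<Longrightarrow> z \<in> D \<and> norm (F s z) \<le> C * norm z \<and> norm (Z z * F s z / z) \<le> C"
    using F_near_0[OF ev] by blast
  show ?thesis
  proof (rule Lim_null_comparison)
    show "\<forall>\<^sub>F z in near_0. norm (F s z) \<le> C * norm z" unfolding eventually_near_0 using C by blast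
    show "((\<lambda>z. C * norm z) \<longlongrightarrow> 0) near_0"
      using tendsto_mult_right_zero[OF tendsto_norm_zero[OF tendsto_near_0]] .
  qed
qed

lemma F_near_infinity:
  assumes ev: "\<forall>\<^sub>F z in near_infinity. z \<in> D"
  obtains C r where "C > 0" "r > 0"
    "\<And>z. z \<in> Cplus \<Longrightarrow> r < norm z \<Longrightarrow> z \<in> D \<and> norm (F s z) \<le> C / norm z ^ 2 \<and> norm (Z z * F s z / z) \<le> C / norm z ^ 2"
proof -
  obtain B where B: "B > 0" "\<And>z. z \<in> D \<Longrightarrow> 1 \<le> norm z \<Longrightarrow> norm z / 2 \<le> norm (Z z) \<Longrightarrow> norm (F s z) \<le> B / norm z ^ 2"
    using F_bound_large by blast
  have limZ: "((\<lambda>z. norm (Z z / z)) \<longlongrightarrow> 1) near_infinity" using tendsto_norm[OF Z_near_infinity[OF ev]] by simp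
  have lim0: "((\<lambda>z. norm (inverse z)) \<longlongrightarrow> 0) near_infinity" using tendsto_norm[OF tendsto_near_infinity] by simp
  have "\<forall>\<^sub>F z in near_infinity. z \<in> D \<and> norm (inverse z) < 1 \<and> 1/2 < norm (Z z / z) \<and> norm (Z z / z) < 2"
    by (intro eventually_conj ev order_tendstoD[OF limZ] order_tendstoD[OF lim0]) auto
  then obtain r where r: "r > 0" "\<And>z. z \<in> Cplus \<Longrightarrow> r < norm z \<Longrightarrow> z \<in> D \<and> norm (inverse z) < 1 \<and> 1/2 < norm (Z z / z) \<and> norm (Z z / z) < 2"
    unfolding eventually_near_infinity by blast
  show ?thesis
  proof (rule that[of "2 * B" r])
    fix z assume z: "z \<in> Cplus" "r < norm z"
    note * = r(2)[OF z]
    have nz: "0 < norm z" using z by (simp add: Cplus_eq)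
    have n1: "1 \<le> norm z" using * nz by (simp add: norm_inverse inverse_less_1_iff)
    have n2: "norm z / 2 \<le> norm (Z z)" using * nz by (simp add: norm_divide less_divide_eq)
    have Fz: "norm (F s z) \<le> B / norm z ^ 2" using * n1 n2 by (intro B(2)) auto
    also have "B / norm z ^ 2 \<le> 2 * B / norm z ^ 2" using B(1) by (intro divide_right_mono) auto
    finally have 1: "norm (F s z) \<le> 2 * B / norm z ^ 2" .
    have "norm (Z z * F s z / z) = norm (Z z / z) * norm (F s z)" by (simp add: norm_mult norm_divide)
    also have "\<dots> \<le> 2 * (B / norm z ^ 2)" using * Fz by (intro mult_mono) auto
    finally show "z \<in> D \<and> norm (F s z) \<le> 2 * B / norm z ^ 2 \<and> norm (Z z * F s z / z) \<le> 2 * B / norm z ^ 2" using * 1 by simp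
  qed (use B r in auto)
qed

lemma tendsto_norm_near_infinity: "((\<lambda>z. C / norm z) \<longlongrightarrow> 0) near_infinity"
  using tendsto_mult_right_zero[OF tendsto_norm_zero[OF tendsto_near_infinity], of C]
  by (simp add: norm_inverse divide_inverse)

lemma F_tendsto_near_infinity:
  assumes ev: "\<forall>\<^sub>F z in near_infinity. z \<in> D"
  shows "(F s \<longlongrightarrow> 0) near_infinity"
proof -
  obtain C r where C: "C > 0" "r > 0"
    "\<And>z. z \<in> Cplus \<Longrightarrow> r < norm z \<Longrightarrow> z \<in> D \<and> norm (F s z) \<le> C / norm z ^ 2 \<and> norm (Z z * F s z / z) \<le> C / norm z ^ 2"
    using F_near_infinity[OF ev] by blast
  show ?thesis
  proof (rule Lim_null_comparison)
    show "\<forall>\<^sub>F z in near_infinity. norm (F s z) \<le> C / norm z * (1 / norm z)"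
      unfolding eventually_near_infinity using C by (intro exI[of _ r]) (auto simp: power2_eq_square)
    show "((\<lambda>z. C / norm z * (1 / norm z)) \<longlongrightarrow> 0) near_infinity"
      using tendsto_mult[OF tendsto_norm_near_infinity[of C] tendsto_norm_near_infinity[of 1]]
      by (simp only: mult_zero_left)
  qed
qed

lemma continuous_on_integrand: "continuous_on D (\<lambda>t. Z t * F s t / t)"
  using nonzero by (intro continuous_intros continuous_on_F cont_Z) auto

text \<open>Since \<open>F s = O(z)\<close> and \<open>Z\<close> tends to 2, the integrand is
  bounded near 0. The path from \<open>z\<close> to \<open>z'\<close> consists of two circular arcs
  and a segment of the real axis, so the variation of \<open>E s\<close> is bounded by a multiple of
  \<open>norm z + norm z'\<close>.\<close>

lemma E_near_0:
  assumes ev: "\<forall>\<^sub>F z in near_0. z \<in> D" and s: "1 \<le> s"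
  shows "\<exists>l. (E s \<longlongrightarrow> l) near_0"
proof -
  obtain C r where C: "C > 0" "r > 0"
    "\<And>z. z \<in> Cplus \<inter> ball 0 r \<Longrightarrow> z \<in> D \<and> norm (F s z) \<le> C * norm z \<and> norm (Z z * F s z / z) \<le> C"
    using F_near_0[OF ev] by blast
  let ?g = "\<lambda>t. Z t * F s t / t"
  note int = branches_basic(5)[OF s]
  have real_in: "of_real x \<in> Cplus \<inter> ball 0 r" if "0 < x" "x < r" for x using that by auto
  have circ: "norm (2 * E s z - 2 * E s (of_real (norm z))) \<le> 4 * C * norm z" if z: "z \<in> Cplus \<inter> ball 0 r" for z
  proof -
    have nz: "0 < norm z" "norm z < r" using z by (auto simp: Cplus_eq)
    have "norm (2 * E s z - 2 * E s (of_real (norm z))) \<le> C * norm z * pi"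
      by (rule reachable_circle(2)[where D = D and g = ?g])
         (use z nz C(3) int real_in[OF nz] continuous_on_integrand in auto)
    also have "\<dots> \<le> C * norm z * 4" using C(1) pi_less_4 by (intro mult_left_mono) auto
    finally show ?thesis by simp
  qed
  have seg: "norm (2 * E s (of_real y) - 2 * E s (of_real x)) \<le> C * y" if xy: "0 < x" "x \<le> y" "y < r" for x y
  proof -
    have sub: "of_real ` {x..y} \<subseteq> Cplus \<inter> ball (0::complex) r" using xy by auto
    have "2 * E s (of_real y) - 2 * E s (of_real x) = integral {x..y} (\<lambda>v. 1 * ?g (of_real v))"
    proof (rule reachable_arc(2)[OF xy(2), of of_real "\<lambda>_. 1" D])
      show "((of_real :: real \<Rightarrow> complex) has_vector_derivative 1) (at v within {x..y})" for v
        using has_vector_derivative_real_field[OF DERIV_ident, of v "{x..y}"] by simp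
      show "of_real ` {x..y} \<subseteq> D" using sub C(3) by blast
      then show "reachable D (of_real x)" using xy by (intro reachable_of_real) force+
      show "integral_from_infinity D ?g (of_real x) (2 * E s (of_real x))"
        "integral_from_infinity D ?g (of_real y) (2 * E s (of_real y))"
        using C(3) sub xy by (intro int; force)+
    qed (use continuous_on_integrand in auto)
    also have "norm \<dots> \<le> C * (y - x)"
    proof (rule integral_bound[OF xy(2)])
      show "continuous_on {x..y} (\<lambda>v. 1 * ?g (of_real v))"
        unfolding mult_1_left
        by (rule continuous_on_compose2[OF continuous_on_integrand continuous_on_of_real_id]) (use sub C(3) in blast)
      show "norm (1 * ?g (of_real v)) \<le> C" if "v \<in> {x..y}" for v
        using sub C(3)[of "of_real v"] that by (simp add: image_subset_iff)
    qed
    also have "\<dots> \<le> C * y" using C(1) xy by (intro mult_left_mono) auto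
    finally show ?thesis .
  qed
  have "norm (E s z - E s z') \<le> 4 * C * (norm z + norm z')" if z: "z \<in> Cplus \<inter> ball 0 r" and z': "z' \<in> Cplus \<inter> ball 0 r" for z z'
  proof -
    let ?e = "\<lambda>z. 2 * E s z"
    have nz: "0 < norm z" "norm z < r" "0 < norm z'" "norm z' < r" using z z' by (auto simp: Cplus_eq)
    have "norm (?e (of_real (norm z)) - ?e (of_real (norm z'))) \<le> C * (norm z + norm z')"
    proof (cases "norm z' \<le> norm z")
      case True
      have "norm (?e (of_real (norm z)) - ?e (of_real (norm z'))) \<le> C * norm z" by (rule seg) (use nz True in auto)
      also have "\<dots> \<le> C * (norm z + norm z')" using C(1) by (intro mult_left_mono) auto
      finally show ?thesis .
    next
      case False
      have "norm (?e (of_real (norm z')) - ?e (of_real (norm z))) \<le> C * norm z'" by (rule seg) (use nz False in auto)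
      also have "\<dots> \<le> C * (norm z + norm z')" using C(1) by (intro mult_left_mono) auto
      finally show ?thesis by (simp add: norm_minus_commute)
    qed
    moreover have "norm (a - b) \<le> norm (a - c) + norm (c - d) + norm (b - d)" for a b c d :: complex by norm
    from this[of "?e z" "?e z'" "?e (of_real (norm z))" "?e (of_real (norm z'))"]
    have "norm (?e z - ?e z') \<le> norm (?e z - ?e (of_real (norm z))) + norm (?e (of_real (norm z)) - ?e (of_real (norm z')))
        + norm (?e z' - ?e (of_real (norm z')))" .
    ultimately have "norm (?e z - ?e z') \<le> 4 * C * norm z + C * (norm z + norm z') + 4 * C * norm z'"
      using circ[OF z] circ[OF z'] by linarith
    also have "\<dots> \<le> 8 * C * (norm z + norm z')" using C(1) by (simp add: distrib_left)
    finally have "norm (2 * (E s z - E s z')) \<le> 8 * C * (norm z + norm z')" by (simp add: right_diff_distrib)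
    then show ?thesis unfolding norm_mult by simp
  qed
  then show ?thesis by (rule convergent_near_0[OF C(2)])
qed

text \<open>The integrand is \<open>O(1 / z^2)\<close>. Both the circular arc from
  \<open>norm z\<close> to \<open>z\<close> and the ray from \<open>norm z\<close> to infinity
  therefore contribute \<open>O(1 / norm z)\<close>.\<close>

lemma E_near_infinity:
  assumes ev: "\<forall>\<^sub>F z in near_infinity. z \<in> D" and s: "1 \<le> s"
  shows "(E s \<longlongrightarrow> 0) near_infinity"
proof -
  obtain C r where C: "C > 0" "r > 0"
    "\<And>z. z \<in> Cplus \<Longrightarrow> r < norm z \<Longrightarrow> z \<in> D \<and> norm (F s z) \<le> C / norm z ^ 2 \<and> norm (Z z * F s z / z) \<le> C / norm z ^ 2"
    using F_near_infinity[OF ev] by blast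
  let ?g = "\<lambda>t. Z t * F s t / t"
  note int = branches_basic(5)[OF s]
  have bound: "norm (E s z) \<le> 3 * C / norm z" if z: "z \<in> Cplus" "r < norm z" for z
  proof -
    define x where "x = norm z"
    have x: "0 < x" "r < x" using z C(2) by (auto simp: x_def)
    have xD: "of_real x \<in> D" using C(3)[of "of_real x"] x by auto
    have "norm (2 * E s z - 2 * E s (of_real x)) \<le> C / x ^ 2 * x * pi"
      unfolding x_def
    proof (rule reachable_circle(2)[where D = D and g = ?g])
      show "norm (?g w) \<le> C / (norm z)\<^sup>2" if "w \<in> Cplus" "norm w = norm z" for w
        using C(3)[of w] that z by simp
    qed (use z C(3) int xD continuous_on_integrand in \<open>auto simp: x_def\<close>)
    also have "\<dots> = C / x * pi" using x by (simp add: power2_eq_square)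
    also have "\<dots> \<le> C / x * 4" using C(1) x pi_less_4 by (intro mult_left_mono) auto
    finally have 1: "norm (2 * E s z - 2 * E s (of_real x)) \<le> 4 * C / x" by (simp add: mult.commute)
    have "2 * E s (of_real x) = - integral {x..} (\<lambda>v. ?g (of_real v))"
      by (rule integral_from_infinity_of_real[OF x(1) xD int[OF xD]])
    \<comment> \<open>Without integrability the value of \<open>integral\<close> is 0 and the bound
      is trivial.\<close>
    moreover have "norm (integral {x..} (\<lambda>v. ?g (of_real v))) \<le> C / x"
    proof (cases "(\<lambda>v. ?g (of_real v)) integrable_on {x..}")
      case True
      have "((\<lambda>v. C * (1 / v ^ 2)) has_integral C * (1 / (real (2 - 1) * x ^ (2 - 1)))) {x..}"
        by (intro has_integral_mult_right has_integral_inverse_power_to_inf) (use x in auto)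
      then have bd: "((\<lambda>v. C / v ^ 2) has_integral C / x) {x..}" by simp
      have "norm (?g (of_real v)) \<le> C / v ^ 2" if "v \<in> {x..}" for v
        using C(3)[of "of_real v"] that x by auto
      from integral_norm_bound_integral[OF True has_integral_integrable[OF bd] this]
      show ?thesis by (simp only: integral_unique[OF bd])
    qed (use C(1) x in \<open>simp add: not_integrable_integral\<close>)
    ultimately have 2: "norm (2 * E s (of_real x)) \<le> C / x" by simp
    have "norm (2 * E s z) \<le> norm (2 * E s z - 2 * E s (of_real x)) + norm (2 * E s (of_real x))"
      using norm_triangle_ineq[of "2 * E s z - 2 * E s (of_real x)" "2 * E s (of_real x)"] by simp
    also have "\<dots> \<le> 5 * C / x" using 1 2 by (simp add: add_divide_distrib[symmetric])
    also have "\<dots> \<le> 6 * C / x" using C(1) x by (intro divide_right_mono) auto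
    finally have "norm (2 * E s z) \<le> 2 * (3 * C / x)" by simp
    then show ?thesis unfolding norm_mult x_def by simp
  qed
  show ?thesis
  proof (rule Lim_null_comparison[OF _ tendsto_norm_near_infinity])
    show "\<forall>\<^sub>F z in near_infinity. norm (E s z) \<le> 3 * C / norm z"
      unfolding eventually_near_infinity using C(2) bound by blast
  qed
qed

text \<open>The limit 1/2 comes from the factor \<open>z\<close> to the power 1/2 in
  \<open>q\<close>; it matches the 1/2 in the exponent \<open>\<mu> + 1/2\<close> of
  \<open>M\<close>.\<close>

lemma theta_near_0:
  assumes ev: "\<forall>\<^sub>F z in near_0. z \<in> D"
  shows "(\<theta> \<longlongrightarrow> 1/2) near_0"
proof -
  have "((\<lambda>z. (1 - z * (z - 2 * of_real lam) / (Z z)\<^sup>2) / Z z) \<longlongrightarrow> (1 - 0 * (0 - 2 * of_real lam) / 2\<^sup>2) / 2) near_0"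
    by (intro tendsto_divide tendsto_diff tendsto_mult tendsto_power tendsto_const tendsto_near_0 Z_near_0[OF ev]) auto
  then show ?thesis unfolding \<theta>_def[abs_def] by simp
qed

lemma inverse_Z_near_infinity:
  assumes ev: "\<forall>\<^sub>F z in near_infinity. z \<in> D"
  shows "((\<lambda>z. 1 / Z z) \<longlongrightarrow> 0) near_infinity"
proof -
  have "((\<lambda>z. inverse z / (Z z / z)) \<longlongrightarrow> 0 / 1) near_infinity"
    by (rule tendsto_divide[OF tendsto_near_infinity Z_near_infinity[OF ev]]) simp
  moreover have "\<forall>\<^sub>F z in near_infinity. inverse z / (Z z / z) = 1 / Z z"
    using ev by eventually_elim (use nonzero in \<open>auto simp: divide_simps\<close>)
  ultimately show ?thesis using Lim_transform_eventually by fastforce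
qed

lemma theta_near_infinity:
  assumes ev: "\<forall>\<^sub>F z in near_infinity. z \<in> D"
  shows "(\<theta> \<longlongrightarrow> 0) near_infinity"
proof -
  have "((\<lambda>z. (1 - (1 - 2 * of_real lam * inverse z) / (Z z / z)\<^sup>2) * (1 / Z z)) \<longlongrightarrow> (1 - (1 - 2 * of_real lam * 0) / 1\<^sup>2) * 0) near_infinity"
    by (intro tendsto_divide[where b = "1\<^sup>2"] tendsto_diff tendsto_mult tendsto_power tendsto_const tendsto_near_infinity
        Z_near_infinity[OF ev] inverse_Z_near_infinity[OF ev]) simp_all
  moreover have "\<forall>\<^sub>F z in near_infinity. (1 - (1 - 2 * of_real lam * inverse z) / (Z z / z)\<^sup>2) * (1 / Z z) = \<theta> z"
    using ev
  proof eventually_elim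
    case (elim z)
    have "(1 - 2 * of_real lam * inverse z) / (Z z / z)\<^sup>2 = z * (z - 2 * of_real lam) / (Z z)\<^sup>2"
      using nonzero[OF elim] by (simp add: divide_simps power2_eq_square)
    then show ?case by (simp add: \<theta>_def)
  qed
  ultimately show ?thesis using Lim_transform_eventually by fastforce
qed

end

section \<open>Start values\<close>

lemma tendsto_Ln_of_real:
  assumes "(f \<longlongrightarrow> of_real t) F" "0 < (t::real)"
  shows "((\<lambda>x. Ln (f x)) \<longlongrightarrow> of_real (ln t)) F"
  using tendsto_Ln[OF assms(1)] assms(2) by (simp add: Ln_of_real)

lemma norm_near_0: "filterlim norm (at_right 0) near_0"
  unfolding near_0_def filterlim_at
proof
  show "\<forall>\<^sub>F x in at 0 within Cplus. norm x \<in> {0<..} \<and> norm x \<noteq> 0"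
    by (auto simp: eventually_at_filter)
  show "(norm \<longlongrightarrow> 0) (at 0 within Cplus)"
    using tendsto_norm_zero[OF tendsto_near_0] by (simp add: near_0_def)
qed

lemma norm_near_infinity: "filterlim norm at_top near_infinity"
  unfolding near_infinity_def by (rule filterlim_mono[OF filterlim_norm_at_top order_refl inf_le1])

context liouville_branches
begin

lemma Ln_near_0:
  assumes ev: "\<forall>\<^sub>F z in near_0. z \<in> D"
  shows "((\<lambda>z. Ln (Z z + z - 2 * of_real lam)) \<longlongrightarrow> of_real (ln (2 - 2 * lam))) near_0"
    and "((\<lambda>z. Ln (Z z - of_real lam * z + 2)) \<longlongrightarrow> of_real (ln 4)) near_0"
proof -
  have limZ: "(Z \<longlongrightarrow> of_real 2) near_0" using Z_near_0[OF ev] by simp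
  show "((\<lambda>z. Ln (Z z + z - 2 * of_real lam)) \<longlongrightarrow> of_real (ln (2 - 2 * lam))) near_0"
  proof -
    have "((\<lambda>z. Z z + z - 2 * of_real lam) \<longlongrightarrow> of_real 2 + 0 - 2 * of_real lam) near_0"
      by (intro tendsto_add tendsto_diff limZ tendsto_near_0 tendsto_const)
    moreover have "(of_real 2 + 0 - 2 * of_real lam :: complex) = of_real (2 - 2 * lam)" by simp
    ultimately have "((\<lambda>z. Z z + z - 2 * of_real lam) \<longlongrightarrow> of_real (2 - 2 * lam)) near_0" by simp
    then show ?thesis by (rule tendsto_Ln_of_real) (use lam in simp)
  qed
  show "((\<lambda>z. Ln (Z z - of_real lam * z + 2)) \<longlongrightarrow> of_real (ln 4)) near_0"
  proof -
    have "((\<lambda>z. Z z - of_real lam * z + 2) \<longlongrightarrow> of_real 2 - of_real lam * 0 + 2) near_0"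
      by (intro tendsto_add tendsto_diff tendsto_mult limZ tendsto_near_0 tendsto_const)
    then have "((\<lambda>z. Z z - of_real lam * z + 2) \<longlongrightarrow> of_real 4) near_0" by simp
    then show ?thesis by (rule tendsto_Ln_of_real) simp
  qed
qed

text \<open>Rationalizing: \<open>(Z - z) (Z + z) = Zsq - z^2 = 4 - 4 lam z\<close>, and
  \<open>Z + z\<close> is \<open>z\<close> times a quantity that tends to 2.\<close>

lemma Z_minus_z_near_infinity:
  assumes ev: "\<forall>\<^sub>F z in near_infinity. z \<in> D"
  shows "((\<lambda>z. Z z - z) \<longlongrightarrow> - 2 * of_real lam) near_infinity"
proof -
  have ZI: "((\<lambda>z. Z z / z) \<longlongrightarrow> of_real 1) near_infinity" using Z_near_infinity[OF ev] by simp
  show "((\<lambda>z. Z z - z) \<longlongrightarrow> - 2 * of_real lam) near_infinity"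
  proof -
    have "((\<lambda>z. (- 4 * of_real lam + 4 * inverse z) / (Z z / z + 1)) \<longlongrightarrow> (- 4 * of_real lam + 4 * 0) / (of_real 1 + 1)) near_infinity"
      by (intro tendsto_divide[where b = "of_real 1 + 1"] tendsto_add tendsto_mult tendsto_const ZI tendsto_near_infinity) simp
    moreover have "\<forall>\<^sub>F z in near_infinity. (- 4 * of_real lam + 4 * inverse z) / (Z z / z + 1) = Z z - z"
      using ev pos_real_if_near[OF ZI zero_less_one]
    proof eventually_elim
      case (elim z)
      have "0 < Re (Z z / z + 1)" using elim(2) by simp
      then have nz: "Z z / z + 1 \<noteq> 0" by (rule nonzero_if_Re_pos)
      have "(Z z - z) * (Z z + z) = z * (- 4 * of_real lam + 4 * inverse z)"
        using Z_sq[OF elim(1)] nonzero[OF elim(1)] by (simp add: Zsq_def algebra_simps power2_eq_square)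
      moreover have "Z z + z = z * (Z z / z + 1)" using nonzero[OF elim(1)] by (simp add: distrib_left)
      ultimately have "z * ((Z z - z) * (Z z / z + 1)) = z * (- 4 * of_real lam + 4 * inverse z)" by (simp add: mult_ac)
      then have "(Z z - z) * (Z z / z + 1) = - 4 * of_real lam + 4 * inverse z"
        using nonzero(1)[OF elim(1)] mult_left_cancel by blast
      then show ?case using nz by (simp add: divide_eq_eq)
    qed
    ultimately have "((\<lambda>z. Z z - z) \<longlongrightarrow> (- 4 * of_real lam + 4 * 0) / (of_real 1 + 1)) near_infinity"
      by (rule Lim_transform_eventually)
    then show ?thesis by simp
  qed
qed

lemma Ln_near_infinity:
  assumes ev: "\<forall>\<^sub>F z in near_infinity. z \<in> D"
  shows "((\<lambda>z. Ln (Z z / z + 1 - 2 * of_real lam * inverse z)) \<longlongrightarrow> of_real (ln 2)) near_infinity"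
    and "((\<lambda>z. Ln (Z z / z - of_real lam + 2 * inverse z)) \<longlongrightarrow> of_real (ln (1 - lam))) near_infinity"
proof -
  have ZI: "((\<lambda>z. Z z / z) \<longlongrightarrow> of_real 1) near_infinity" using Z_near_infinity[OF ev] by simp
  show "((\<lambda>z. Ln (Z z / z + 1 - 2 * of_real lam * inverse z)) \<longlongrightarrow> of_real (ln 2)) near_infinity"
  proof -
    have "((\<lambda>z. Z z / z + 1 - 2 * of_real lam * inverse z) \<longlongrightarrow> of_real 1 + 1 - 2 * of_real lam * 0) near_infinity"
      by (intro tendsto_add tendsto_diff tendsto_mult ZI tendsto_near_infinity tendsto_const)
    then have "((\<lambda>z. Z z / z + 1 - 2 * of_real lam * inverse z) \<longlongrightarrow> of_real 2) near_infinity" by simp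
    then show ?thesis by (rule tendsto_Ln_of_real) simp
  qed
  show "((\<lambda>z. Ln (Z z / z - of_real lam + 2 * inverse z)) \<longlongrightarrow> of_real (ln (1 - lam))) near_infinity"
  proof -
    have "((\<lambda>z. Z z / z - of_real lam + 2 * inverse z) \<longlongrightarrow> of_real 1 - of_real lam + 2 * 0) near_infinity"
      by (intro tendsto_add tendsto_diff tendsto_mult ZI tendsto_near_infinity tendsto_const)
    then have "((\<lambda>z. Z z / z - of_real lam + 2 * inverse z) \<longlongrightarrow> of_real (1 - lam)) near_infinity" by simp
    then show ?thesis by (rule tendsto_Ln_of_real) (use lam in simp)
  qed
qed

text \<open>\<open>Re \<xi>\<close> equals \<open>ln (norm z)\<close> up to a convergent term. The
  divergence fixes the direction in which \<open>Re \<xi>\<close> is monotonic on a path that starts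
  at 0.\<close>

lemma xi_near_0:
  assumes ev: "\<forall>\<^sub>F z in near_0. z \<in> D"
  shows "filterlim (\<lambda>z. Re (\<xi> z)) at_bot near_0"
proof -
  let ?b = "\<lambda>z. Z z / 2 - of_real lam * Ln (Z z + z - 2 * of_real lam) - Ln (Z z - of_real lam * z + 2)"
  have "(?b \<longlongrightarrow> 2 / 2 - of_real lam * of_real (ln (2 - 2 * lam)) - of_real (ln 4)) near_0"
    by (intro tendsto_diff tendsto_mult tendsto_divide tendsto_const Ln_near_0 Z_near_0 ev) simp
  from tendsto_minus[OF tendsto_Re[OF this]]
  have "filterlim (\<lambda>z. - Re (?b z) + - ln (norm z)) at_top near_0"
    by (rule filterlim_tendsto_add_at_top)
       (use filterlim_compose[OF ln_at_0 norm_near_0] in \<open>simp add: filterlim_uminus_at_bot\<close>)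
  moreover have "\<forall>\<^sub>F z in near_0. - Re (?b z) + - ln (norm z) = - Re (\<xi> z)"
    using branches_near_0[OF ev] ev by eventually_elim (use nonzero in simp)
  ultimately have "filterlim (\<lambda>z. - Re (\<xi> z)) at_top near_0"
    by (simp cong: filterlim_cong)
  then show ?thesis by (simp add: filterlim_uminus_at_bot)
qed

text \<open>\<open>\<xi>\<close> is \<open>z / 2 - lam Ln z\<close> up to a convergent term, so its
  real part depends on the direction in which infinity is approached; the hypothesis on
  \<open>Arg\<close> makes \<open>Re z\<close> comparable with \<open>norm z\<close>.\<close>

lemma xi_at_infinity:
  fixes p :: "real \<Rightarrow> complex"
  assumes ev: "\<forall>\<^sub>F z in near_infinity. z \<in> D"
    and p: "filterlim p near_infinity Fl" and Arg: "((\<lambda>\<tau>. Arg (p \<tau>)) \<longlongrightarrow> 0) Fl"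
  shows "filterlim (\<lambda>\<tau>. Re (\<xi> (p \<tau>))) at_top Fl"
proof -
  let ?l1 = "\<lambda>z. Ln (Z z / z + 1 - 2 * of_real lam * inverse z)" and ?l2 = "\<lambda>z. Ln (Z z / z - of_real lam + 2 * inverse z)"
  let ?b = "\<lambda>z. (Z z - z) / 2 - of_real lam * ?l1 z - ?l2 z"
  have "(?b \<longlongrightarrow> (- 2 * of_real lam) / 2 - of_real lam * of_real (ln 2) - of_real (ln (1 - lam))) near_infinity"
    by (intro tendsto_diff[of "\<lambda>z. (Z z - z) / 2 - of_real lam * ?l1 z"] tendsto_diff[of "\<lambda>z. (Z z - z) / 2"]
        tendsto_mult tendsto_divide tendsto_const Ln_near_infinity Z_minus_z_near_infinity ev) simp
  from filterlim_compose[OF tendsto_Re[OF this] p]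
  have b: "((\<lambda>\<tau>. Re (?b (p \<tau>))) \<longlongrightarrow> Re ((- 2 * of_real lam) / 2 - of_real lam * of_real (ln 2) - of_real (ln (1 - lam)))) Fl" .
  \<comment> \<open>Eventually \<open>Re z \<ge> norm z / 2\<close>, so \<open>Re z / 2\<close> is
    at least \<open>norm z / 4\<close>, while
    \<open>lam * ln (norm z) \<le> ln (norm z)\<close>.\<close>
  have "filterlim (\<lambda>r::real. r / 4 - ln r) at_top at_top" by real_asymp
  from filterlim_tendsto_add_at_top[OF b filterlim_compose[OF this filterlim_compose[OF norm_near_infinity p]]]
  have "filterlim (\<lambda>\<tau>. Re (?b (p \<tau>)) + (norm (p \<tau>) / 4 - ln (norm (p \<tau>)))) at_top Fl" .
  then show ?thesis
  proof (rule filterlim_at_top_mono)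
    have "((\<lambda>\<tau>. cos (Arg (p \<tau>))) \<longlongrightarrow> cos 0) Fl" by (rule tendsto_cos[OF Arg])
    then have "\<forall>\<^sub>F \<tau> in Fl. 1/2 < cos (Arg (p \<tau>))" by (rule order_tendstoD) simp
    moreover have "\<forall>\<^sub>F \<tau> in Fl. 1 \<le> norm (p \<tau>)"
      using filterlim_compose[OF norm_near_infinity p] by (simp add: filterlim_at_top)
    moreover have "\<forall>\<^sub>F \<tau> in Fl. p \<tau> \<in> D" using ev p by (rule eventually_compose_filterlim)
    moreover have "\<forall>\<^sub>F \<tau> in Fl. \<xi> (p \<tau>) = Z (p \<tau>) / 2 - of_real lam * (Ln (p \<tau>) + ?l1 (p \<tau>)) - ?l2 (p \<tau>)"
      using eventually_compose_filterlim[OF branches_near_infinity[OF ev] p] by eventually_elim blast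
    ultimately show "\<forall>\<^sub>F \<tau> in Fl. Re (?b (p \<tau>)) + (norm (p \<tau>) / 4 - ln (norm (p \<tau>))) \<le> Re (\<xi> (p \<tau>))"
    proof eventually_elim
      case (elim \<tau>)
      let ?z = "p \<tau>"
      have "Re ?z = norm ?z * cos (Arg ?z)" using arg_cong[OF rcis_cmod_Arg[of ?z], of Re] by simp
      also have "\<dots> \<ge> norm ?z * (1/2)" using elim(1) by (intro mult_left_mono) auto
      finally have "norm ?z / 2 \<le> Re ?z" by simp
      moreover have "lam * ln (norm ?z) \<le> ln (norm ?z)"
        using lam elim(2) by (intro mult_left_le_one_le) auto
      moreover have "\<xi> ?z = ?b ?z + ?z / 2 - of_real lam * Ln ?z"
        unfolding elim(4) by (simp add: algebra_simps diff_divide_distrib)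
      then have "Re (\<xi> ?z) = Re (?b ?z) + Re ?z / 2 - lam * ln (norm ?z)"
        using nonzero[OF elim(3)] by (simp add: Re_Ln)
      ultimately show ?case by linarith
    qed
  qed
qed

end

context liouville_solution
begin

text \<open>\<open>\<phi>\<close> is the exponent of the known asymptotic form of \<open>Y\<close>.
  With \<open>exp (\<phi>)\<close> inserted and removed, \<open>h\<close> becomes a product of two
  factors with limit 1. In \<open>k\<close> two terms remain: the derivative of
  \<open>Y exp (- \<phi>)\<close>, and the mismatch of the logarithmic derivatives of
  \<open>exp (\<phi>)\<close> and of the approximate solution.\<close>

lemma start_values:
  assumes ev: "\<forall>\<^sub>F z in Fl. z \<in> D"
    and A: "((\<lambda>z. A z * exp (\<phi> (w z))) \<longlongrightarrow> 1) Fl"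
    and \<phi>: "\<And>v. (\<phi> has_field_derivative \<phi>' v) (at v)"
    and y: "((\<lambda>z. Y (w z) * exp (- \<phi> (w z))) \<longlongrightarrow> 1) Fl"
    and y': "((\<lambda>z. deriv (\<lambda>v. Y v * exp (- \<phi> v)) (w z)) \<longlongrightarrow> 0) Fl"
    and inverse_Z: "((\<lambda>z. 1 / Z z) \<longlongrightarrow> l) Fl"
    and log_deriv: "((\<lambda>z. 2 * \<phi>' (w z) / Z z - (\<theta> z + of_real u + \<sigma> z)) \<longlongrightarrow> 0) Fl"
  shows "(h \<longlongrightarrow> 1) Fl" "(k \<longlongrightarrow> 0) Fl"
proof -
  have h_eq: "h z = A z * exp (\<phi> (w z)) * (Y (w z) * exp (- \<phi> (w z)))" for z
    by (simp add: h_def exp_minus)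
  have "((\<lambda>z. A z * exp (\<phi> (w z)) * (Y (w z) * exp (- \<phi> (w z)))) \<longlongrightarrow> 1 * 1) Fl"
    by (intro tendsto_mult A y)
  then show "(h \<longlongrightarrow> 1) Fl" unfolding h_eq[abs_def] by simp
  have deriv: "deriv (\<lambda>v. Y v * exp (- \<phi> v)) v = deriv Y v * exp (- \<phi> v) - \<phi>' v * (Y v * exp (- \<phi> v))" for v
    by (rule DERIV_imp_deriv) (auto intro!: derivative_eq_intros whittaker_second_deriv(1)[OF Y] \<phi>)
  have k_eq: "k z = A z * exp (\<phi> (w z)) * (2 * (1 / Z z) * deriv (\<lambda>v. Y v * exp (- \<phi> v)) (w z)
      + (2 * \<phi>' (w z) / Z z - (\<theta> z + of_real u + \<sigma> z)) * (Y (w z) * exp (- \<phi> (w z))))" for z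
  proof -
    have alg: "a * (2 * y1 / b - T * y0) = a * e * (2 * (1 / b) * (y1 * e' - f * (y0 * e')) + (2 * f / b - T) * (y0 * e'))"
      if "e * e' = 1" for a b y1 y0 T e e' f :: complex
    proof -
      have "a * e * (2 * (1 / b) * (y1 * e' - f * (y0 * e')) + (2 * f / b - T) * (y0 * e')) =
          a * (e * e') * (2 * y1 / b - T * y0)"
        by (simp add: algebra_simps)
      also have "\<dots> = a * (2 * y1 / b - T * y0)" using that by simp
      finally show ?thesis ..
    qed
    show ?thesis unfolding k_def deriv by (rule alg) (simp add: exp_minus)
  qed
  have "((\<lambda>z. A z * exp (\<phi> (w z)) * (2 * (1 / Z z) * deriv (\<lambda>v. Y v * exp (- \<phi> v)) (w z)
      + (2 * \<phi>' (w z) / Z z - (\<theta> z + of_real u + \<sigma> z)) * (Y (w z) * exp (- \<phi> (w z))))) \<longlongrightarrow> 1 * (2 * l * 0 + 0 * 1)) Fl"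
    by (intro tendsto_mult tendsto_add A y y' inverse_Z log_deriv tendsto_const)
  then show "(k \<longlongrightarrow> 0) Fl" unfolding k_eq[abs_def] by simp
qed

lemma sigma_tendsto:
  assumes "\<And>s. (F s \<longlongrightarrow> 0) Fl" shows "(\<sigma> \<longlongrightarrow> 0) Fl"
proof -
  have "((\<lambda>z. \<Sum>s=1..N-1. F s z / of_real u ^ s) \<longlongrightarrow> (\<Sum>s=1..N-1. 0 / of_real u ^ s)) Fl"
    using u_nonzero by (intro tendsto_sum tendsto_divide assms tendsto_const) auto
  then show ?thesis by (simp add: \<sigma>_def[abs_def])
qed

lemma Re_w: "z \<in> D \<Longrightarrow> Re (w z) = ln \<mu> + ln (norm z)" and Im_w: "z \<in> D \<Longrightarrow> Im (w z) = Im (Ln z)"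
  using w_eq nonzero by simp_all

text \<open>At 0 the difference \<open>\<xi> - Ln z\<close> tends to
  \<open>1 - lam ln (2 - 2 lam) - ln 4\<close>, and \<open>Z\<close> tends to 2. The powers of
  \<open>z\<close> cancel in \<open>A exp (\<phi>)\<close>, and \<open>c_eq\<close> says that the
  remaining constant is 1.\<close>

lemma start_values_M:
  assumes ev: "\<forall>\<^sub>F z in near_0. z \<in> D" and u_eq: "u = \<mu>"
    and M: "is_whittaker_M (lam * \<mu>) \<mu> Y"
    and E: "\<And>s. 1 \<le> s \<Longrightarrow> (E s \<longlongrightarrow> l s) near_0"
    and c_eq: "c * exp (of_real \<mu> * (1 - of_real lam * of_real (ln (2 - 2 * lam)) - of_real (ln 4)) + (\<Sum>s=1..N-1. l s / of_real \<mu> ^ s))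
      = exp ((of_real \<mu> + 1/2) * of_real (ln \<mu>)) * csqrt 2"
  shows "(h \<longlongrightarrow> 1) near_0" "(k \<longlongrightarrow> 0) near_0"
proof -
  let ?\<phi> = "\<lambda>v. (of_real \<mu> + 1/2) * v"
  have w_lim: "filterlim w (filtercomap Re at_bot) near_0"
  proof -
    have "filterlim (\<lambda>x. ln \<mu> + x) at_bot at_bot" by real_asymp
    from filterlim_compose[OF this filterlim_compose[OF ln_at_0 norm_near_0]]
    have "filterlim (\<lambda>z. ln \<mu> + ln (norm z)) at_bot near_0" .
    moreover have "\<forall>\<^sub>F z in near_0. ln \<mu> + ln (norm z) = Re (w z)"
      using ev by eventually_elim (simp add: Re_w)
    ultimately have "filterlim (\<lambda>z. Re (w z)) at_bot near_0"
      by (simp cong: filterlim_cong)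
    then show ?thesis by (simp add: filterlim_filtercomap_iff o_def)
  qed
  have Ylim: "((\<lambda>v. Y v * exp (- ?\<phi> v)) \<longlongrightarrow> 1) (filtercomap Re at_bot)"
  proof -
    have "(\<lambda>v. Y v / exp (?\<phi> v)) = (\<lambda>v. Y v * exp (- ?\<phi> v))"
      unfolding exp_minus divide_inverse[of "Y _"] ..
    then show ?thesis using M unfolding is_whittaker_M_def by (simp only:)
  qed
  have hol: "(\<lambda>v. Y v * exp (- ?\<phi> v)) holomorphic_on UNIV"
    using Y unfolding whittaker_solution_def by (intro holomorphic_intros) auto
  have dlim: "(deriv (\<lambda>v. Y v * exp (- ?\<phi> v)) \<longlongrightarrow> 0) (filtercomap Re at_bot)"
  proof (rule deriv_tendsto_0[OF hol Ylim])
    fix P :: "complex \<Rightarrow> bool" assume "eventually P (filtercomap Re at_bot)"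
    then obtain b where b: "\<And>v. Re v \<le> b \<Longrightarrow> P v"
      unfolding eventually_filtercomap eventually_at_bot_linorder by blast
    show "\<forall>\<^sub>F w in filtercomap Re at_bot. \<forall>v\<in>cball w 1. P v"
      unfolding eventually_filtercomap eventually_at_bot_linorder
    proof (intro exI conjI allI impI ballI)
      show "x \<le> b - 1 \<Longrightarrow> x \<le> b - 1" for x .
      fix w v :: complex assume "Re w \<le> b - 1" "v \<in> cball w 1"
      moreover have "Re v \<le> Re w + norm (v - w)" using complex_Re_le_cmod[of "v - w"] by simp
      ultimately show "P v" by (intro b) (simp add: dist_norm norm_minus_commute)
    qed
  qed
  have limZ: "(Z \<longlongrightarrow> of_real 2) near_0" using Z_near_0[OF ev] by simp
  have csq: "((\<lambda>z. csqrt (Z z)) \<longlongrightarrow> csqrt (of_real 2)) near_0"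
    by (rule isCont_tendsto_compose[OF _ limZ]) (simp add: continuous_at_csqrt)
  note l1 = Ln_near_0(1)[OF ev] and l2 = Ln_near_0(2)[OF ev]
  let ?e = "\<lambda>z. of_real \<mu> * (Z z / 2 - of_real lam * Ln (Z z + z - 2 * of_real lam) - Ln (Z z - of_real lam * z + 2))
      + (\<Sum>s=1..N-1. E s z / of_real \<mu> ^ s)"
  let ?l = "of_real \<mu> * (of_real 2 / 2 - of_real lam * of_real (ln (2 - 2 * lam)) - of_real (ln 4)) + (\<Sum>s=1..N-1. l s / of_real \<mu> ^ s) :: complex"
  have "((\<lambda>z. exp ((of_real \<mu> + 1/2) * of_real (ln \<mu>)) * csqrt (Z z) / (c * exp (?e z))) \<longlongrightarrow>
      exp ((of_real \<mu> + 1/2) * of_real (ln \<mu>)) * csqrt (of_real 2) / (c * exp ?l)) near_0"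
    using c \<mu> by (intro tendsto_mult tendsto_divide tendsto_exp tendsto_add tendsto_diff tendsto_sum tendsto_const csq l1 l2 limZ E) auto
  moreover have "exp ((of_real \<mu> + 1/2) * of_real (ln \<mu>)) * csqrt (of_real 2) / (c * exp ?l) = 1"
  proof -
    have "c * exp ?l = exp ((of_real \<mu> + 1/2) * of_real (ln \<mu>)) * csqrt (of_real 2)" using c_eq by simp
    moreover have "c * exp ?l \<noteq> 0" using c by simp
    ultimately show ?thesis by (metis divide_self)
  qed
  moreover have "\<forall>\<^sub>F z in near_0. exp ((of_real \<mu> + 1/2) * of_real (ln \<mu>)) * csqrt (Z z) / (c * exp (?e z)) = A z * exp (?\<phi> (w z))"
    using branches_near_0[OF ev] ev
  proof eventually_elim
    case (elim z)
    then have xi: "\<xi> z = Z z / 2 - of_real lam * Ln (Z z + z - 2 * of_real lam) - Ln (Z z - of_real lam * z + 2) + Ln z"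
      and q: "q z = exp (Ln z / 2) / csqrt (Z z)" and z: "z \<in> D" by auto
    have "of_real u * \<xi> z + (\<Sum>s=1..N-1. E s z / of_real u ^ s) = ?e z + of_real \<mu> * Ln z"
      unfolding xi u_eq by (simp add: algebra_simps)
    moreover have "?\<phi> (w z) = (of_real \<mu> + 1/2) * of_real (ln \<mu>) + of_real \<mu> * Ln z + Ln z / 2"
      unfolding w_eq[OF z] by (simp add: algebra_simps)
    ultimately show ?case
      unfolding A_def q using nonzero[OF z] c by (simp add: exp_add)
  qed
  ultimately have A: "((\<lambda>z. A z * exp (?\<phi> (w z))) \<longlongrightarrow> 1) near_0"
    using Lim_transform_eventually by fastforce
  have iZ: "((\<lambda>z. 1 / Z z) \<longlongrightarrow> 1 / of_real 2) near_0"
    by (intro tendsto_divide tendsto_const limZ) simp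
  have "((\<lambda>z. 2 * (of_real \<mu> + 1/2) / Z z - (\<theta> z + of_real u + \<sigma> z)) \<longlongrightarrow>
      2 * (of_real \<mu> + 1/2) / of_real 2 - (1/2 + of_real u + 0)) near_0"
    by (intro tendsto_diff tendsto_add tendsto_divide tendsto_const limZ theta_near_0 sigma_tendsto F_tendsto_near_0 ev) simp
  moreover have "2 * (of_real \<mu> + 1/2) / of_real 2 - (1/2 + of_real u + 0) = (0 :: complex)"
    by (simp add: u_eq add_divide_distrib)
  ultimately have ld: "((\<lambda>z. 2 * (of_real \<mu> + 1/2) / Z z - (\<theta> z + of_real u + \<sigma> z)) \<longlongrightarrow> 0) near_0"
    by (simp only:)
  have d\<phi>: "(?\<phi> has_field_derivative (of_real \<mu> + 1/2)) (at v)" for v by (auto intro!: derivative_eq_intros)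
  show "(h \<longlongrightarrow> 1) near_0" "(k \<longlongrightarrow> 0) near_0"
    using start_values[OF ev A d\<phi> filterlim_compose[OF Ylim w_lim] filterlim_compose[OF dlim w_lim] iZ ld] by blast+
qed

lemma start_values_W:
  assumes ev: "\<forall>\<^sub>F z in near_infinity. z \<in> D" and u_eq: "u = - \<mu>"
    and W: "is_whittaker_W (lam * \<mu>) \<mu> Y"
    and c_eq: "c = exp (of_real (lam * \<mu> * ln \<mu> - lam * \<mu> - lam * \<mu> * ln 2 - \<mu> * ln (1 - lam)))"
  shows "(h \<longlongrightarrow> 1) near_infinity" "(k \<longlongrightarrow> 0) near_infinity"
proof -
  define \<kappa> where "\<kappa> = lam * \<mu>"
  let ?\<phi> = "\<lambda>v. of_real \<kappa> * v - exp v / 2"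
  let ?F = "\<lambda>b. inf (filtercomap Re at_top) (principal {v. \<bar>Im v\<bar> \<le> b})"
  have eventually_F: "eventually P (?F b) \<longleftrightarrow> (\<exists>a. \<forall>v. a \<le> Re v \<and> \<bar>Im v\<bar> \<le> b \<longrightarrow> P v)" for P b
    unfolding eventually_inf_principal eventually_filtercomap eventually_at_top_linorder by auto
  have w_lim: "filterlim w (?F pi) near_infinity"
  proof -
    from filterlim_compose[OF ln_at_top norm_near_infinity]
    have "filterlim (\<lambda>z. ln \<mu> + ln (norm z)) at_top near_infinity"
      by (rule filterlim_tendsto_add_at_top[OF tendsto_const])
    moreover have "\<forall>\<^sub>F z in near_infinity. ln \<mu> + ln (norm z) = Re (w z)"
      using ev by eventually_elim (simp add: Re_w)
    ultimately have "filterlim (\<lambda>z. Re (w z)) at_top near_infinity"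
      by (simp cong: filterlim_cong)
    then have "filterlim w (filtercomap Re at_top) near_infinity" by (simp add: filterlim_filtercomap_iff o_def)
    moreover have "\<forall>\<^sub>F z in near_infinity. w z \<in> {v. \<bar>Im v\<bar> \<le> pi}"
      using ev
    proof eventually_elim
      case (elim z)
      then show ?case using Im_w[OF elim] Cplus_polar[of z] nonzero[OF elim] by (auto simp: Arg_def abs_le_iff)
    qed
    ultimately show ?thesis by (simp add: filterlim_inf filterlim_principal)
  qed
  have "\<forall>\<epsilon>>0. ((\<lambda>v. Y v / exp (of_real \<kappa> * v - exp v / 2)) \<longlongrightarrow> 1) (?F (3/2 * pi - \<epsilon>))"
    using W unfolding is_whittaker_W_def \<kappa>_def by blast
  \<comment> \<open>The choice \<open>\<epsilon> = \<pi> / 2 - 1\<close> yields the strip of half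
    width \<open>\<pi> + 1\<close>, which contains the unit discs around all points with imaginary
    part at most \<open>\<pi>\<close> in modulus.\<close>
  moreover have "0 < pi / 2 - 1" using pi_gt3 by simp
  ultimately have "((\<lambda>v. Y v / exp (of_real \<kappa> * v - exp v / 2)) \<longlongrightarrow> 1) (?F (3/2 * pi - (pi / 2 - 1)))"
    by blast
  moreover have "3/2 * pi - (pi / 2 - 1) = pi + 1" by simp
  moreover have "(\<lambda>v. Y v / exp (of_real \<kappa> * v - exp v / 2)) = (\<lambda>v. Y v * exp (- ?\<phi> v))"
    unfolding exp_minus divide_inverse[of "Y _"] ..
  ultimately have Ylim: "((\<lambda>v. Y v * exp (- ?\<phi> v)) \<longlongrightarrow> 1) (?F (pi + 1))" by (simp only:)
  have hol: "(\<lambda>v. Y v * exp (- ?\<phi> v)) holomorphic_on UNIV"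
    using Y unfolding whittaker_solution_def by (intro holomorphic_intros) auto
  have dlim: "(deriv (\<lambda>v. Y v * exp (- ?\<phi> v)) \<longlongrightarrow> 0) (?F pi)"
  proof (rule deriv_tendsto_0[OF hol Ylim])
    fix P :: "complex \<Rightarrow> bool" assume "eventually P (?F (pi + 1))"
    then obtain a where a: "\<And>v. a \<le> Re v \<Longrightarrow> \<bar>Im v\<bar> \<le> pi + 1 \<Longrightarrow> P v"
      unfolding eventually_F by blast
    show "\<forall>\<^sub>F w in ?F pi. \<forall>v\<in>cball w 1. P v"
      unfolding eventually_F
    proof (intro exI[of _ "a + 1"] allI impI ballI)
      fix w v :: complex assume w: "a + 1 \<le> Re w \<and> \<bar>Im w\<bar> \<le> pi" and "v \<in> cball w 1"
      then have "norm (v - w) \<le> 1" by (simp add: dist_norm norm_minus_commute)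
      then have "\<bar>Re (v - w)\<bar> \<le> 1" "\<bar>Im (v - w)\<bar> \<le> 1"
        using abs_Re_le_cmod[of "v - w"] abs_Im_le_cmod[of "v - w"] by linarith+
      then show "P v" using w by (intro a) auto
    qed
  qed
  have Ylim': "((\<lambda>v. Y v * exp (- ?\<phi> v)) \<longlongrightarrow> 1) (?F pi)"
    by (rule tendsto_mono[OF _ Ylim]) (intro inf_mono order_refl, auto)
  have ZI: "((\<lambda>z. Z z / z) \<longlongrightarrow> of_real 1) near_infinity" using Z_near_infinity[OF ev] by simp
  have csq: "((\<lambda>z. csqrt (Z z / z)) \<longlongrightarrow> csqrt (of_real 1)) near_infinity"
    by (rule isCont_tendsto_compose[OF _ ZI]) (simp add: continuous_at_csqrt)
  note diff = Z_minus_z_near_infinity[OF ev]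
  note l1 = Ln_near_infinity(1)[OF ev] and l2 = Ln_near_infinity(2)[OF ev]
  let ?e = "\<lambda>z. of_real (\<kappa> * ln \<mu>) + of_real \<mu> * (Z z - z) / 2 - of_real \<kappa> * Ln (Z z / z + 1 - 2 * of_real lam * inverse z)
      - of_real \<mu> * Ln (Z z / z - of_real lam + 2 * inverse z) - (\<Sum>s=1..N-1. E s z / of_real u ^ s)"
  let ?l = "of_real (\<kappa> * ln \<mu>) + of_real \<mu> * (- 2 * of_real lam) / 2 - of_real \<kappa> * of_real (ln 2)
      - of_real \<mu> * of_real (ln (1 - lam)) - (\<Sum>s=1..N-1. 0 / of_real u ^ s) :: complex"
  have "((\<lambda>z. exp (?e z) * csqrt (Z z / z) / c) \<longlongrightarrow> exp ?l * csqrt (of_real 1) / c) near_infinity"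
    using c u_nonzero by (intro tendsto_mult tendsto_divide tendsto_exp tendsto_add tendsto_diff tendsto_sum tendsto_const csq l1 l2 diff E_near_infinity ev) auto
  moreover have "exp ?l * csqrt (of_real 1) / c = 1"
  proof -
    have "?l = of_real (lam * \<mu> * ln \<mu> - lam * \<mu> - lam * \<mu> * ln 2 - \<mu> * ln (1 - lam))" by (simp add: \<kappa>_def)
    from arg_cong[OF this, of exp] have "exp ?l = c" unfolding c_eq .
    then show ?thesis using c by simp
  qed
  moreover have "\<forall>\<^sub>F z in near_infinity. exp (?e z) * csqrt (Z z / z) / c = A z * exp (?\<phi> (w z))"
    using branches_near_infinity[OF ev] ev
  proof eventually_elim
    case (elim z)
    let ?l1 = "Ln (Z z / z + 1 - 2 * of_real lam * inverse z)" and ?l2 = "Ln (Z z / z - of_real lam + 2 * inverse z)"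
    from elim have xi: "\<xi> z = Z z / 2 - of_real lam * (Ln z + ?l1) - ?l2"
      and q: "q z = 1 / csqrt (Z z / z)" and z: "z \<in> D" by auto
    let ?S = "\<Sum>s=1..N-1. E s z / of_real u ^ s"
    have "?\<phi> (w z) = of_real \<kappa> * (of_real (ln \<mu>) + Ln z) - of_real \<mu> * z / 2"
      unfolding exp_w[OF z] unfolding w_eq[OF z] ..
    then have e: "?\<phi> (w z) - (of_real u * \<xi> z + ?S) = ?e z"
      unfolding xi u_eq \<kappa>_def by (simp add: algebra_simps add_divide_distrib diff_divide_distrib)
    have "exp (?e z) = exp (?\<phi> (w z)) / exp (of_real u * \<xi> z + ?S)"
      unfolding e[symmetric] by (rule exp_diff)
    then show ?case unfolding A_def q by (simp add: mult_ac)
  qed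
  ultimately have A: "((\<lambda>z. A z * exp (?\<phi> (w z))) \<longlongrightarrow> 1) near_infinity"
    using Lim_transform_eventually by fastforce
  have iZ: "((\<lambda>z. 1 / Z z) \<longlongrightarrow> 0) near_infinity" by (rule inverse_Z_near_infinity[OF ev])
  \<comment> \<open>As \<open>u = - \<mu>\<close> and \<open>exp (w z) = \<mu> z\<close>, the large
    terms combine to \<open>\<mu> (Z - z)\<close>, which stays bounded, and division by
    \<open>Z\<close> makes it vanish at infinity.\<close>
  have "((\<lambda>z. (2 * of_real \<kappa> + of_real \<mu> * (Z z - z)) * (1 / Z z) - \<theta> z - \<sigma> z) \<longlongrightarrow>
      (2 * of_real \<kappa> + of_real \<mu> * (- 2 * of_real lam)) * 0 - 0 - 0) near_infinity"
    by (intro tendsto_diff tendsto_add tendsto_mult tendsto_const diff iZ theta_near_infinity sigma_tendsto F_tendsto_near_infinity ev)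
  moreover have "\<forall>\<^sub>F z in near_infinity. (2 * of_real \<kappa> + of_real \<mu> * (Z z - z)) * (1 / Z z) - \<theta> z - \<sigma> z =
     2 * (of_real \<kappa> - exp (w z) / 2) / Z z - (\<theta> z + of_real u + \<sigma> z)"
    using ev
  proof eventually_elim
    case (elim z)
    have "(2 * of_real \<kappa> + of_real \<mu> * (Z z - z)) * (1 / Z z) = (2 * of_real \<kappa> - of_real \<mu> * z) / Z z + of_real \<mu>"
      using nonzero[OF elim] by (simp add: divide_simps) (simp add: algebra_simps)
    then show ?case unfolding exp_w[OF elim] u_eq by (simp add: right_diff_distrib)
  qed
  ultimately have ld: "((\<lambda>z. 2 * (of_real \<kappa> - exp (w z) / 2) / Z z - (\<theta> z + of_real u + \<sigma> z)) \<longlongrightarrow> 0) near_infinity"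
    using Lim_transform_eventually by fastforce
  have d\<phi>: "(?\<phi> has_field_derivative (of_real \<kappa> - exp v / 2)) (at v)" for v by (auto intro!: derivative_eq_intros)
  show "(h \<longlongrightarrow> 1) near_infinity" "(k \<longlongrightarrow> 0) near_infinity"
    using start_values[OF ev A d\<phi> filterlim_compose[OF Ylim' w_lim] filterlim_compose[OF dlim w_lim] iZ ld] by blast+
qed

end

section \<open>The expansions\<close>

text \<open>A progressive path may by definition be monotonic in either sense; divergence at the
  starting end decides which.\<close>

lemma mono_on_if_tendsto_at_bot:
  fixes f :: "real \<Rightarrow> real"
  assumes "mono_on {0<..1} f \<or> antimono_on {0<..1} f" "filterlim f at_bot (at_right 0)"
  shows "mono_on {0<..1} f"
  using assms(1)
proof
  assume anti: "antimono_on {0<..1} f"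
  have "\<forall>\<^sub>F \<tau> in at_right 0. f \<tau> \<le> f 1 - 1" using assms(2) by (simp add: filterlim_at_bot)
  moreover have "\<forall>\<^sub>F \<tau> in at_right 0. \<tau> \<in> {0<..<1::real}" by (rule eventually_at_right_real) simp
  ultimately have "\<forall>\<^sub>F \<tau> in at_right (0::real). False"
  proof eventually_elim
    case (elim \<tau>)
    then have "f 1 \<le> f \<tau>" by (intro monotone_onD[OF anti]) auto
    with elim(1) show False by simp
  qed
  then show ?thesis by simp
qed

text \<open>Here \<open>h\<close> is the relative error of the expansion with \<open>n + r\<close>
  and \<open>exp X\<close> collects the terms moved into the error factor. The split is
  \<open>h exp X - 1 = (exp X - 1) + exp X (h - 1)\<close>, with
  \<open>norm (exp X) = exp (Re X)\<close>.\<close>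

lemma error_term_bound:
  fixes h X :: complex
  assumes "norm (h - 1) \<le> \<omega> * exp (v + \<omega>')"
  shows "norm (h * exp X - 1) \<le> norm (exp X - 1) + \<omega> * exp (v + Re X + \<omega>')"
proof -
  have "h * exp X - 1 = (exp X - 1) + exp X * (h - 1)" by (simp add: algebra_simps)
  also have "norm \<dots> \<le> norm (exp X - 1) + exp (Re X) * norm (h - 1)"
    by (rule order.trans[OF norm_triangle_ineq]) (simp add: norm_mult)
  also have "exp (Re X) * norm (h - 1) \<le> exp (Re X) * (\<omega> * exp (v + \<omega>'))"
    by (intro mult_left_mono assms) simp
  also have "\<dots> = \<omega> * exp (v + Re X + \<omega>')" by (simp add: exp_add)
  finally show ?thesis by simp
qed

lemma sum_split_at:
  fixes f :: "nat \<Rightarrow> complex"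
  assumes "1 \<le> n"
  shows "(\<Sum>s=1..n + r - 1. f s) = (\<Sum>s=1..n - 1. f s) + (\<Sum>s=n..n + r - 1. f s)"
proof -
  have "{1..n + r - 1} = {1..n - 1} \<union> {n..n + r - 1}" using assms by auto
  then show ?thesis by (simp add: sum.union_disjoint ivl_disj_int)
qed

lemma away_from_subset:
  assumes "\<delta> > 0" shows "away_from (Cplus \<inter> A) \<delta> \<subseteq> Cplus - A"
proof
  fix z assume "z \<in> away_from (Cplus \<inter> A) \<delta>"
  then have z: "z \<in> Cplus" "\<delta> \<le> infdist z (Cplus \<inter> A)" by (auto simp: away_from_def)
  then have "z \<notin> A" using assms by (auto dest: infdist_zero)
  with z show "z \<in> Cplus - A" by simp
qed

text \<open>By their definition the curves are closed only relative to \<open>Cplus\<close>, which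
  omits 0. \<open>K1\<close> and \<open>K2\<close> are closed in the plane and have the curves as
  traces on \<open>Cplus\<close>.\<close>

definition "K1 lam = closure (S_0 lam) \<inter> closure (S_1 lam)"
definition "K2 lam = closure (S_m1 lam) \<inter> closure (S_1 lam)"

lemma gamma_eq: "gamma1 lam = Cplus \<inter> K1 lam" "gamma2 lam = Cplus \<inter> K2 lam"
  and D_eq: "D1 lam = Cplus - K1 lam" "D2 lam = Cplus - K2 lam"
  and closed_K: "closed (K1 lam)" "closed (K2 lam)"
  by (auto simp: gamma1_def gamma2_def D1_def D2_def K1_def K2_def)

context liouville_solution
begin

lemma M_path_bound:
  assumes ev: "\<forall>\<^sub>F z in near_0. z \<in> D" and u_eq: "u = \<mu>" and M: "is_whittaker_M (lam * \<mu>) \<mu> Y"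
    and E: "\<And>s. 1 \<le> s \<Longrightarrow> (E s \<longlongrightarrow> l s) near_0"
    and c_eq: "c * exp (of_real \<mu> * (1 - of_real lam * of_real (ln (2 - 2 * lam)) - of_real (ln 4)) + (\<Sum>s=1..N-1. l s / of_real \<mu> ^ s))
      = exp ((of_real \<mu> + 1/2) * of_real (ln \<mu>)) * csqrt 2"
    and prog: "progressive lam \<delta> D B p" "starts_at_0 p" and fin: "finite_integrals lam D Z N p"
  shows "norm (h (p 1) - 1) \<le> omega lam D Z N \<mu> p / \<mu> ^ N *
     exp (varpi lam D Z N \<mu> p / \<mu> + omega lam D Z N \<mu> p / \<mu> ^ N)"
proof -
  have chain: "R2_chain p" and pD: "p ` {0<..1} \<subseteq> D"
    and mono: "mono_on {0<..1} (\<lambda>\<tau>. Re (\<xi> (p \<tau>))) \<or> antimono_on {0<..1} (\<lambda>\<tau>. Re (\<xi> (p \<tau>)))"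
    using prog(1) by (simp_all add: progressive_def)
  have p: "filterlim p near_0 (at_right 0)"
    unfolding near_0_def filterlim_at
  proof
    have "\<forall>\<^sub>F \<tau> in at_right 0. \<tau> \<in> {0<..<1::real}" by (rule eventually_at_right_real) simp
    then show "\<forall>\<^sub>F \<tau> in at_right 0. p \<tau> \<in> Cplus \<and> p \<tau> \<noteq> 0"
    proof eventually_elim
      case (elim \<tau>)
      then have "\<tau> \<in> {0<..1}" by simp
      then have "p \<tau> \<in> D" using pD by blast
      then show ?case by (simp add: Cplus_eq)
    qed
    show "(p \<longlongrightarrow> 0) (at_right 0)" using prog(2) by (simp add: starts_at_0_def)
  qed
  have "mono_on {0<..1} (\<lambda>\<tau>. Re (\<xi> (p \<tau>)))"
    by (rule mono_on_if_tendsto_at_bot[OF mono filterlim_compose[OF xi_near_0[OF ev] p]])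
  then have mono': "mono_on {0<..1} (\<lambda>\<tau>. u * Re (\<xi> (p \<tau>)))"
    using \<mu> unfolding u_eq by (auto simp: monotone_on_def)
  note start = start_values_M[OF ev u_eq M E c_eq]
  show ?thesis
    by (rule path_bound[OF chain pD mono' fin eventually_compose_filterlim[OF eventually_reachable_near_0[OF ev] p]
        filterlim_compose[OF start(1) p] filterlim_compose[OF start(2) p]])
qed

text \<open>\<open>Re \<xi>\<close> tends to infinity at the starting end and hence is nonincreasing
  along the path, so that \<open>u = - \<mu>\<close> gives the monotonicity required for the
  damping.\<close>

lemma W_path_bound:
  assumes ev: "\<forall>\<^sub>F z in near_infinity. z \<in> D" and u_eq: "u = - \<mu>" and W: "is_whittaker_W (lam * \<mu>) \<mu> Y"
    and c_eq: "c = exp (of_real (lam * \<mu> * ln \<mu> - lam * \<mu> - lam * \<mu> * ln 2 - \<mu> * ln (1 - lam)))"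
    and prog: "progressive lam \<delta> D B p" "starts_at_plus_infinity p" and fin: "finite_integrals lam D Z N p"
  shows "norm (h (p 1) - 1) \<le> omega lam D Z N \<mu> p / \<mu> ^ N *
     exp (varpi lam D Z N \<mu> p / \<mu> + omega lam D Z N \<mu> p / \<mu> ^ N)"
proof -
  have chain: "R2_chain p" and pD: "p ` {0<..1} \<subseteq> D"
    and mono: "mono_on {0<..1} (\<lambda>\<tau>. Re (\<xi> (p \<tau>))) \<or> antimono_on {0<..1} (\<lambda>\<tau>. Re (\<xi> (p \<tau>)))"
    using prog(1) by (simp_all add: progressive_def)
  have p: "filterlim p near_infinity (at_right 0)"
    unfolding near_infinity_def filterlim_inf filterlim_principal
  proof
    have "\<forall>\<^sub>F \<tau> in at_right 0. \<tau> \<in> {0<..<1::real}" by (rule eventually_at_right_real) simp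
    then show "\<forall>\<^sub>F \<tau> in at_right 0. p \<tau> \<in> Cplus"
    proof eventually_elim
      case (elim \<tau>)
      then have "\<tau> \<in> {0<..1}" by simp
      then show ?case using pD by blast
    qed
    show "filterlim p at_infinity (at_right 0)" using prog(2) by (simp add: starts_at_plus_infinity_def)
  qed
  have Arg: "((\<lambda>\<tau>. Arg (p \<tau>)) \<longlongrightarrow> 0) (at_right 0)" using prog(2) by (simp add: starts_at_plus_infinity_def)
  have "filterlim (\<lambda>\<tau>. - Re (\<xi> (p \<tau>))) at_bot (at_right 0)"
    using xi_at_infinity[OF ev p Arg] by (simp add: filterlim_uminus_at_top)
  moreover have "mono_on {0<..1} (\<lambda>\<tau>. - Re (\<xi> (p \<tau>))) \<or> antimono_on {0<..1} (\<lambda>\<tau>. - Re (\<xi> (p \<tau>)))"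
    using mono by (auto simp: monotone_on_def)
  ultimately have "mono_on {0<..1} (\<lambda>\<tau>. - Re (\<xi> (p \<tau>)))" by (intro mono_on_if_tendsto_at_bot)
  then have mono': "mono_on {0<..1} (\<lambda>\<tau>. u * Re (\<xi> (p \<tau>)))"
    using \<mu> unfolding u_eq by (auto simp: monotone_on_def)
  note start = start_values_W[OF ev u_eq W c_eq]
  show ?thesis
    by (rule path_bound[OF chain pD mono' fin eventually_compose_filterlim[OF eventually_reachable_near_infinity[OF ev] p]
        filterlim_compose[OF start(1) p] filterlim_compose[OF start(2) p]])
qed

lemma solution_eq:
  assumes "z \<in> D"
  shows "Y (w z) = h z * (c * q z * exp (of_real u * \<xi> z + (\<Sum>s=1..N-1. E s z / of_real u ^ s)))"
  using q_nonzero[OF assms] c by (simp add: h_def A_def)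

end

text \<open>The turning point lies in \<open>K2\<close>, so the closure of \<open>S_m1\<close> is
  not empty and \<open>regions_near_0\<close> applies. Near 0 there are then no points of
  \<open>S_1\<close> or \<open>gamma2\<close>, so the continued branches coincide with the principal
  ones; this transfers the limits \<open>E_at_0\<close>, which are defined by the principal
  branches.\<close>

lemma branches_agree_near_0:
  assumes lam: "0 \<le> lam" "lam < 1" and P: "principal_branches lam P" and C: "continued_branches lam P C"
  shows "\<forall>\<^sub>F z in near_0. z \<in> D1 lam \<and> z \<in> D2 lam \<and> (\<forall>s\<ge>1. bE C s z = bE P s z)"
    and "\<forall>\<^sub>F z in near_infinity. z \<in> D2 lam"
    and "at 0 within D2 lam = near_0"
proof -
  interpret P: liouville_branches lam "K2 lam" P
    by standard (use lam P closed_K in \<open>simp_all add: principal_branches_def D_eq\<close>)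
  have "S_m1 lam \<noteq> {}" using P.zplus_K by (auto simp: K2_def)
  moreover obtain r where r: "0 < r" "level_set lam \<inter> ball 0 r = {}" using level_set_near_0[OF lam] by blast
  ultimately have bd: "bounded (S_m1 lam)" and S1: "S_1 lam \<inter> ball 0 r = {}" using regions_near_0 by blast+
  have "ball 0 r \<inter> closure (S_1 lam) = {}"
    using S1 open_Int_closure_eq_empty[OF open_ball, of 0 r "S_1 lam"] by (simp add: Int_commute)
  then have K: "ball 0 r \<inter> K1 lam = {}" "ball 0 r \<inter> K2 lam = {}" by (auto simp: K1_def K2_def)
  have D: "z \<in> D1 lam \<and> z \<in> D2 lam \<and> (\<forall>s\<ge>1. bE C s z = bE P s z)" if z: "z \<in> Cplus \<inter> ball 0 r" for z
  proof -
    have "z \<in> D1 lam" "z \<in> D2 lam" using z K unfolding D_eq by blast+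
    moreover have "z \<in> D1 lam - (S_1 lam \<union> gamma2 lam)"
      using z S1 K \<open>z \<in> D1 lam\<close> unfolding gamma_eq by blast
    ultimately show ?thesis using C unfolding continued_branches_def by blast
  qed
  then show "\<forall>\<^sub>F z in near_0. z \<in> D1 lam \<and> z \<in> D2 lam \<and> (\<forall>s\<ge>1. bE C s z = bE P s z)"
    unfolding eventually_near_0 using r(1) by blast
  obtain b where b: "b > 0" "closure (S_m1 lam) \<subseteq> ball 0 b"
    using bounded_subset_ballD[OF bounded_closure[OF bd], of 0] by blast
  have "z \<in> D2 lam" if "z \<in> Cplus" "b < norm z" for z
    using that b(2) unfolding D_eq K2_def by auto
  then show "\<forall>\<^sub>F z in near_infinity. z \<in> D2 lam"
    unfolding eventually_near_infinity using b(1) by blast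
  have "D2 lam \<inter> ball 0 r - {0} = Cplus \<inter> ball 0 r - {0}"
    using D unfolding D_eq by blast
  then show "at 0 within D2 lam = near_0"
    unfolding near_0_def using r(1) by (intro at_within_nhd[of 0 "ball 0 r"]) auto
qed

lemma M_expansion:
  assumes "\<delta> > 0" "1 \<le> n" "1 \<le> r" and \<mu>: "\<mu> > 0" and lam: "0 \<le> lam" "lam < 1"
    and M: "is_whittaker_M (lam * \<mu>) \<mu> M" and P: "principal_branches lam P" and C: "continued_branches lam P C"
  shows "\<exists>\<eta>1. \<forall>z\<in>Z1_region lam \<delta>.
        M (Ln (of_real \<mu> * z)) =
          of_real ((4 * \<mu>) powr \<mu> * (2 * (1 - lam)) powr (lam * \<mu>)) *
          (of_real (sqrt (2 * \<mu>)) * bq C z) *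
          exp (of_real \<mu> * (bxi C z - 1) +
               (\<Sum>s=1..n-1. (bE C s z - E_at_0 lam P s) / of_real \<mu> ^ s)) *
          (1 + \<eta>1 z) \<and>
        (\<forall>p. progressive1 lam \<delta> C p z \<and> finite_integrals lam (D1 lam) (bZ C) (n + r) p \<longrightarrow>
          norm (\<eta>1 z) \<le>
            norm (exp (\<Sum>s=n..n+r-1. (bE C s z - E_at_0 lam P s) / of_real \<mu> ^ s) - 1) +
            omega lam (D1 lam) (bZ C) (n + r) \<mu> p / \<mu> ^ (n + r) *
            exp (varpi lam (D1 lam) (bZ C) (n + r) \<mu> p / \<mu> +
                 (\<Sum>s=n..n+r-1. (Re (bE C s z) - Re (E_at_0 lam P s)) / \<mu> ^ s) +
                 omega lam (D1 lam) (bZ C) (n + r) \<mu> p / \<mu> ^ (n + r)))"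
proof -
  note agree = branches_agree_near_0[OF lam P C]
  interpret P: liouville_branches lam "K2 lam" P
    by standard (use lam P closed_K in \<open>simp_all add: principal_branches_def D_eq\<close>)
  define E0 where "E0 = E_at_0 lam P"
  have ev2: "\<forall>\<^sub>F z in near_0. z \<in> P.D" using agree(1) unfolding D_eq by eventually_elim blast
  have E_lim: "(bE C s \<longlongrightarrow> E0 s) near_0" if s: "1 \<le> s" for s
  proof -
    obtain l where l: "(bE P s \<longlongrightarrow> l) near_0" using P.E_near_0[OF ev2 s] by blast
    then have "E0 s = l"
      unfolding E0_def E_at_0_def agree(3) by (rule tendsto_Lim[OF near_0_neq_bot])
    moreover have "\<forall>\<^sub>F z in near_0. bE P s z = bE C s z"
      using agree(1) by eventually_elim (use s in simp)
    ultimately show ?thesis using Lim_transform_eventually[OF l] by simp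
  qed
  define X0 where "X0 = (\<Sum>s=1..n+r-1. E0 s / of_real \<mu> ^ s)"
  define c0 where "c0 = (4 * \<mu>) powr \<mu> * (2 * (1 - lam)) powr (lam * \<mu>)"
  \<comment> \<open>All factors independent of \<open>z\<close>: the prefactors, the
    \<open>- 1\<close> in \<open>\<mu> (\<xi> - 1)\<close>, and the values \<open>E_s\<close> at
    0.\<close>
  define c where "c = of_real c0 * of_real (sqrt (2 * \<mu>)) * exp (- of_real \<mu> - X0)"
  interpret liouville_solution lam "K1 lam" C \<mu> \<mu> M c "n + r"
    by standard (use lam C \<mu> M closed_K assms in
      \<open>simp_all add: continued_branches_def D_eq is_whittaker_M_def c_def c0_def\<close>)
  have ev: "\<forall>\<^sub>F z in near_0. z \<in> D" using agree(1) unfolding D_eq by eventually_elim blast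
  have c_eq: "c * exp (of_real \<mu> * (1 - of_real lam * of_real (ln (2 - 2 * lam)) - of_real (ln 4)) + X0)
      = exp ((of_real \<mu> + 1/2) * of_real (ln \<mu>)) * csqrt 2"
  proof -
    have "c0 = exp (\<mu> * ln (4 * \<mu>) + lam * \<mu> * ln (2 - 2 * lam))"
      using \<mu> lam by (simp add: c0_def powr_def exp_add)
    also have "ln (4 * \<mu>) = ln 4 + ln \<mu>" using \<mu> by (simp add: ln_mult)
    finally have c0: "c0 * exp (- \<mu> * lam * ln (2 - 2 * lam) - \<mu> * ln 4) = exp (\<mu> * ln \<mu>)"
      by (simp add: exp_add[symmetric] algebra_simps)
    have "sqrt \<mu> = exp (ln \<mu> / 2)" using \<mu> by (simp add: powr_half_sqrt[symmetric] powr_def)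
    then have sq: "sqrt (2 * \<mu>) = sqrt 2 * exp (ln \<mu> / 2)" by (simp add: real_sqrt_mult)
    have "c * exp (of_real \<mu> * (1 - of_real lam * of_real (ln (2 - 2 * lam)) - of_real (ln 4)) + X0)
       = of_real (c0 * exp (- \<mu> * lam * ln (2 - 2 * lam) - \<mu> * ln 4)) * of_real (sqrt (2 * \<mu>))"
    proof -
      have "(- of_real \<mu> - X0) + (of_real \<mu> * (1 - of_real lam * of_real (ln (2 - 2 * lam)) - of_real (ln 4)) + X0)
         = of_real (- \<mu> * lam * ln (2 - 2 * lam) - \<mu> * ln 4)"
        by (simp add: algebra_simps)
      then have prod: "exp (- of_real \<mu> - X0) * exp (of_real \<mu> * (1 - of_real lam * of_real (ln (2 - 2 * lam)) - of_real (ln 4)) + X0)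
         = exp (of_real (- \<mu> * lam * ln (2 - 2 * lam) - \<mu> * ln 4))"
        unfolding exp_add[symmetric] by (rule arg_cong)
      show ?thesis unfolding c_def mult.assoc prod by (simp only: exp_of_real of_real_mult mult_ac)
    qed
    also have "\<dots> = of_real (exp (\<mu> * ln \<mu> + ln \<mu> / 2)) * of_real (sqrt 2)"
      unfolding c0 sq by (simp add: exp_add mult_ac)
    also have "\<mu> * ln \<mu> + ln \<mu> / 2 = (\<mu> + 1/2) * ln \<mu>" by (simp add: distrib_right)
    also have "of_real (exp ((\<mu> + 1/2) * ln \<mu>)) = exp ((of_real \<mu> + 1/2) * of_real (ln \<mu>) :: complex)"
      by (simp add: exp_of_real[symmetric])
    also have "of_real (sqrt 2) = csqrt 2" by simp
    finally show ?thesis .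
  qed
  define X where "X z = (\<Sum>s=n..n+r-1. (bE C s z - E0 s) / of_real \<mu> ^ s)" for z
  show ?thesis
    unfolding E0_def[symmetric]
  \<comment> \<open>\<open>h\<close> belongs to the exponent with all terms up to
    \<open>n + r - 1\<close>; keeping only those below \<open>n\<close> in front makes the error
    factor \<open>h exp X\<close>.\<close>
  proof (intro exI[of _ "\<lambda>z. h z * exp (X z) - 1"] ballI conjI allI impI)
    fix z assume "z \<in> Z1_region lam \<delta>"
    then have z: "z \<in> D" using away_from_subset[OF \<open>\<delta> > 0\<close>, of "K1 lam"] unfolding Z1_region_def gamma_eq by blast
    have "(\<Sum>s=1..n+r-1. E s z / of_real \<mu> ^ s) - X0 = (\<Sum>s=1..n+r-1. (bE C s z - E0 s) / of_real \<mu> ^ s)"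
      unfolding X0_def by (simp add: sum_subtractf diff_divide_distrib)
    also have "\<dots> = (\<Sum>s=1..n-1. (bE C s z - E0 s) / of_real \<mu> ^ s) + X z"
      unfolding X_def by (rule sum_split_at[OF \<open>1 \<le> n\<close>])
    finally have exps: "(- of_real \<mu> - X0) + (of_real \<mu> * \<xi> z + (\<Sum>s=1..n+r-1. E s z / of_real \<mu> ^ s)) =
       (of_real \<mu> * (\<xi> z - 1) + (\<Sum>s=1..n-1. (bE C s z - E0 s) / of_real \<mu> ^ s)) + X z"
      by (simp add: algebra_simps)
    have "M (w z) = h z * (of_real c0 * of_real (sqrt (2 * \<mu>)) * q z *
        (exp (- of_real \<mu> - X0) * exp (of_real \<mu> * \<xi> z + (\<Sum>s=1..n+r-1. E s z / of_real \<mu> ^ s))))"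
      unfolding solution_eq[OF z] c_def by (simp add: mult_ac)
    also have "\<dots> = of_real c0 * (of_real (sqrt (2 * \<mu>)) * q z) *
        exp (of_real \<mu> * (\<xi> z - 1) + (\<Sum>s=1..n-1. (bE C s z - E0 s) / of_real \<mu> ^ s)) * (1 + (h z * exp (X z) - 1))"
      unfolding exp_add[symmetric] exps unfolding exp_add by (simp add: mult_ac)
    finally show "M (w z) = of_real ((4 * \<mu>) powr \<mu> * (2 * (1 - lam)) powr (lam * \<mu>)) * (of_real (sqrt (2 * \<mu>)) * q z) *
        exp (of_real \<mu> * (\<xi> z - 1) + (\<Sum>s=1..n-1. (bE C s z - E0 s) / of_real \<mu> ^ s)) * (1 + (h z * exp (X z) - 1))"
      unfolding c0_def .
    fix p assume p: "progressive1 lam \<delta> C p z \<and> finite_integrals lam (D1 lam) Z (n + r) p"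
    have bound: "norm (h (p 1) - 1) \<le> omega lam D Z (n + r) \<mu> p / \<mu> ^ (n + r) *
        exp (varpi lam D Z (n + r) \<mu> p / \<mu> + omega lam D Z (n + r) \<mu> p / \<mu> ^ (n + r))"
    proof (rule M_path_bound[OF ev refl M E_lim c_eq[unfolded X0_def]])
      show "progressive lam \<delta> D C p" "starts_at_0 p" "finite_integrals lam D Z (n + r) p"
        using p by (simp_all add: progressive1_def D_eq)
    qed
    have pz: "p 1 = z" using p by (simp add: progressive1_def)
    have Re_X: "Re (X z) = (\<Sum>s=n..n+r-1. (Re (bE C s z) - Re (E0 s)) / \<mu> ^ s)"
      unfolding X_def Re_sum by (intro sum.cong refl) (simp add: of_real_power[symmetric] del: of_real_power)
    show "norm (h z * exp (X z) - 1) \<le>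
        norm (exp (\<Sum>s=n..n+r-1. (bE C s z - E0 s) / of_real \<mu> ^ s) - 1) +
            omega lam (D1 lam) Z (n + r) \<mu> p / \<mu> ^ (n + r) *
            exp (varpi lam (D1 lam) Z (n + r) \<mu> p / \<mu> +
                 (\<Sum>s=n..n+r-1. (Re (bE C s z) - Re (E0 s)) / \<mu> ^ s) +
                 omega lam (D1 lam) Z (n + r) \<mu> p / \<mu> ^ (n + r))"
      using error_term_bound[OF bound, of "X z"] unfolding pz Re_X unfolding X_def D_eq .
  qed
qed

lemma W_expansion:
  assumes "\<delta> > 0" "1 \<le> n" "1 \<le> r" and \<mu>: "\<mu> > 0" and lam: "0 \<le> lam" "lam < 1"
    and W: "is_whittaker_W (lam * \<mu>) \<mu> W" and P: "principal_branches lam P" and C: "continued_branches lam P C"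
  shows "\<exists>\<eta>2. \<forall>z\<in>Z2_region lam \<delta>.
        W (Ln (of_real \<mu> * z)) =
          of_real ((\<mu> / (2 * exp 1)) powr (lam * \<mu>) * (1 / (1 - lam) powr \<mu>)) *
          bq P z *
          exp (- of_real \<mu> * bxi P z + (\<Sum>s=1..n-1. (-1) ^ s * bE P s z / of_real \<mu> ^ s)) *
          (1 + \<eta>2 z) \<and>
        (\<forall>p. progressive2 lam \<delta> P p z \<and> finite_integrals lam (D2 lam) (bZ P) (n + r) p \<longrightarrow>
          norm (\<eta>2 z) \<le>
            norm (exp (\<Sum>s=n..n+r-1. (-1) ^ s * bE P s z / of_real \<mu> ^ s) - 1) +
            omega lam (D2 lam) (bZ P) (n + r) \<mu> p / \<mu> ^ (n + r) *
            exp (varpi lam (D2 lam) (bZ P) (n + r) \<mu> p / \<mu> +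
                 (\<Sum>s=n..n+r-1. (-1) ^ s * Re (bE P s z) / \<mu> ^ s) +
                 omega lam (D2 lam) (bZ P) (n + r) \<mu> p / \<mu> ^ (n + r)))"
proof -
  define c0 where "c0 = (\<mu> / (2 * exp 1)) powr (lam * \<mu>) * (1 / (1 - lam) powr \<mu>)"
  interpret liouville_solution lam "K2 lam" P \<mu> "- \<mu>" W "of_real c0" "n + r"
    by standard (use lam P \<mu> W closed_K assms in
      \<open>simp_all add: principal_branches_def D_eq is_whittaker_W_def c0_def\<close>)
  have ev: "\<forall>\<^sub>F z in near_infinity. z \<in> D" using branches_agree_near_0(2)[OF lam P C] unfolding D_eq .
  have "c0 = exp (lam * \<mu> * ln \<mu> - lam * \<mu> - lam * \<mu> * ln 2 - \<mu> * ln (1 - lam))"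
  proof -
    have ln: "ln (\<mu> / (2 * exp 1)) = ln \<mu> - ln 2 - 1" using \<mu> by (simp add: ln_div ln_mult)
    have "c0 = exp (lam * \<mu> * ln (\<mu> / (2 * exp 1))) * (1 / exp (\<mu> * ln (1 - lam)))"
      using \<mu> lam by (simp add: c0_def powr_def)
    also have "\<dots> = exp (lam * \<mu> * ln (\<mu> / (2 * exp 1)) - \<mu> * ln (1 - lam))" by (simp add: exp_diff)
    also have "lam * \<mu> * ln (\<mu> / (2 * exp 1)) - \<mu> * ln (1 - lam) =
        lam * \<mu> * ln \<mu> - lam * \<mu> - lam * \<mu> * ln 2 - \<mu> * ln (1 - lam)"
      unfolding ln by (simp add: algebra_simps)
    finally show ?thesis .
  qed
  then have c_eq: "of_real c0 = (exp (of_real (lam * \<mu> * ln \<mu> - lam * \<mu> - lam * \<mu> * ln 2 - \<mu> * ln (1 - lam))) :: complex)"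
    by (simp only: exp_of_real)
  \<comment> \<open>The alternating signs of the expansion of \<open>W\<close> are the powers of
    \<open>u = - \<mu>\<close>.\<close>
  have alt: "x / of_real (- \<mu>) ^ s = (-1) ^ s * x / of_real \<mu> ^ s" for x :: complex and s
  proof -
    have "of_real (- \<mu>) ^ s = (-1) ^ s * (of_real \<mu> ^ s :: complex)"
      by (metis mult_minus1 of_real_minus power_mult_distrib)
    moreover have "(-1) ^ s * (-1) ^ s = (1 :: complex)" by (simp add: power_mult_distrib[symmetric])
    ultimately show ?thesis by (simp add: divide_simps)
  qed
  define X where "X z = (\<Sum>s=n..n+r-1. (-1) ^ s * bE P s z / of_real \<mu> ^ s)" for z
  show ?thesis
  proof (intro exI[of _ "\<lambda>z. h z * exp (X z) - 1"] ballI conjI allI impI)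
    fix z assume "z \<in> Z2_region lam \<delta>"
    then have z: "z \<in> D" using away_from_subset[OF \<open>\<delta> > 0\<close>, of "K2 lam"] unfolding Z2_region_def gamma_eq by blast
    have "(\<Sum>s=1..n+r-1. E s z / of_real (- \<mu>) ^ s) = (\<Sum>s=1..n-1. (-1) ^ s * bE P s z / of_real \<mu> ^ s) + X z"
      unfolding X_def alt by (rule sum_split_at[OF \<open>1 \<le> n\<close>])
    then have "W (w z) = h z * (of_real c0 * q z *
        exp ((- of_real \<mu> * \<xi> z + (\<Sum>s=1..n-1. (-1) ^ s * bE P s z / of_real \<mu> ^ s)) + X z))"
      unfolding solution_eq[OF z] by (simp only: of_real_minus mult_minus_left mult.assoc add.assoc)
    then show "W (w z) = of_real ((\<mu> / (2 * exp 1)) powr (lam * \<mu>) * (1 / (1 - lam) powr \<mu>)) * q z *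
          exp (- of_real \<mu> * \<xi> z + (\<Sum>s=1..n-1. (-1) ^ s * bE P s z / of_real \<mu> ^ s)) * (1 + (h z * exp (X z) - 1))"
      unfolding c0_def[symmetric] exp_add[of _ "X z"] by (simp add: mult_ac)
    fix p assume p: "progressive2 lam \<delta> P p z \<and> finite_integrals lam (D2 lam) Z (n + r) p"
    have bound: "norm (h (p 1) - 1) \<le> omega lam D Z (n + r) \<mu> p / \<mu> ^ (n + r) *
        exp (varpi lam D Z (n + r) \<mu> p / \<mu> + omega lam D Z (n + r) \<mu> p / \<mu> ^ (n + r))"
    proof (rule W_path_bound[OF ev refl W c_eq])
      show "progressive lam \<delta> D P p" "starts_at_plus_infinity p" "finite_integrals lam D Z (n + r) p"
        using p by (simp_all add: progressive2_def D_eq)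
    qed
    have pz: "p 1 = z" using p by (simp add: progressive2_def)
    have Re_X: "Re (X z) = (\<Sum>s=n..n+r-1. (-1) ^ s * Re (bE P s z) / \<mu> ^ s)"
    proof -
      have "X z = (\<Sum>s=n..n+r-1. of_real ((-1) ^ s / \<mu> ^ s) * bE P s z)" unfolding X_def by simp
      then show ?thesis by (simp only: Re_sum times_complex.sel Re_complex_of_real Im_complex_of_real) simp
    qed
    show "norm (h z * exp (X z) - 1) \<le>
        norm (exp (\<Sum>s=n..n+r-1. (-1) ^ s * bE P s z / of_real \<mu> ^ s) - 1) +
            omega lam (D2 lam) Z (n + r) \<mu> p / \<mu> ^ (n + r) *
            exp (varpi lam (D2 lam) Z (n + r) \<mu> p / \<mu> +
                 (\<Sum>s=n..n+r-1. (-1) ^ s * Re (bE P s z) / \<mu> ^ s) +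
                 omega lam (D2 lam) Z (n + r) \<mu> p / \<mu> ^ (n + r))"
      using error_term_bound[OF bound, of "X z"] unfolding pz Re_X unfolding X_def D_eq .
  qed
qed

theorem theorem2p1:
  fixes \<delta> :: real and n r :: nat
  assumes "\<delta> > 0" and "n \<ge> 1" and "r \<ge> 1"
  shows "\<exists>\<mu>0>0. \<forall>\<mu>\<ge>\<mu>0. \<forall>lam\<in>{0..1-\<delta>}. \<forall>\<kappa> M W P C.
     \<kappa> = lam * \<mu> \<and> is_whittaker_M \<kappa> \<mu> M \<and> is_whittaker_W \<kappa> \<mu> W \<and>
     principal_branches lam P \<and> continued_branches lam P C \<longrightarrow>
     (\<exists>\<eta>1. \<forall>z\<in>Z1_region lam \<delta>.
        M (Ln (of_real \<mu> * z)) =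
          of_real ((4 * \<mu>) powr \<mu> * (2 * (1 - lam)) powr \<kappa>) *
          (of_real (sqrt (2 * \<mu>)) * bq C z) *
          exp (of_real \<mu> * (bxi C z - 1) +
               (\<Sum>s=1..n-1. (bE C s z - E_at_0 lam P s) / of_real \<mu> ^ s)) *
          (1 + \<eta>1 z) \<and>
        (\<forall>p. progressive1 lam \<delta> C p z \<and> finite_integrals lam (D1 lam) (bZ C) (n + r) p \<longrightarrow>
          norm (\<eta>1 z) \<le>
            norm (exp (\<Sum>s=n..n+r-1. (bE C s z - E_at_0 lam P s) / of_real \<mu> ^ s) - 1) +
            omega lam (D1 lam) (bZ C) (n + r) \<mu> p / \<mu> ^ (n + r) *
            exp (varpi lam (D1 lam) (bZ C) (n + r) \<mu> p / \<mu> +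
                 (\<Sum>s=n..n+r-1. (Re (bE C s z) - Re (E_at_0 lam P s)) / \<mu> ^ s) +
                 omega lam (D1 lam) (bZ C) (n + r) \<mu> p / \<mu> ^ (n + r)))) \<and>
     (\<exists>\<eta>2. \<forall>z\<in>Z2_region lam \<delta>.
        W (Ln (of_real \<mu> * z)) =
          of_real ((\<mu> / (2 * exp 1)) powr \<kappa> * (1 / (1 - lam) powr \<mu>)) *
          bq P z *
          exp (- of_real \<mu> * bxi P z + (\<Sum>s=1..n-1. (-1) ^ s * bE P s z / of_real \<mu> ^ s)) *
          (1 + \<eta>2 z) \<and>
        (\<forall>p. progressive2 lam \<delta> P p z \<and> finite_integrals lam (D2 lam) (bZ P) (n + r) p \<longrightarrow>
          norm (\<eta>2 z) \<le>
            norm (exp (\<Sum>s=n..n+r-1. (-1) ^ s * bE P s z / of_real \<mu> ^ s) - 1) +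
            omega lam (D2 lam) (bZ P) (n + r) \<mu> p / \<mu> ^ (n + r) *
            exp (varpi lam (D2 lam) (bZ P) (n + r) \<mu> p / \<mu> +
                 (\<Sum>s=n..n+r-1. (-1) ^ s * Re (bE P s z) / \<mu> ^ s) +
                 omega lam (D2 lam) (bZ P) (n + r) \<mu> p / \<mu> ^ (n + r))))"
proof (intro exI[of _ 1] conjI[OF zero_less_one] allI impI ballI)
  fix \<mu> lam \<kappa> :: real and M W :: "complex \<Rightarrow> complex" and P C :: branches
  assume \<mu>: "1 \<le> \<mu>" and "lam \<in> {0..1 - \<delta>}" and asm: "\<kappa> = lam * \<mu> \<and> is_whittaker_M \<kappa> \<mu> M \<and> is_whittaker_W \<kappa> \<mu> W \<and>
     principal_branches lam P \<and> continued_branches lam P C"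
  \<comment> \<open>Both expansions are available for every positive \<open>\<mu>\<close>, so 1
    serves as the threshold; \<open>\<delta> > 0\<close> enters through
    \<open>lam < 1\<close>.\<close>
  then have *: "0 < \<mu>" "0 \<le> lam" "lam < 1" using assms(1) by auto
  have \<kappa>: "\<kappa> = lam * \<mu>" and M: "is_whittaker_M (lam * \<mu>) \<mu> M" and W: "is_whittaker_W (lam * \<mu>) \<mu> W"
    and PC: "principal_branches lam P" "continued_branches lam P C" using asm by auto
  show "(\<exists>\<eta>1. \<forall>z\<in>Z1_region lam \<delta>.
        M (Ln (of_real \<mu> * z)) =
          of_real ((4 * \<mu>) powr \<mu> * (2 * (1 - lam)) powr \<kappa>) *
          (of_real (sqrt (2 * \<mu>)) * bq C z) *
          exp (of_real \<mu> * (bxi C z - 1) +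
               (\<Sum>s=1..n-1. (bE C s z - E_at_0 lam P s) / of_real \<mu> ^ s)) *
          (1 + \<eta>1 z) \<and>
        (\<forall>p. progressive1 lam \<delta> C p z \<and> finite_integrals lam (D1 lam) (bZ C) (n + r) p \<longrightarrow>
          norm (\<eta>1 z) \<le>
            norm (exp (\<Sum>s=n..n+r-1. (bE C s z - E_at_0 lam P s) / of_real \<mu> ^ s) - 1) +
            omega lam (D1 lam) (bZ C) (n + r) \<mu> p / \<mu> ^ (n + r) *
            exp (varpi lam (D1 lam) (bZ C) (n + r) \<mu> p / \<mu> +
                 (\<Sum>s=n..n+r-1. (Re (bE C s z) - Re (E_at_0 lam P s)) / \<mu> ^ s) +
                 omega lam (D1 lam) (bZ C) (n + r) \<mu> p / \<mu> ^ (n + r)))) \<and>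
     (\<exists>\<eta>2. \<forall>z\<in>Z2_region lam \<delta>.
        W (Ln (of_real \<mu> * z)) =
          of_real ((\<mu> / (2 * exp 1)) powr \<kappa> * (1 / (1 - lam) powr \<mu>)) *
          bq P z *
          exp (- of_real \<mu> * bxi P z + (\<Sum>s=1..n-1. (-1) ^ s * bE P s z / of_real \<mu> ^ s)) *
          (1 + \<eta>2 z) \<and>
        (\<forall>p. progressive2 lam \<delta> P p z \<and> finite_integrals lam (D2 lam) (bZ P) (n + r) p \<longrightarrow>
          norm (\<eta>2 z) \<le>
            norm (exp (\<Sum>s=n..n+r-1. (-1) ^ s * bE P s z / of_real \<mu> ^ s) - 1) +
            omega lam (D2 lam) (bZ P) (n + r) \<mu> p / \<mu> ^ (n + r) *
            exp (varpi lam (D2 lam) (bZ P) (n + r) \<mu> p / \<mu> +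
                 (\<Sum>s=n..n+r-1. (-1) ^ s * Re (bE P s z) / \<mu> ^ s) +
                 omega lam (D2 lam) (bZ P) (n + r) \<mu> p / \<mu> ^ (n + r))))"
    unfolding \<kappa> by (intro conjI M_expansion[OF assms * M PC] W_expansion[OF assms * W PC])
qed

end
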